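(* Let $\lambda\in C^\infty(S^1)$ with $\lambda\ge0$ and let $s\ge1$ be a real number. For every sufficiently small $\epsilon>0$ there exists a continuous function $C=C(s,E,M)>0$ of the energy and mass (also allowed to depend on $\epsilon$ and on the fixed function $\lambda$) such that the following holds. For every $\Phi\in H^s(S^1)$, if $u$ is the global solution of $$iu_t+\Delta u=\lambda|u|^2u,\quad x\in S^1,\ t\in\mathbb{R},\qquad u(x,0)=\Phi(x),$$ where $\lambda=\lambda(x)$, then for all $t\in\mathbb{R}$, $$\|u(t)\|_{H^s}\le C\big(s,E(\Phi),M(\Phi)\big)\,(1+|t|)^{2s+\epsilon}\,\|\Phi\|_{H^s}.$$
   Context: $S^1=\mathbb{R}/2\pi\mathbb{Z}$; $\widehat f(n)=\int_{S^1}f(x)e^{-inx}dx$; $\langle n\rangle=\sqrt{1+|n|^2}$; $\|f\|_{H^s}=\big(\sum_{n\in\mathbb{Z}}|\widehat f(n)|^2\langle n\rangle^{2s}\big)^{1/2}$. For $\Phi\in H^s(S^1)$, $s\ge1$, the equation has a unique global solution $u\in C(\mathbb{R};H^s(S^1))$ (in the sense of Duhamel's formula). The mass and energy are $$M(f)=\int_{S^1}|f|^2dx,\qquad E(f)=\frac12\int_{S^1}|\nabla f|^2dx+\frac14\int_{S^1}\lambda|f|^4dx,$$ and are conserved by the flow. *)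

theory Defs
  imports "HOL-Analysis.Analysis"
begin

text \<open>
  Functions on the circle of length \<open>2\<pi>\<close> are represented by \<open>2\<pi>\<close>-periodic functions on the
  real line.  Elements of \<open>L\<^sup>2\<close> and \<open>H\<^sup>s\<close> are represented by Borel measurable functions, and
  equality of two elements is equality almost everywhere.
\<close>

definition circle_fun :: "(real \<Rightarrow> 'a) \<Rightarrow> bool" where
  "circle_fun f \<longleftrightarrow> (\<forall>x. f (x + 2 * pi) = f x)"

definition smooth_circle :: "(real \<Rightarrow> real) \<Rightarrow> bool" where
  "smooth_circle f \<longleftrightarrow> circle_fun f \<and> (\<forall>k x. (deriv ^^ k) f field_differentiable (at x))"

abbreviation circle_integral :: "(real \<Rightarrow> 'a::{banach, second_countable_topology}) \<Rightarrow> 'a" where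
  "circle_integral f \<equiv> (LINT x:{0..2 * pi}|lborel. f x)"

definition L2_circle :: "(real \<Rightarrow> complex) set" where
  "L2_circle = {f. circle_fun f \<and> f \<in> borel_measurable borel \<and>
     set_integrable lborel {0..2 * pi} (\<lambda>x. (cmod (f x))\<^sup>2)}"

definition fourier_coeff :: "(real \<Rightarrow> complex) \<Rightarrow> int \<Rightarrow> complex" where
  "fourier_coeff f n = circle_integral (\<lambda>x. f x * cis (- (of_int n * x)))"

definition japanese_bracket :: "int \<Rightarrow> real" where
  "japanese_bracket n = sqrt (1 + (of_int n)\<^sup>2)"

definition Hs_circle :: "real \<Rightarrow> (real \<Rightarrow> complex) set" where
  "Hs_circle s = {f \<in> L2_circle.
     (\<lambda>n. (cmod (fourier_coeff f n))\<^sup>2 * japanese_bracket n powr (2 * s)) summable_on UNIV}"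

definition Hs_norm :: "real \<Rightarrow> (real \<Rightarrow> complex) \<Rightarrow> real" where
  "Hs_norm s f =
     sqrt (\<Sum>\<^sub>\<infinity>n. (cmod (fourier_coeff f n))\<^sup>2 * japanese_bracket n powr (2 * s))"

definition is_weak_deriv :: "(real \<Rightarrow> complex) \<Rightarrow> (real \<Rightarrow> complex) \<Rightarrow> bool" where
  "is_weak_deriv f g \<longleftrightarrow> g \<in> L2_circle \<and>
     (\<forall>\<phi>. smooth_circle \<phi> \<longrightarrow>
        circle_integral (\<lambda>x. f x * of_real (deriv \<phi> x)) =
        - circle_integral (\<lambda>x. g x * of_real (\<phi> x)))"

text \<open>
  The weak derivative of an \<open>H\<^sup>1\<close> function is unique only up to a null set, hence the choice;
  the integrals below do not depend on it.
\<close>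

definition weak_deriv :: "(real \<Rightarrow> complex) \<Rightarrow> real \<Rightarrow> complex" where
  "weak_deriv f = (SOME g. is_weak_deriv f g)"

definition mass :: "(real \<Rightarrow> complex) \<Rightarrow> real" where
  "mass f = circle_integral (\<lambda>x. (cmod (f x))\<^sup>2)"

definition energy :: "(real \<Rightarrow> real) \<Rightarrow> (real \<Rightarrow> complex) \<Rightarrow> real" where
  "energy lam f = 1 / 2 * circle_integral (\<lambda>x. (cmod (weak_deriv f x))\<^sup>2)
     + 1 / 4 * circle_integral (\<lambda>x. lam x * (cmod (f x)) ^ 4)"

text \<open>
  The free propagator \<open>exp(i t \<Delta>)\<close>, the Fourier multiplier with symbol \<open>exp(- i n\<^sup>2 t)\<close>.  The
  factor \<open>1 / (2\<pi>)\<close> belongs to Fourier inversion, since \<open>fourier_coeff\<close> is not normalised.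
  The series converges absolutely for functions in \<open>H\<^sup>s\<close> with \<open>s > 1/2\<close>, and is only used there.
\<close>

definition schroedinger_propagator :: "real \<Rightarrow> (real \<Rightarrow> complex) \<Rightarrow> real \<Rightarrow> complex" where
  "schroedinger_propagator t f x =
     1 / (2 * pi) * (\<Sum>\<^sub>\<infinity>n. cis (- ((of_int n)\<^sup>2 * t)) * fourier_coeff f n * cis (of_int n * x))"

text \<open>
  A global solution of \<open>i u\<^sub>t + \<Delta>u = \<lambda>|u|\<^sup>2u\<close>, \<open>u(0) = \<Phi>\<close>, in \<open>C(\<real>; H\<^sup>s)\<close>.  In Duhamel's
  formula the \<open>H\<^sup>s\<close>-valued integral is evaluated pointwise in \<open>x\<close>, which is legitimate because
  point evaluation is continuous on \<open>H\<^sup>s\<close> for \<open>s > 1/2\<close>.  The interval integral is oriented, so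
  negative times are covered.
\<close>

definition global_NLS_solution ::
  "(real \<Rightarrow> real) \<Rightarrow> real \<Rightarrow> (real \<Rightarrow> complex) \<Rightarrow> (real \<Rightarrow> real \<Rightarrow> complex) \<Rightarrow> bool" where
  "global_NLS_solution lam s \<Phi> u \<longleftrightarrow>
     (\<forall>t. u t \<in> Hs_circle s) \<and>
     (\<forall>t\<^sub>0. ((\<lambda>t. Hs_norm s (\<lambda>x. u t x - u t\<^sub>0 x)) \<longlongrightarrow> 0) (at t\<^sub>0)) \<and>
     (\<forall>t. AE x in lborel.
        u t x = schroedinger_propagator t \<Phi> x
          - \<i> * (LBINT \<tau>=0..ereal t. schroedinger_propagator (t - \<tau>)
                (\<lambda>y. of_real (lam y * (cmod (u \<tau> y))\<^sup>2) * u \<tau> y) x))"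

end

theory Submission
  imports Defs
begin

text \<open>
  Let \<open>\<theta> n = (max 1 (\<bar>n\<bar> / N)) powr s\<close> with \<open>N = 10 K\<close>, and measure the solution by the sum of
  \<open>(\<theta> n)\<^sup>2 \<bar>c n\<bar>\<^sup>2\<close> over its Fourier coefficients \<open>c n\<close>.  Low frequencies do not contribute to its
  derivative, and the interactions that remain gain \<open>1 / sqrt K\<close>, up to powers of the conserved
  \<open>H\<^sup>1\<close> norm.  When at least two of the three factors of the nonlinearity have frequency above \<open>K\<close>,
  the gain comes from the \<open>\<ell>\<^sup>1\<close> norm of the high part; when all three are low, from the decay of the
  coefficients of \<open>\<lambda>\<close>; when exactly one is high and unconjugated, from the smoothness of the weight
  in a commutator.  The remaining term, with only the conjugated factor high, has phase
  \<open>n\<^sup>2 + m\<^sup>2 - a\<^sup>2 - b\<^sup>2\<close> of size at least \<open>K\<^sup>2\<close> and is removed by a normal form correction.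
  Gronwall's inequality over a time \<open>t\<close> with \<open>K\<close> of order \<open>(1 + \<bar>t\<bar>)\<^sup>2\<close> costs only a constant factor,
  and since \<open>\<theta> n\<close> is comparable to \<open>max 1 \<bar>n\<bar> powr s\<close> up to \<open>N powr s\<close>, the \<open>H\<^sup>s\<close> norm grows at most
  like \<open>(1 + \<bar>t\<bar>) powr (2 * s)\<close>.

  These estimates, and the conservation of mass and energy, are applied to the system of the finitely
  many coefficients with \<open>\<bar>n\<bar> \<le> L\<close>, whose error term vanishes uniformly on compact time intervals
  as \<open>L\<close> tends to infinity.
\<close>

section \<open>Weights and multilinear sums\<close>

text \<open>The rate \<open>1 / sqrt K\<close> is what an \<open>H\<^sup>1\<close> bound yields:
  Cauchy-Schwarz against \<open>1 / (1 + n\<^sup>2)\<close> makes the sum of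
  \<open>\<bar>c n\<bar>\<close> over the modes above \<open>K\<close> of that size. Weight one can
  be split off, since the pairing with constant weight is real (conservation of mass), and then only
  outputs with \<open>\<bar>n\<bar> > 10 * K\<close> remain. The factor 10 keeps them away from the
  low inputs; this forces a potential frequency of size \<open>K\<close>, or a phase of size
  \<open>K\<^sup>2\<close>. Conjugating the quartic sum exchanges its conjugated and unconjugated
  positions. A high unconjugated factor can thus trade places with the output. A high conjugated
  factor stands on the side of the output, so this symmetry gives nothing; but there the two large
  squares in the phase add up instead of cancelling. The truncation is forced: for
  \<open>H\<^sup>s\<close> data the terms \<open>n\<^sup>2 * c n\<close> need not be summable
  against the weight, so the infinite weighted sum cannot be differentiated term by term. At a fixed
  time the error only has to be small, without a rate, so continuity in \<open>H\<^sup>s\<close> and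
  compactness of the time interval suffice.\<close>

definition grow :: "real \<Rightarrow> int \<Rightarrow> real" where
  "grow N n = max 1 (\<bar>real_of_int n\<bar> / N)"

definition weight :: "real \<Rightarrow> real \<Rightarrow> int \<Rightarrow> real" where
  "weight N s n = grow N n powr s"

lemma grow_ge_1: "1 \<le> grow N n"
  by (simp add: grow_def)

lemma weight_ge_1: "0 \<le> s \<Longrightarrow> 1 \<le> weight N s n"
  unfolding weight_def using grow_ge_1[of N n] by (simp add: ge_one_powr_ge_zero)

lemma weight_nonneg: "0 \<le> weight N s n"
  by (simp add: weight_def)

lemma grow_le_bracket:
  assumes "1 \<le> N" shows "grow N n \<le> 1 + \<bar>real_of_int n\<bar>"
proof -
  have "\<bar>real_of_int n\<bar> / N \<le> \<bar>real_of_int n\<bar>" using assms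
    by (simp add: divide_le_eq mult_le_cancel_left1)
  then show ?thesis by (simp add: grow_def)
qed

lemma weight_le_bracket:
  assumes "1 \<le> N" "0 \<le> s" shows "weight N s n \<le> (1 + \<bar>real_of_int n\<bar>) powr s"
  unfolding weight_def using grow_le_bracket[OF assms(1), of n] grow_ge_1[of N n] assms
  by (intro powr_mono2) auto

lemma weight_eq_1:
  assumes "0 < N" "\<bar>real_of_int n\<bar> \<le> N" shows "weight N s n = 1"
  using assms by (simp add: weight_def grow_def max_def)

text \<open>The potential frequency \<open>l\<close> enters as a factor, so that its whole
  contribution can be charged to the decay of the potential. Each of the four summands is at most
  the product because all values of \<open>grow\<close> are at least 1.\<close>

lemma grow_add4:
  assumes "0 < N"
  shows "grow N (l + a + b - m) \<le> 4 * (grow N l * max (grow N a) (max (grow N b) (grow N m)))"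
proof -
  let ?M = "max (grow N a) (max (grow N b) (grow N m))"
  have g: "\<bar>real_of_int k\<bar> / N \<le> grow N k" for k by (simp add: grow_def)
  have 1: "1 \<le> ?M" using grow_ge_1[of N a] by simp
  have 2: "1 \<le> grow N l" by (rule grow_ge_1)
  have pl: "grow N l \<le> grow N l * ?M" using mult_left_mono[OF 1, of "grow N l"] 2 by simp
  have pm: "?M \<le> grow N l * ?M" using mult_right_mono[OF 2, of ?M] 1 by simp
  have "\<bar>real_of_int (l + a + b - m)\<bar> / N \<le>
      (\<bar>real_of_int l\<bar> + \<bar>real_of_int a\<bar> + \<bar>real_of_int b\<bar> + \<bar>real_of_int m\<bar>) / N"
    using assms by (intro divide_right_mono) auto
  also have "\<dots> \<le> grow N l + grow N a + grow N b + grow N m"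
    using g[of l] g[of a] g[of b] g[of m] by (simp add: add_divide_distrib)
  also have "\<dots> \<le> 4 * (grow N l * ?M)"
  proof -
    have "grow N a \<le> ?M" "grow N b \<le> ?M" "grow N m \<le> ?M" by auto
    then show ?thesis using pl pm by linarith
  qed
  finally show ?thesis using 1 2 pl unfolding grow_def[of N "l + a + b - m"] by linarith
qed

lemma weight_add4:
  assumes "1 \<le> N" "0 \<le> s"
  shows "weight N s (l + a + b - m) \<le>
    4 powr s * ((1 + \<bar>real_of_int l\<bar>) powr s * (weight N s a + weight N s b + weight N s m))"
proof -
  let ?M = "max (grow N a) (max (grow N b) (grow N m))"
  have M: "0 \<le> ?M" "0 \<le> grow N l" using grow_ge_1[of N a] grow_ge_1[of N l] by auto
  have "weight N s (l + a + b - m) \<le> (4 * (grow N l * ?M)) powr s"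
    unfolding weight_def using grow_add4[of N l a b m] grow_ge_1[of N "l+a+b-m"] assms
    by (intro powr_mono2) auto
  also have "\<dots> = 4 powr s * (weight N s l * ?M powr s)"
    using M by (simp add: powr_mult weight_def)
  also have "\<dots> \<le> 4 powr s * ((1 + \<bar>real_of_int l\<bar>) powr s * (weight N s a + weight N s b + weight N s m))"
  proof (intro mult_left_mono mult_mono weight_le_bracket assms)
    show "?M powr s \<le> weight N s a + weight N s b + weight N s m"
      using weight_nonneg[of N s a] weight_nonneg[of N s b] weight_nonneg[of N s m]
      unfolding weight_def max_def by auto
  qed auto
  finally show ?thesis .
qed

text \<open>Mean value theorem. The exponent \<open>p - 1\<close> of the derivative is raised to
  \<open>p\<close>, which is allowed for bases at least 1 and makes the weight itself reappear on
  the right.\<close>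

lemma powr_diff_le:
  fixes x y p :: real
  assumes "1 \<le> x" "1 \<le> y" "1 \<le> p"
  shows "\<bar>x powr p - y powr p\<bar> \<le> p * max x y powr p * \<bar>x - y\<bar>"
proof -
  have *: "\<bar>y powr p - x powr p\<bar> \<le> p * y powr p * \<bar>y - x\<bar>" if "1 \<le> x" "x < y" for x y :: real
  proof -
    have "\<exists>z. z > x \<and> z < y \<and> y powr p - x powr p = (y - x) * (p * z powr (p - 1))"
      using that by (intro MVT2) (auto intro!: has_real_derivative_powr)
    then obtain z where z: "z > x" "z < y" "y powr p - x powr p = (y - x) * (p * z powr (p - 1))" by blast
    have "z powr (p - 1) \<le> y powr (p - 1)" using z that assms by (intro powr_mono2) auto
    also have "\<dots> \<le> y powr p" using that by (intro powr_mono) auto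
    finally have "(y - x) * (p * z powr (p - 1)) \<le> (y - x) * (p * y powr p)"
      using that assms by (intro mult_left_mono) auto
    moreover have "0 \<le> (y - x) * (p * z powr (p - 1))" using that assms by auto
    ultimately show ?thesis using z that by (simp add: algebra_simps)
  qed
  consider "x < y" | "x = y" | "y < x" by linarith
  then show ?thesis
  proof cases
    case 1 then show ?thesis using *[of x y] assms by (simp add: abs_minus_commute max_def)
  next
    case 3 then show ?thesis using *[of y x] assms by (simp add: max_def)
  qed auto
qed

text \<open>Schur's test: write the kernel as the product of two square roots and apply
  Cauchy-Schwarz on the product set, using row sums for one factor and column sums for the
  other.\<close>

lemma schur_sum:
  fixes K :: "'a \<Rightarrow> 'b \<Rightarrow> real"
  assumes fin: "finite A" "finite B"
    and K: "\<And>i j. i \<in> A \<Longrightarrow> j \<in> B \<Longrightarrow> 0 \<le> K i j"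
    and row: "\<And>i. i \<in> A \<Longrightarrow> (\<Sum>j\<in>B. K i j) \<le> G" and col: "\<And>j. j \<in> B \<Longrightarrow> (\<Sum>i\<in>A. K i j) \<le> G"
    and G: "0 \<le> G"
    and h: "\<And>i. i \<in> A \<Longrightarrow> 0 \<le> h i" and k: "\<And>j. j \<in> B \<Longrightarrow> 0 \<le> k j"
  shows "(\<Sum>i\<in>A. \<Sum>j\<in>B. K i j * h i * k j) \<le> G * L2_set h A * L2_set k B"
proof -
  let ?f = "\<lambda>(i,j). sqrt (K i j) * h i" and ?g = "\<lambda>(i,j). sqrt (K i j) * k j"
  have "(\<Sum>i\<in>A. \<Sum>j\<in>B. K i j * h i * k j) = (\<Sum>p\<in>A\<times>B. \<bar>?f p\<bar> * \<bar>?g p\<bar>)"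
    unfolding sum.cartesian_product
  proof (intro sum.cong refl, clarify)
    fix i j assume ij: "i \<in> A" "j \<in> B"
    have "K i j * h i * k j = (sqrt (K i j) * sqrt (K i j)) * h i * k j" using K[OF ij] by simp
    also have "\<dots> = (sqrt (K i j) * h i) * (sqrt (K i j) * k j)" by (simp only: ac_simps)
    finally show "K i j * h i * k j = \<bar>sqrt (K i j) * h i\<bar> * \<bar>sqrt (K i j) * k j\<bar>"
      using K[OF ij] h[OF ij(1)] k[OF ij(2)] by (simp add: abs_mult)
  qed
  also have "\<dots> \<le> L2_set ?f (A\<times>B) * L2_set ?g (A\<times>B)" by (rule L2_set_mult_ineq)
  also have "\<dots> \<le> (sqrt G * L2_set h A) * (sqrt G * L2_set k B)"
  proof (intro mult_mono)
    have "(\<Sum>p\<in>A\<times>B. (?f p)\<^sup>2) = (\<Sum>i\<in>A. (h i)\<^sup>2 * (\<Sum>j\<in>B. K i j))"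
      unfolding sum_distrib_left sum.cartesian_product
      using K by (intro sum.cong) (auto simp: power_mult_distrib)
    also have "\<dots> \<le> (\<Sum>i\<in>A. (h i)\<^sup>2 * G)" by (intro sum_mono mult_left_mono row) auto
    also have "\<dots> = G * (\<Sum>i\<in>A. (h i)\<^sup>2)" by (simp add: sum_distrib_left mult_ac)
    finally show "L2_set ?f (A\<times>B) \<le> sqrt G * L2_set h A"
      unfolding L2_set_def real_sqrt_mult[symmetric] by (rule real_sqrt_le_mono)
    have "(\<Sum>p\<in>A\<times>B. (?g p)\<^sup>2) = (\<Sum>i\<in>A. \<Sum>j\<in>B. K i j * (k j)\<^sup>2)"
      unfolding sum.cartesian_product
      using K by (intro sum.cong) (auto simp: power_mult_distrib)
    also have "\<dots> = (\<Sum>j\<in>B. \<Sum>i\<in>A. K i j * (k j)\<^sup>2)" by (rule sum.swap)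
    also have "\<dots> = (\<Sum>j\<in>B. (k j)\<^sup>2 * (\<Sum>i\<in>A. K i j))"
      by (simp add: sum_distrib_left sum_distrib_right mult_ac)
    also have "\<dots> \<le> (\<Sum>j\<in>B. (k j)\<^sup>2 * G)" by (intro sum_mono mult_left_mono col) auto
    also have "\<dots> = G * (\<Sum>j\<in>B. (k j)\<^sup>2)" by (simp add: sum_distrib_left mult_ac)
    finally show "L2_set ?g (A\<times>B) \<le> sqrt G * L2_set k B"
      unfolding L2_set_def real_sqrt_mult[symmetric] by (rule real_sqrt_le_mono)
  qed (auto simp: G)
  also have "\<dots> = (sqrt G * sqrt G) * L2_set h A * L2_set k B" by (simp only: ac_simps)
  also have "\<dots> = G * L2_set h A * L2_set k B" using G by simp
  finally show ?thesis .
qed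

text \<open>For fixed \<open>p\<close> and \<open>q\<close> the kernel in \<open>i\<close> and
  \<open>j\<close> has row and column sums at most \<open>G\<close>, because \<open>\<phi>\<close>
  is injective in each of them. Schur's test bounds the inner sum, and the remaining two factors are
  summed in \<open>\<ell>\<^sup>1\<close>.\<close>

lemma quadrilinear_sum_le:
  fixes \<phi> :: "'a \<Rightarrow> 'a \<Rightarrow> 'a \<Rightarrow> 'a \<Rightarrow> 'b" and \<Lambda> :: "'b \<Rightarrow> real"
  assumes S: "finite S" and \<Lambda>: "\<And>l. 0 \<le> \<Lambda> l" "\<And>A. finite A \<Longrightarrow> sum \<Lambda> A \<le> G"
    and inj1: "\<And>p q j. inj (\<lambda>i. \<phi> p q i j)" and inj2: "\<And>p q i. inj (\<lambda>j. \<phi> p q i j)"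
    and nn: "\<And>i. 0 \<le> f i" "\<And>i. 0 \<le> g i" "\<And>i. 0 \<le> h i" "\<And>i. 0 \<le> k i"
  shows "(\<Sum>p\<in>S. \<Sum>q\<in>S. \<Sum>i\<in>S. \<Sum>j\<in>S. \<Lambda> (\<phi> p q i j) * f p * g q * h i * k j)
    \<le> G * sum f S * sum g S * L2_set h S * L2_set k S"
proof -
  have G: "0 \<le> G" using \<Lambda>(2)[of "{}"] by simp
  have sub: "(\<Sum>i\<in>S. \<Lambda> (\<psi> i)) \<le> G" if "inj \<psi>" for \<psi> :: "'a \<Rightarrow> 'b"
    using sum.reindex[of \<psi> S \<Lambda>] \<Lambda>(2)[of "\<psi> ` S"] S inj_on_subset[OF that subset_UNIV] by auto
  have "(\<Sum>p\<in>S. \<Sum>q\<in>S. \<Sum>i\<in>S. \<Sum>j\<in>S. \<Lambda> (\<phi> p q i j) * f p * g q * h i * k j)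
    = (\<Sum>p\<in>S. \<Sum>q\<in>S. f p * g q * (\<Sum>i\<in>S. \<Sum>j\<in>S. \<Lambda> (\<phi> p q i j) * h i * k j))"
    by (simp add: sum_distrib_left mult_ac)
  also have "\<dots> \<le> (\<Sum>p\<in>S. \<Sum>q\<in>S. f p * g q * (G * L2_set h S * L2_set k S))"
    by (intro sum_mono mult_left_mono schur_sum sub inj1 inj2) (auto simp: S \<Lambda> nn G)
  also have "\<dots> = G * sum f S * sum g S * L2_set h S * L2_set k S"
    by (simp add: sum_distrib_left sum_distrib_right algebra_simps)
  finally show ?thesis .
qed

abbreviation (input) quads :: "int set \<Rightarrow> (int \<times> int \<times> int \<times> int) set" where
  "quads S \<equiv> S \<times> S \<times> S \<times> S"

lemma sum_quads: "(\<Sum>(a,b,m,n)\<in>quads S. X a b m n) = (\<Sum>a\<in>S. \<Sum>b\<in>S. \<Sum>m\<in>S. \<Sum>n\<in>S. X a b m n)"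
  by (simp add: sum.cartesian_product)

text \<open>The symmetries of the quartic form: exchange of the unconjugated factors, exchange of
  the conjugated ones, and the reversal through which complex conjugation acts.\<close>

lemma sum_quads_perm:
  "(\<Sum>(a,b,m,n)\<in>quads S. X a b m n) = (\<Sum>(a,b,m,n)\<in>quads S. X b a m n)"
  "(\<Sum>(a,b,m,n)\<in>quads S. X a b m n) = (\<Sum>(a,b,m,n)\<in>quads S. X a b n m)"
  "(\<Sum>(a,b,m,n)\<in>quads S. X a b m n) = (\<Sum>(a,b,m,n)\<in>quads S. X n m b a)"
    apply (rule sum.reindex_bij_witness[of _ "\<lambda>(a,b,m,n). (b,a,m,n)" "\<lambda>(a,b,m,n). (b,a,m,n)"]; auto)
   apply (rule sum.reindex_bij_witness[of _ "\<lambda>(a,b,m,n). (a,b,n,m)" "\<lambda>(a,b,m,n). (a,b,n,m)"]; auto)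
  apply (rule sum.reindex_bij_witness[of _ "\<lambda>(a,b,m,n). (n,m,b,a)" "\<lambda>(a,b,m,n). (n,m,b,a)"]; auto)
  done

text \<open>The conjugated and unconjugated factors enter with opposite signs of the frequency; the
  three variants say which factor is measured, together with the last one, in \<open>\<ell>\<^sup>2\<close>.\<close>

lemma quads_sum_le:
  fixes \<Lambda> :: "int \<Rightarrow> real"
  assumes S: "finite S" and \<Lambda>: "\<And>l. 0 \<le> \<Lambda> l" "\<And>A. finite A \<Longrightarrow> sum \<Lambda> A \<le> G"
    and nn: "\<And>i. 0 \<le> f i" "\<And>i. 0 \<le> g i" "\<And>i. 0 \<le> h i" "\<And>i. 0 \<le> k i"
  shows "(\<Sum>(a,b,m,n)\<in>quads S. \<Lambda> (n + m - a - b) * (f a * g b * h m * k n))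
      \<le> G * sum f S * sum g S * L2_set h S * L2_set k S"
    and "(\<Sum>(a,b,m,n)\<in>quads S. \<Lambda> (n + m - a - b) * (h a * f b * g m * k n))
      \<le> G * sum f S * sum g S * L2_set h S * L2_set k S"
    and "(\<Sum>(a,b,m,n)\<in>quads S. \<Lambda> (n + m - a - b) * (f a * h b * g m * k n))
      \<le> G * sum f S * sum g S * L2_set h S * L2_set k S"
proof -
  note Q = quadrilinear_sum_le[of S \<Lambda> G _ f g h k, OF S \<Lambda> _ _ nn]
  have inj: "inj (\<lambda>n::int. n + m - a - b)" "inj (\<lambda>m::int. n + m - a - b)" "inj (\<lambda>a::int. n + m - a - b)"
    "inj (\<lambda>b::int. n + m - a - b)" for a b m n
    by (auto simp: inj_def)
  show "(\<Sum>(a,b,m,n)\<in>quads S. \<Lambda> (n + m - a - b) * (f a * g b * h m * k n))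
      \<le> G * sum f S * sum g S * L2_set h S * L2_set k S"
    unfolding sum_quads mult.assoc[symmetric] by (rule Q) (assumption | rule inj)+
  have "(\<Sum>(a,b,m,n)\<in>quads S. \<Lambda> (n + m - a - b) * (h a * f b * g m * k n)) =
     (\<Sum>(b,m,a,n)\<in>quads S. \<Lambda> (n + m - a - b) * (f b * g m * h a * k n))"
    by (rule sum.reindex_bij_witness[of _ "\<lambda>(b,m,a,n). (a,b,m,n)" "\<lambda>(a,b,m,n). (b,m,a,n)"])
       (auto simp: ac_simps)
  also have "\<dots> \<le> G * sum f S * sum g S * L2_set h S * L2_set k S"
    unfolding sum_quads mult.assoc[symmetric] by (rule Q) (assumption | rule inj)+
  finally show "(\<Sum>(a,b,m,n)\<in>quads S. \<Lambda> (n + m - a - b) * (h a * f b * g m * k n))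
      \<le> G * sum f S * sum g S * L2_set h S * L2_set k S" .
  have "(\<Sum>(a,b,m,n)\<in>quads S. \<Lambda> (n + m - a - b) * (f a * h b * g m * k n)) =
     (\<Sum>(a,m,b,n)\<in>quads S. \<Lambda> (n + m - a - b) * (f a * g m * h b * k n))"
    by (rule sum.reindex_bij_witness[of _ "\<lambda>(a,m,b,n). (a,b,m,n)" "\<lambda>(a,b,m,n). (a,m,b,n)"])
       (auto simp: ac_simps)
  also have "\<dots> \<le> G * sum f S * sum g S * L2_set h S * L2_set k S"
    unfolding sum_quads mult.assoc[symmetric] by (rule Q) (assumption | rule inj)+
  finally show "(\<Sum>(a,b,m,n)\<in>quads S. \<Lambda> (n + m - a - b) * (f a * h b * g m * k n))
      \<le> G * sum f S * sum g S * L2_set h S * L2_set k S" .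
qed

section \<open>The cubic term on finitely many modes\<close>

text \<open>This is the coefficient at \<open>n\<close> of the potential times
  \<open>\<bar>p\<bar>\<^sup>2 * p\<close>, where \<open>p\<close> is the trigonometric polynomial
  with coefficients \<open>c\<close> on \<open>S\<close> (proved in \<open>fc_cubic\<close>). The
  potential supplies the missing frequency \<open>n + m - a - b\<close>.\<close>

definition cubic :: "(int \<Rightarrow> complex) \<Rightarrow> int set \<Rightarrow> (int \<Rightarrow> complex) \<Rightarrow> int \<Rightarrow> complex" where
  "cubic \<Lambda> S c n = (\<Sum>a\<in>S. \<Sum>b\<in>S. \<Sum>m\<in>S. \<Lambda> (n + m - a - b) * (c a * c b * cnj (c m)))"

definition quartic :: "(int \<Rightarrow> complex) \<Rightarrow> int \<Rightarrow> int \<Rightarrow> int \<Rightarrow> int \<Rightarrow> (int \<Rightarrow> complex) \<Rightarrow> complex" where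
  "quartic \<Lambda> a b m n c = \<Lambda> (n + m - a - b) * (c a * c b * cnj (c m) * cnj (c n))"

text \<open>Of the \<open>s + 1\<close> powers in \<open>decay\<close>, \<open>s\<close> pay for
  moving the output weight to an input, and the last one buys a factor \<open>1 / K\<close> or pays
  for the distance between two high frequencies.\<close>

locale potential =
  fixes \<Lambda> :: "int \<Rightarrow> complex" and s G :: real
  assumes s_ge_1: "1 \<le> s"
    and reality: "\<Lambda> (- l) = cnj (\<Lambda> l)"
    and decay: "finite A \<Longrightarrow> (\<Sum>l\<in>A. cmod (\<Lambda> l) * (1 + \<bar>real_of_int l\<bar>) powr (s + 1)) \<le> G"
begin

definition W1 :: "int \<Rightarrow> real" where "W1 l = cmod (\<Lambda> l) * (1 + \<bar>real_of_int l\<bar>) powr (s + 1)"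
definition W0 :: "int \<Rightarrow> real" where "W0 l = cmod (\<Lambda> l) * (1 + \<bar>real_of_int l\<bar>) powr s"

lemma W1_nonneg: "0 \<le> W1 l" and W0_nonneg: "0 \<le> W0 l"
  by (simp_all add: W1_def W0_def)

lemma W0_le_W1: "W0 l \<le> W1 l"
  unfolding W0_def W1_def by (intro mult_left_mono powr_mono) auto

lemma W1_eq: "W1 l = W0 l * (1 + \<bar>real_of_int l\<bar>)"
  unfolding W0_def W1_def by (simp add: powr_add)

lemma cmod_le_W0: "cmod (\<Lambda> l) \<le> W0 l"
proof -
  have "1 \<le> (1 + \<bar>real_of_int l\<bar>) powr s" using s_ge_1 by (intro ge_one_powr_ge_zero) auto
  then show ?thesis unfolding W0_def using mult_left_mono[of 1 _ "cmod (\<Lambda> l)"] by simp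
qed

lemma W1_sum: "finite A \<Longrightarrow> sum W1 A \<le> G"
  using decay by (simp add: W1_def)

lemma W0_sum: "finite A \<Longrightarrow> sum W0 A \<le> G"
  using sum_mono[of A W0 W1] W0_le_W1 W1_sum by fastforce

lemma G_nonneg: "0 \<le> G"
  using W1_sum[of "{}"] by simp

lemma weight_quad:
  assumes "1 \<le> N"
  shows "cmod (\<Lambda> (n + m - a - b)) * weight N s n
    \<le> 4 powr s * (W0 (n + m - a - b) * (weight N s a + weight N s b + weight N s m))"
proof -
  have "weight N s n \<le> 4 powr s * ((1 + \<bar>real_of_int (n + m - a - b)\<bar>) powr s *
      (weight N s a + weight N s b + weight N s m))"
    using weight_add4[OF assms, of s "n + m - a - b" a b m] s_ge_1 by (simp add: algebra_simps)
  then have "cmod (\<Lambda> (n + m - a - b)) * weight N s n \<le> cmod (\<Lambda> (n + m - a - b)) *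
      (4 powr s * ((1 + \<bar>real_of_int (n + m - a - b)\<bar>) powr s *
      (weight N s a + weight N s b + weight N s m)))"
    by (rule mult_left_mono) simp
  also have "\<dots> = 4 powr s * (W0 (n + m - a - b) * (weight N s a + weight N s b + weight N s m))"
    unfolding W0_def by (simp only: ac_simps)
  finally show ?thesis .
qed

text \<open>Duality: the sequence \<open>k\<close> to be estimated is tested against itself. One
  copy is expanded, its weight is distributed over the three inputs, and the quadrilinear bound
  gives \<open>\<bar>k\<bar>\<^sup>2 \<le> R * \<bar>k\<bar>\<close> in the
  \<open>\<ell>\<^sup>2\<close> norm, which is then divided by that norm.\<close>

lemma trilinear_le:
  fixes x y z :: "int \<Rightarrow> real"
  assumes "finite S" "1 \<le> N" and nn: "\<And>i. 0 \<le> x i" "\<And>i. 0 \<le> y i" "\<And>i. 0 \<le> z i"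
  shows "L2_set (\<lambda>n. weight N s n *
      (\<Sum>a\<in>S. \<Sum>b\<in>S. \<Sum>m\<in>S. cmod (\<Lambda> (n + m - a - b)) * (x a * y b * z m))) S
    \<le> 4 powr s * G * (L2_set (\<lambda>n. weight N s n * x n) S * sum y S * sum z S +
        sum x S * L2_set (\<lambda>n. weight N s n * y n) S * sum z S +
        sum x S * sum y S * L2_set (\<lambda>n. weight N s n * z n) S)"
    (is "L2_set ?k0 S \<le> ?R")
proof -
  let ?w = "weight N s"
  define k where "k = ?k0"
  have knn: "0 \<le> k n" for n unfolding k_def by (intro mult_nonneg_nonneg sum_nonneg weight_nonneg) (auto simp: nn)
  have wnn: "0 \<le> ?w i * x i" "0 \<le> ?w i * y i" "0 \<le> ?w i * z i" for i
    by (simp_all add: nn weight_nonneg)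
  have "(L2_set k S)\<^sup>2 = (\<Sum>n\<in>S. (k n)\<^sup>2)" unfolding L2_set_def by (simp add: sum_nonneg)
  also have "\<dots> = (\<Sum>n\<in>S. \<Sum>a\<in>S. \<Sum>b\<in>S. \<Sum>m\<in>S.
      cmod (\<Lambda> (n + m - a - b)) * ?w n * (x a * y b * z m * k n))"
  proof (intro sum.cong refl)
    fix n
    have "(k n)\<^sup>2 = ?w n * (\<Sum>a\<in>S. \<Sum>b\<in>S. \<Sum>m\<in>S. cmod (\<Lambda> (n + m - a - b)) * (x a * y b * z m)) * k n"
      unfolding power2_eq_square by (subst (1) k_def) simp
    then show "(k n)\<^sup>2 = (\<Sum>a\<in>S. \<Sum>b\<in>S. \<Sum>m\<in>S. cmod (\<Lambda> (n + m - a - b)) * ?w n * (x a * y b * z m * k n))"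
      by (simp add: sum_distrib_left sum_distrib_right mult_ac)
  qed
  also have "\<dots> = (\<Sum>(a,b,m,n)\<in>quads S. cmod (\<Lambda> (n + m - a - b)) * ?w n * (x a * y b * z m * k n))"
    unfolding sum.cartesian_product
    by (rule sum.reindex_bij_witness[of _ "\<lambda>(a,b,m,n). (n,a,b,m)" "\<lambda>(n,a,b,m). (a,b,m,n)"]) auto
  also have "\<dots> \<le> (\<Sum>(a,b,m,n)\<in>quads S. 4 powr s * (W0 (n + m - a - b) * (?w a + ?w b + ?w m)) *
      (x a * y b * z m * k n))"
    using weight_quad[OF assms(2)] knn nn
    by (intro sum_mono) (auto intro!: mult_right_mono mult_nonneg_nonneg simp del: mult.assoc)
  also have "\<dots> = 4 powr s * ((\<Sum>(a,b,m,n)\<in>quads S. W0 (n + m - a - b) * ((?w a * x a) * y b * z m * k n)) +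
      (\<Sum>(a,b,m,n)\<in>quads S. W0 (n + m - a - b) * (x a * (?w b * y b) * z m * k n)) +
      (\<Sum>(a,b,m,n)\<in>quads S. W0 (n + m - a - b) * (x a * y b * (?w m * z m) * k n)))"
    unfolding sum.distrib[symmetric] sum_distrib_left
    by (intro sum.cong refl, clarify) algebra
  also have "\<dots> \<le> 4 powr s * (G * sum y S * sum z S * L2_set (\<lambda>n. ?w n * x n) S * L2_set k S +
      G * sum x S * sum z S * L2_set (\<lambda>n. ?w n * y n) S * L2_set k S +
      G * sum x S * sum y S * L2_set (\<lambda>n. ?w n * z n) S * L2_set k S)"
    by (intro mult_left_mono add_mono quads_sum_le assms W0_nonneg W0_sum knn wnn nn) auto
  also have "\<dots> = ?R * L2_set k S" by (simp add: algebra_simps)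
  finally have *: "(L2_set k S)\<^sup>2 \<le> ?R * L2_set k S" .
  have R: "0 \<le> ?R"
    by (intro mult_nonneg_nonneg add_nonneg_nonneg G_nonneg sum_nonneg) (auto simp: nn)
  have "L2_set k S \<le> ?R"
  proof (cases "L2_set k S = 0")
    case False
    then have "0 < L2_set k S" using L2_set_nonneg[of k S] by linarith
    then show ?thesis using * by (simp add: power2_eq_square)
  qed (use R in simp)
  then show ?thesis by (simp only: k_def)
qed

text \<open>Young's inequality for convolutions: summing over \<open>n\<close> first meets a
  translate of the potential coefficients, whose sum is at most \<open>G\<close>.\<close>

lemma cubic_l1_le:
  assumes "finite S" "finite A"
  shows "(\<Sum>n\<in>A. cmod (cubic \<Lambda> S c n)) \<le> G * (\<Sum>n\<in>S. cmod (c n)) ^ 3"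
proof -
  let ?x = "\<lambda>n. cmod (c n)"
  have "(\<Sum>n\<in>A. cmod (cubic \<Lambda> S c n)) \<le>
      (\<Sum>n\<in>A. \<Sum>a\<in>S. \<Sum>b\<in>S. \<Sum>m\<in>S. cmod (\<Lambda> (n + m - a - b)) * (?x a * ?x b * ?x m))"
    unfolding cubic_def
    by (intro sum_mono order.trans[OF norm_sum]) (simp add: norm_mult)
  also have "\<dots> = (\<Sum>a\<in>S. \<Sum>b\<in>S. \<Sum>m\<in>S. \<Sum>n\<in>A. cmod (\<Lambda> (n + m - a - b)) * (?x a * ?x b * ?x m))"
    unfolding sum.cartesian_product
    by (rule sum.reindex_bij_witness[of _ "\<lambda>(a,b,m,n). (n,a,b,m)" "\<lambda>(n,a,b,m). (a,b,m,n)"]) auto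
  also have "\<dots> = (\<Sum>a\<in>S. \<Sum>b\<in>S. \<Sum>m\<in>S. (\<Sum>n\<in>A. cmod (\<Lambda> (n + m - a - b))) * (?x a * ?x b * ?x m))"
    by (simp add: sum_distrib_right)
  also have "\<dots> \<le> (\<Sum>a\<in>S. \<Sum>b\<in>S. \<Sum>m\<in>S. G * (?x a * ?x b * ?x m))"
  proof (intro sum_mono mult_right_mono)
    fix a b m
    have "(\<Sum>n\<in>A. cmod (\<Lambda> (n + m - a - b))) = (\<Sum>l\<in>(\<lambda>n. n + m - a - b) ` A. cmod (\<Lambda> l))"
      by (subst sum.reindex) (auto simp: inj_on_def)
    also have "\<dots> \<le> sum W0 ((\<lambda>n. n + m - a - b) ` A)" by (intro sum_mono cmod_le_W0)
    also have "\<dots> \<le> G" using assms by (intro W0_sum) auto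
    finally show "(\<Sum>n\<in>A. cmod (\<Lambda> (n + m - a - b))) \<le> G" .
  qed auto
  also have "\<dots> = G * (\<Sum>n\<in>S. ?x n) ^ 3"
    by (simp add: sum_distrib_left sum_distrib_right power3_eq_cube mult_ac)
  finally show ?thesis .
qed

lemma cubic_weight_le:
  assumes "finite S" "1 \<le> N"
  shows "L2_set (\<lambda>n. weight N s n * cmod (cubic \<Lambda> S c n)) S
    \<le> 3 * 4 powr s * G * (\<Sum>n\<in>S. cmod (c n))\<^sup>2 * L2_set (\<lambda>n. weight N s n * cmod (c n)) S"
proof -
  let ?x = "\<lambda>n. cmod (c n)"
  have "L2_set (\<lambda>n. weight N s n * cmod (cubic \<Lambda> S c n)) S \<le>
    L2_set (\<lambda>n. weight N s n *
      (\<Sum>a\<in>S. \<Sum>b\<in>S. \<Sum>m\<in>S. cmod (\<Lambda> (n + m - a - b)) * (?x a * ?x b * ?x m))) S"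
    unfolding cubic_def
    by (intro L2_set_mono mult_left_mono order.trans[OF norm_sum] sum_mono)
       (auto simp: norm_mult weight_nonneg intro!: order.trans[OF norm_sum] sum_mono)
  also have "\<dots> \<le> 4 powr s * G * (L2_set (\<lambda>n. weight N s n * ?x n) S * sum ?x S * sum ?x S +
        sum ?x S * L2_set (\<lambda>n. weight N s n * ?x n) S * sum ?x S +
        sum ?x S * sum ?x S * L2_set (\<lambda>n. weight N s n * ?x n) S)"
    using assms by (intro trilinear_le) auto
  finally show ?thesis by (simp add: power2_eq_square algebra_simps)
qed

text \<open>Algebraic form of the conservation of mass: since the potential is real, reversing the
  four indices turns the sum into its complex conjugate.\<close>

lemma cubic_pairing_real: "Im (\<Sum>n\<in>S. cnj (c n) * cubic \<Lambda> S c n) = 0"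
proof -
  have e: "(\<Sum>n\<in>S. cnj (c n) * cubic \<Lambda> S c n) = (\<Sum>(a,b,m,n)\<in>quads S. quartic \<Lambda> a b m n c)"
    (is "?l = ?r")
    unfolding cubic_def quartic_def sum_distrib_left sum.cartesian_product
    by (rule sum.reindex_bij_witness[of _ "\<lambda>(a,b,m,n). (n,a,b,m)" "\<lambda>(n,a,b,m). (a,b,m,n)"])
       (auto simp: mult_ac)
  have "cnj ?r = (\<Sum>(a,b,m,n)\<in>quads S. cnj (quartic \<Lambda> a b m n c))"
    by (simp add: cnj_sum split_beta)
  also have "\<dots> = (\<Sum>(a,b,m,n)\<in>quads S. quartic \<Lambda> n m b a c)"
  proof (intro sum.cong refl, clarify)
    fix a b m n
    have "\<Lambda> (a + b - n - m) = cnj (\<Lambda> (n + m - a - b))"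
      using reality[of "n + m - a - b"] by (simp add: algebra_simps)
    then show "cnj (quartic \<Lambda> a b m n c) = quartic \<Lambda> n m b a c" unfolding quartic_def by simp
  qed
  also have "\<dots> = ?r" by (rule sum_quads_perm(3)[symmetric])
  finally show ?thesis unfolding e by (metis Reals_cnj_iff complex_is_Real_iff)
qed

end

section \<open>The growth of the weighted norm\<close>

context potential
begin

text \<open>The name refers to the phase: the weight factor vanishes for outputs up to
  \<open>10 * K\<close>, and on all other terms of this sum \<open>phase_ge\<close> keeps the phase
  away from zero.\<close>

definition nonresonant :: "nat \<Rightarrow> int set \<Rightarrow> (int \<Rightarrow> complex) \<Rightarrow> complex" where
  "nonresonant K S c = (\<Sum>(a,b,m,n)\<in>quads S. of_bool (\<bar>a\<bar> \<le> int K \<and> \<bar>b\<bar> \<le> int K \<and> \<not> \<bar>m\<bar> \<le> int K) *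
     (of_real ((weight (10 * real K) s n)\<^sup>2 - 1) * quartic \<Lambda> a b m n c))"

context
  fixes K :: nat and S :: "int set" and c :: "int \<Rightarrow> complex"
  assumes K: "1 \<le> K" and S: "finite S"
begin

private abbreviation (input) \<theta> :: "int \<Rightarrow> real" where "\<theta> \<equiv> weight (10 * real K) s"
private abbreviation (input) lo :: "int \<Rightarrow> bool" where "lo n \<equiv> \<bar>n\<bar> \<le> int K"
private abbreviation (input) x :: "int \<Rightarrow> real" where "x n \<equiv> cmod (c n)"
private abbreviation (input) hx :: "int \<Rightarrow> real" where "hx n \<equiv> of_bool (\<not> lo n) * cmod (c n)"
private abbreviation (input) lx :: "int \<Rightarrow> real" where "lx n \<equiv> of_bool (lo n) * (1 + \<bar>real_of_int n\<bar>) * cmod (c n)"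
private abbreviation (input) y :: "int \<Rightarrow> real" where "y n \<equiv> weight (10 * real K) s n * cmod (c n)"
private abbreviation (input) Y :: real where "Y \<equiv> L2_set (\<lambda>n. weight (10 * real K) s n * cmod (c n)) S"

lemma N_ge_1: "1 \<le> 10 * real K"
  using K by linarith

lemma theta_ge_1: "1 \<le> \<theta> n"
  using s_ge_1 by (intro weight_ge_1) auto

lemma theta_low: "\<bar>n\<bar> \<le> 10 * int K \<Longrightarrow> \<theta> n = 1"
  using K by (intro weight_eq_1) (auto simp: of_int_abs[symmetric] simp del: of_int_abs)

lemma rho_le: "(\<theta> n)\<^sup>2 - 1 \<le> \<theta> n * \<theta> n" and rho_nonneg: "0 \<le> (\<theta> n)\<^sup>2 - 1"
  using theta_ge_1[of n] by (auto simp: power2_eq_square intro: mult_ge1_I)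

text \<open>Of the two output weights one stays with \<open>c n\<close> and completes
  \<open>y n\<close>; the other is passed on to the inputs.\<close>

lemma quartic_rho_le:
  "cmod (quartic \<Lambda> a b m n c) * ((\<theta> n)\<^sup>2 - 1) \<le>
    4 powr s * (W0 (n + m - a - b) * (\<theta> a + \<theta> b + \<theta> m) * (x a * x b * x m * y n))"
proof -
  have "cmod (quartic \<Lambda> a b m n c) * ((\<theta> n)\<^sup>2 - 1) \<le> cmod (quartic \<Lambda> a b m n c) * (\<theta> n * \<theta> n)"
    by (intro mult_left_mono rho_le) auto
  also have "\<dots> = cmod (\<Lambda> (n + m - a - b)) * \<theta> n * (x a * x b * x m * y n)"
    unfolding quartic_def by (simp add: norm_mult)
  also have "\<dots> \<le> 4 powr s * (W0 (n + m - a - b) * (\<theta> a + \<theta> b + \<theta> m)) * (x a * x b * x m * y n)"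
    using weight_quad[OF N_ge_1] by (intro mult_right_mono) (auto simp: weight_nonneg)
  finally show ?thesis by (simp only: mult.assoc)
qed

text \<open>One input carries the output weight. As two inputs are high, some high input is
  different from the carrier and can be measured by the small \<open>\<ell>\<^sup>1\<close> norm of
  \<open>hx\<close>. The factor 6 counts the pairs of a carrier and another high input.\<close>

lemma two_high_le:
  "(\<Sum>(a,b,m,n)\<in>quads S. of_bool ((\<not> lo a \<and> \<not> lo b) \<or> (\<not> lo a \<and> \<not> lo m) \<or> (\<not> lo b \<and> \<not> lo m)) *
      (cmod (quartic \<Lambda> a b m n c) * ((\<theta> n)\<^sup>2 - 1)))
    \<le> 4 powr s * (6 * (G * sum hx S * sum x S * Y * Y))"
proof -
  have "(\<Sum>(a,b,m,n)\<in>quads S. of_bool ((\<not> lo a \<and> \<not> lo b) \<or> (\<not> lo a \<and> \<not> lo m) \<or> (\<not> lo b \<and> \<not> lo m)) *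
      (cmod (quartic \<Lambda> a b m n c) * ((\<theta> n)\<^sup>2 - 1)))
    \<le> (\<Sum>(a,b,m,n)\<in>quads S. 4 powr s * (
      W0 (n + m - a - b) * (y a * hx b * x m * y n) + W0 (n + m - a - b) * (y a * x b * hx m * y n) +
      W0 (n + m - a - b) * (hx a * y b * x m * y n) + W0 (n + m - a - b) * (x a * y b * hx m * y n) +
      W0 (n + m - a - b) * (hx a * x b * y m * y n) + W0 (n + m - a - b) * (x a * hx b * y m * y n)))"
  proof (intro sum_mono, clarify)
    fix a b m n
    define w p where "w = W0 (n + m - a - b)" and "p = w * (x a * x b * x m * y n)"
    have p: "0 \<le> p" unfolding p_def w_def by (simp add: W0_nonneg weight_nonneg)
    have q: "0 \<le> \<theta> a * p" "0 \<le> \<theta> b * p" "0 \<le> \<theta> m * p" using p by (simp_all add: weight_nonneg)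
    have "of_bool ((\<not> lo a \<and> \<not> lo b) \<or> (\<not> lo a \<and> \<not> lo m) \<or> (\<not> lo b \<and> \<not> lo m)) *
       (cmod (quartic \<Lambda> a b m n c) * ((\<theta> n)\<^sup>2 - 1)) \<le>
       of_bool ((\<not> lo a \<and> \<not> lo b) \<or> (\<not> lo a \<and> \<not> lo m) \<or> (\<not> lo b \<and> \<not> lo m)) *
       (4 powr s * (W0 (n + m - a - b) * (\<theta> a + \<theta> b + \<theta> m) * (x a * x b * x m * y n)))"
      by (intro mult_left_mono quartic_rho_le) auto
    also have "\<dots> = 4 powr s * (of_bool ((\<not> lo a \<and> \<not> lo b) \<or> (\<not> lo a \<and> \<not> lo m) \<or> (\<not> lo b \<and> \<not> lo m)) *
       (\<theta> a * p + \<theta> b * p + \<theta> m * p))"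
      unfolding p_def w_def by (simp add: algebra_simps)
    also have "\<dots> \<le> 4 powr s * (of_bool (\<not> lo b) * (\<theta> a * p) + of_bool (\<not> lo m) * (\<theta> a * p) +
       of_bool (\<not> lo a) * (\<theta> b * p) + of_bool (\<not> lo m) * (\<theta> b * p) +
       of_bool (\<not> lo a) * (\<theta> m * p) + of_bool (\<not> lo b) * (\<theta> m * p))"
    proof (intro mult_left_mono)
      have *: "of_bool ((\<not> lo a \<and> \<not> lo b) \<or> (\<not> lo a \<and> \<not> lo m) \<or> (\<not> lo b \<and> \<not> lo m)) * (t + u + v) \<le>
        of_bool (\<not> lo b) * t + of_bool (\<not> lo m) * t + of_bool (\<not> lo a) * u + of_bool (\<not> lo m) * u +
        of_bool (\<not> lo a) * v + of_bool (\<not> lo b) * v" if "0 \<le> t" "0 \<le> u" "0 \<le> v" for t u v :: real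
        using that by (auto simp: of_bool_def)
      show "of_bool ((\<not> lo a \<and> \<not> lo b) \<or> (\<not> lo a \<and> \<not> lo m) \<or> (\<not> lo b \<and> \<not> lo m)) *
          (\<theta> a * p + \<theta> b * p + \<theta> m * p) \<le>
        of_bool (\<not> lo b) * (\<theta> a * p) + of_bool (\<not> lo m) * (\<theta> a * p) +
        of_bool (\<not> lo a) * (\<theta> b * p) + of_bool (\<not> lo m) * (\<theta> b * p) +
        of_bool (\<not> lo a) * (\<theta> m * p) + of_bool (\<not> lo b) * (\<theta> m * p)"
        by (rule *[OF q])
    qed simp
    also have "\<dots> = 4 powr s * (
      W0 (n + m - a - b) * (y a * hx b * x m * y n) + W0 (n + m - a - b) * (y a * x b * hx m * y n) +
      W0 (n + m - a - b) * (hx a * y b * x m * y n) + W0 (n + m - a - b) * (x a * y b * hx m * y n) +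
      W0 (n + m - a - b) * (hx a * x b * y m * y n) + W0 (n + m - a - b) * (x a * hx b * y m * y n))"
      unfolding p_def w_def by (simp only: mult_ac)
    finally show "of_bool ((\<not> lo a \<and> \<not> lo b) \<or> (\<not> lo a \<and> \<not> lo m) \<or> (\<not> lo b \<and> \<not> lo m)) *
       (cmod (quartic \<Lambda> a b m n c) * ((\<theta> n)\<^sup>2 - 1)) \<le> \<dots>" .
  qed
  also have "\<dots> = 4 powr s * (
     (\<Sum>(a,b,m,n)\<in>quads S. W0 (n + m - a - b) * (y a * hx b * x m * y n)) +
     (\<Sum>(a,b,m,n)\<in>quads S. W0 (n + m - a - b) * (y a * x b * hx m * y n)) +
     (\<Sum>(a,b,m,n)\<in>quads S. W0 (n + m - a - b) * (hx a * y b * x m * y n)) +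
     (\<Sum>(a,b,m,n)\<in>quads S. W0 (n + m - a - b) * (x a * y b * hx m * y n)) +
     (\<Sum>(a,b,m,n)\<in>quads S. W0 (n + m - a - b) * (hx a * x b * y m * y n)) +
     (\<Sum>(a,b,m,n)\<in>quads S. W0 (n + m - a - b) * (x a * hx b * y m * y n)))"
    unfolding sum.distrib[symmetric] sum_distrib_left by (intro sum.cong refl) auto
  also have "\<dots> \<le> 4 powr s * (
     G * sum hx S * sum x S * Y * Y + G * sum x S * sum hx S * Y * Y +
     G * sum hx S * sum x S * Y * Y + G * sum x S * sum hx S * Y * Y +
     G * sum hx S * sum x S * Y * Y + G * sum x S * sum hx S * Y * Y)"
    by (intro mult_left_mono add_mono quads_sum_le S W0_nonneg W0_sum mult_nonneg_nonneg weight_nonneg) auto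
  finally show ?thesis by (simp add: algebra_simps)
qed

text \<open>A term contributes only for \<open>\<bar>n\<bar> > 10 * K\<close>, and with three low
  inputs the potential then has frequency at least \<open>K\<close>. Hence one spare power of the
  decay of the potential is worth \<open>1 / K\<close>. The 3 is the sum of the input weights, all
  equal to 1.\<close>

lemma all_low_le:
  "(\<Sum>(a,b,m,n)\<in>quads S. of_bool (lo a \<and> lo b \<and> lo m) * (cmod (quartic \<Lambda> a b m n c) * ((\<theta> n)\<^sup>2 - 1)))
    \<le> 4 powr s * (3 / K * (G * sum x S * sum x S * Y * Y))"
proof -
  have "(\<Sum>(a,b,m,n)\<in>quads S. of_bool (lo a \<and> lo b \<and> lo m) * (cmod (quartic \<Lambda> a b m n c) * ((\<theta> n)\<^sup>2 - 1)))
    \<le> (\<Sum>(a,b,m,n)\<in>quads S. 4 powr s * (3 / K * (W1 (n + m - a - b) * (x a * x b * y m * y n))))"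
  proof (intro sum_mono, clarify)
    fix a b m n
    have nn: "0 \<le> 4 powr s * (3 / K * (W1 (n + m - a - b) * (x a * x b * y m * y n)))"
      using K by (simp add: W1_nonneg weight_nonneg)
    show "of_bool (lo a \<and> lo b \<and> lo m) * (cmod (quartic \<Lambda> a b m n c) * ((\<theta> n)\<^sup>2 - 1)) \<le>
        4 powr s * (3 / K * (W1 (n + m - a - b) * (x a * x b * y m * y n)))"
    proof (cases "lo a \<and> lo b \<and> lo m \<and> \<not> \<bar>n\<bar> \<le> 10 * int K")
      case True
      then have "int K \<le> \<bar>n + m - a - b\<bar>" by linarith
      then have "K \<le> 1 + \<bar>real_of_int (n + m - a - b)\<bar>" by linarith
      then have "1 \<le> (1 + \<bar>real_of_int (n + m - a - b)\<bar>) / K" using K by (simp add: field_simps)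
      then have "W0 (n + m - a - b) \<le> W1 (n + m - a - b) / K"
        unfolding W1_eq using mult_left_mono[OF _ W0_nonneg[of "n + m - a - b"]] by fastforce
      moreover have "\<theta> a = 1" "\<theta> b = 1" "\<theta> m = 1" using True by (auto intro!: theta_low)
      ultimately have "W0 (n + m - a - b) * (\<theta> a + \<theta> b + \<theta> m) * (x a * x b * x m * y n)
          \<le> W1 (n + m - a - b) / K * (\<theta> a + \<theta> b + \<theta> m) * (x a * x b * x m * y n)"
        by (intro mult_right_mono) (auto simp: weight_nonneg)
      also have "\<dots> = 3 / K * (W1 (n + m - a - b) * (x a * x b * y m * y n))"
        using \<open>\<theta> a = 1\<close> \<open>\<theta> b = 1\<close> \<open>\<theta> m = 1\<close> by simp
      finally have "4 powr s * (W0 (n + m - a - b) * (\<theta> a + \<theta> b + \<theta> m) * (x a * x b * x m * y n))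
          \<le> 4 powr s * (3 / K * (W1 (n + m - a - b) * (x a * x b * y m * y n)))"
        by (rule mult_left_mono) simp
      then show ?thesis using quartic_rho_le[of a b m n] True by simp
    next
      case False
      then have z: "of_bool (lo a \<and> lo b \<and> lo m) * (cmod (quartic \<Lambda> a b m n c) * ((\<theta> n)\<^sup>2 - 1)) = 0"
        using theta_low[of n] by auto
      show ?thesis unfolding z by (rule nn)
    qed
  qed
  also have "\<dots> = 4 powr s * (3 / K * (\<Sum>(a,b,m,n)\<in>quads S. W1 (n + m - a - b) * (x a * x b * y m * y n)))"
    unfolding sum_distrib_left by (intro sum.cong refl) auto
  also have "\<dots> \<le> 4 powr s * (3 / K * (G * sum x S * sum x S * Y * Y))"
    by (intro mult_left_mono quads_sum_le S W1_nonneg W1_sum mult_nonneg_nonneg weight_nonneg) auto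
  finally show ?thesis .
qed

text \<open>\<open>grow N\<close> is Lipschitz with constant \<open>1 / N\<close>, and
  \<open>n\<close> differs from \<open>a\<close> by the potential frequency plus
  \<open>b - m\<close>. Low \<open>b\<close> and \<open>m\<close> make the ratio bounded in terms of
  the potential frequency alone, whereas a gain \<open>1 / K\<close> in the difference costs one
  derivative on \<open>b\<close> or on \<open>m\<close>.\<close>

lemma grow_shift:
  assumes "lo b" "lo m"
  shows "grow (10 * real K) n \<le> grow (10 * real K) a * (2 * (1 + \<bar>real_of_int (n + m - a - b)\<bar>))"
    and "\<bar>grow (10 * real K) n - grow (10 * real K) a\<bar> \<le>
      (1 + \<bar>real_of_int (n + m - a - b)\<bar>) * ((1 + \<bar>real_of_int b\<bar>) + (1 + \<bar>real_of_int m\<bar>)) / K"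
proof -
  let ?g = "grow (10 * real K)"
  define L where "L = \<bar>real_of_int (n + m - a - b)\<bar>"
  have L: "0 \<le> L" by (simp add: L_def)
  have K0: "0 < real K" using K by simp
  have "\<bar>real_of_int n - real_of_int a\<bar> = \<bar>real_of_int (n + m - a - b) + real_of_int b - real_of_int m\<bar>" by simp
  then have d: "\<bar>real_of_int n - real_of_int a\<bar> \<le> L + \<bar>real_of_int b\<bar> + \<bar>real_of_int m\<bar>"
    unfolding L_def by linarith
  have "\<bar>?g n - ?g a\<bar> \<le> \<bar>\<bar>real_of_int n\<bar> / (10 * real K) - \<bar>real_of_int a\<bar> / (10 * real K)\<bar>"
    unfolding grow_def by (simp add: max_def)
  also have "\<dots> = \<bar>\<bar>real_of_int n\<bar> - \<bar>real_of_int a\<bar>\<bar> / (10 * real K)"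
    using K0 by (simp add: diff_divide_distrib[symmetric] abs_divide)
  also have "\<dots> \<le> (L + \<bar>real_of_int b\<bar> + \<bar>real_of_int m\<bar>) / (10 * real K)"
    using d K0 by (intro divide_right_mono) auto
  finally have g: "\<bar>?g n - ?g a\<bar> \<le> (L + \<bar>real_of_int b\<bar> + \<bar>real_of_int m\<bar>) / (10 * real K)" .
  have bm: "\<bar>real_of_int b\<bar> \<le> K" "\<bar>real_of_int m\<bar> \<le> K" using assms by linarith+
  have "(L + \<bar>real_of_int b\<bar> + \<bar>real_of_int m\<bar>) / (10 * real K) \<le> (L * real K + K + K) / (10 * real K)"
    using bm K0 K L by (intro divide_right_mono add_mono) (auto simp: mult_le_cancel_left1)
  also have "\<dots> \<le> 1 + L" using K0 L by (simp add: field_simps)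
  finally have "?g n \<le> ?g a + (1 + L)" using g by linarith
  also have "\<dots> \<le> ?g a * (2 * (1 + L))"
    using grow_ge_1[of "10 * real K" a] mult_right_mono[of 1 "?g a" "1 + 2 * L"] L by (simp add: algebra_simps)
  finally show "?g n \<le> ?g a * (2 * (1 + \<bar>real_of_int (n + m - a - b)\<bar>))" unfolding L_def .
  have "(L + \<bar>real_of_int b\<bar> + \<bar>real_of_int m\<bar>) / (10 * real K) \<le> (L + \<bar>real_of_int b\<bar> + \<bar>real_of_int m\<bar>) / K"
    using K0 L by (intro divide_left_mono) auto
  also have "\<dots> \<le> (1 + L) * ((1 + \<bar>real_of_int b\<bar>) + (1 + \<bar>real_of_int m\<bar>)) / K"
    using L K0 by (intro divide_right_mono) (auto simp: algebra_simps)
  finally show "\<bar>?g n - ?g a\<bar> \<le>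
      (1 + \<bar>real_of_int (n + m - a - b)\<bar>) * ((1 + \<bar>real_of_int b\<bar>) + (1 + \<bar>real_of_int m\<bar>)) / K"
    using g unfolding L_def by linarith
qed

text \<open>Mean value theorem for the power \<open>2 * s\<close> of \<open>grow\<close>. The square
  of the larger weight is replaced by \<open>\<theta> n * \<theta> a\<close>, so that each of the
  two high factors receives its own weight; this costs the powers \<open>s\<close> of
  \<open>L\<close>, and the difference of the \<open>grow\<close> values costs one more.\<close>

lemma theta_diff_le:
  assumes "lo b" "lo m"
  shows "\<bar>(\<theta> n)\<^sup>2 - (\<theta> a)\<^sup>2\<bar> \<le> 2 * s * 2 powr s * (\<theta> n * \<theta> a) * (1 + \<bar>real_of_int (n + m - a - b)\<bar>) powr (s + 1) *
      ((1 + \<bar>real_of_int b\<bar>) + (1 + \<bar>real_of_int m\<bar>)) / K"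
proof -
  let ?g = "grow (10 * real K)"
  define L where "L = 1 + \<bar>real_of_int (n + m - a - b)\<bar>"
  have L: "1 \<le> L" by (simp add: L_def)
  have g1: "1 \<le> ?g n" "1 \<le> ?g a" by (rule grow_ge_1)+
  have g: "?g n \<le> ?g a * (2 * L)" "?g a \<le> ?g n * (2 * L)"
  proof -
    have "1 + \<bar>real_of_int (a + b - n - m)\<bar> = L" unfolding L_def by simp
    then show "?g n \<le> ?g a * (2 * L)" "?g a \<le> ?g n * (2 * L)"
      using grow_shift(1)[OF assms, of n a] grow_shift(1)[OF assms(2,1), of a n] by (simp_all only: L_def)
  qed
  have sq: "(\<theta> k)\<^sup>2 = ?g k powr (2 * s)" for k
    using powr_powr[of "?g k" s 2] by (simp add: weight_def powr_numeral mult.commute)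
  have "max (?g n) (?g a) powr (2 * s) = max (?g n) (?g a) powr s * max (?g n) (?g a) powr s"
    by (simp add: powr_add[symmetric])
  also have "\<dots> = max (\<theta> n) (\<theta> a) * max (\<theta> n) (\<theta> a)"
  proof -
    have "max (?g n) (?g a) powr s = max (\<theta> n) (\<theta> a)"
      unfolding weight_def max_def using powr_mono2[of s "?g n" "?g a"] powr_mono2[of s "?g a" "?g n"] g1 s_ge_1
      by auto
    then show ?thesis by simp
  qed
  also have "\<dots> \<le> \<theta> n * \<theta> a * (2 * L) powr s"
  proof -
    have "\<theta> n \<le> \<theta> a * (2 * L) powr s" "\<theta> a \<le> \<theta> n * (2 * L) powr s"
      unfolding weight_def using g g1 L s_ge_1 by (auto simp: powr_mult[symmetric] intro!: powr_mono2)
    then have "\<theta> n * \<theta> n \<le> \<theta> n * (\<theta> a * (2 * L) powr s)" "\<theta> a * \<theta> a \<le> \<theta> a * (\<theta> n * (2 * L) powr s)"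
      by (auto intro!: mult_left_mono simp: weight_nonneg)
    then show ?thesis by (simp add: max_def mult_ac)
  qed
  finally have m: "max (?g n) (?g a) powr (2 * s) \<le> \<theta> n * \<theta> a * (2 * L) powr s" .
  have "\<bar>(\<theta> n)\<^sup>2 - (\<theta> a)\<^sup>2\<bar> \<le> 2 * s * max (?g n) (?g a) powr (2 * s) * \<bar>?g n - ?g a\<bar>"
    unfolding sq using s_ge_1 g1 by (intro powr_diff_le) auto
  also have "\<dots> \<le> 2 * s * (\<theta> n * \<theta> a * (2 * L) powr s) * (L * ((1 + \<bar>real_of_int b\<bar>) + (1 + \<bar>real_of_int m\<bar>)) / K)"
    using m grow_shift(2)[OF assms, of n a] s_ge_1
    by (intro mult_mono) (auto simp: L_def weight_nonneg)
  also have "\<dots> = 2 * s * 2 powr s * (\<theta> n * \<theta> a) * L powr (s + 1) * ((1 + \<bar>real_of_int b\<bar>) + (1 + \<bar>real_of_int m\<bar>)) / K"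
    using L by (simp add: powr_mult powr_add)
  finally show ?thesis unfolding L_def .
qed

text \<open>The derivative lost on a low factor is collected in \<open>lx\<close>. Its
  \<open>\<ell>\<^sup>1\<close> norm is of order \<open>sqrt K\<close> by
  \<open>mode_sums_le\<close>, so together with \<open>1 / K\<close> a gain
  \<open>1 / sqrt K\<close> is left.\<close>

lemma commutator_le:
  "(\<Sum>(a,b,m,n)\<in>quads S. of_bool (lo b \<and> lo m) * (\<bar>(\<theta> n)\<^sup>2 - (\<theta> a)\<^sup>2\<bar> * cmod (quartic \<Lambda> a b m n c)))
    \<le> 2 * s * 2 powr s / K * (2 * (G * sum lx S * sum x S * Y * Y))"
proof -
  let ?b = "\<lambda>b. 1 + \<bar>real_of_int b\<bar>"
  let ?C = "2 * s * 2 powr s / K"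
  have C: "0 \<le> ?C" using s_ge_1 by simp
  have "(\<Sum>(a,b,m,n)\<in>quads S. of_bool (lo b \<and> lo m) * (\<bar>(\<theta> n)\<^sup>2 - (\<theta> a)\<^sup>2\<bar> * cmod (quartic \<Lambda> a b m n c)))
     \<le> (\<Sum>(a,b,m,n)\<in>quads S. ?C * (W1 (n + m - a - b) * (y a * lx b * x m * y n) +
         W1 (n + m - a - b) * (y a * x b * lx m * y n)))"
  proof (intro sum_mono, clarify)
    fix a b m n
    have nn: "0 \<le> ?C * (W1 (n + m - a - b) * (y a * lx b * x m * y n) +
         W1 (n + m - a - b) * (y a * x b * lx m * y n))"
      by (intro mult_nonneg_nonneg add_nonneg_nonneg C W1_nonneg weight_nonneg) auto
    show "of_bool (lo b \<and> lo m) * (\<bar>(\<theta> n)\<^sup>2 - (\<theta> a)\<^sup>2\<bar> * cmod (quartic \<Lambda> a b m n c)) \<le>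
       ?C * (W1 (n + m - a - b) * (y a * lx b * x m * y n) + W1 (n + m - a - b) * (y a * x b * lx m * y n))"
    proof (cases "lo b \<and> lo m")
      case True
      have "\<bar>(\<theta> n)\<^sup>2 - (\<theta> a)\<^sup>2\<bar> * cmod (quartic \<Lambda> a b m n c) \<le>
         (2 * s * 2 powr s * (\<theta> n * \<theta> a) * ?b (n + m - a - b) powr (s + 1) * (?b b + ?b m) / K) *
          (cmod (\<Lambda> (n + m - a - b)) * (x a * x b * x m * x n))"
        using theta_diff_le[of b m n a] True
        by (intro mult_mono) (auto simp: quartic_def norm_mult)
      also have "\<dots> = ?C * (W1 (n + m - a - b) * (y a * (?b b * x b) * x m * y n) +
         W1 (n + m - a - b) * (y a * x b * (?b m * x m) * y n))"
        unfolding W1_def divide_inverse by algebra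
      finally show ?thesis using True by simp
    next
      case False
      then have z: "of_bool (lo b \<and> lo m) * (\<bar>(\<theta> n)\<^sup>2 - (\<theta> a)\<^sup>2\<bar> * cmod (quartic \<Lambda> a b m n c)) = 0"
        by simp
      show ?thesis unfolding z by (rule nn)
    qed
  qed
  also have "\<dots> = ?C * ((\<Sum>(a,b,m,n)\<in>quads S. W1 (n + m - a - b) * (y a * lx b * x m * y n)) +
       (\<Sum>(a,b,m,n)\<in>quads S. W1 (n + m - a - b) * (y a * x b * lx m * y n)))"
    unfolding sum_distrib_left sum.distrib[symmetric] by (intro sum.cong refl) auto
  also have "\<dots> \<le> ?C * (G * sum lx S * sum x S * Y * Y + G * sum x S * sum lx S * Y * Y)"
    by (intro mult_left_mono add_mono quads_sum_le S W1_nonneg W1_sum mult_nonneg_nonneg weight_nonneg C) auto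
  finally show ?thesis by (simp add: algebra_simps)
qed
text \<open>Splits off the constant weight, whose contribution is real; what remains sees only
  outputs above \<open>10 * K\<close>.\<close>

lemma cubic_pairing_eq:
  "(\<Sum>n\<in>S. of_real ((\<theta> n)\<^sup>2) * (cnj (c n) * cubic \<Lambda> S c n)) =
    (\<Sum>n\<in>S. cnj (c n) * cubic \<Lambda> S c n) +
    (\<Sum>(a,b,m,n)\<in>quads S. of_real ((\<theta> n)\<^sup>2 - 1) * quartic \<Lambda> a b m n c)"
proof -
  have "(\<Sum>(a,b,m,n)\<in>quads S. of_real ((\<theta> n)\<^sup>2 - 1) * quartic \<Lambda> a b m n c) =
    (\<Sum>n\<in>S. of_real ((\<theta> n)\<^sup>2 - 1) * (cnj (c n) * cubic \<Lambda> S c n))"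
    unfolding cubic_def quartic_def sum_distrib_left sum.cartesian_product
    by (rule sum.reindex_bij_witness[of _ "\<lambda>(n,a,b,m). (a,b,m,n)" "\<lambda>(a,b,m,n). (n,a,b,m)"])
       (auto simp: mult_ac)
  then show ?thesis by (simp add: sum.distrib[symmetric] algebra_simps)
qed

lemma cnj_quartic: "cnj (quartic \<Lambda> a b m n c) = quartic \<Lambda> n m b a c"
proof -
  have "\<Lambda> (a + b - n - m) = cnj (\<Lambda> (n + m - a - b))"
    using reality[of "n + m - a - b"] by (simp add: algebra_simps)
  then show ?thesis unfolding quartic_def by simp
qed

text \<open>If one unconjugated factor carries the high frequency, exchanging it with the measured factor
  turns the imaginary part into a commutator.\<close>

lemma one_high_le:
  "\<bar>Im (\<Sum>(a,b,m,n)\<in>quads S. of_bool (\<not> lo a \<and> lo b \<and> lo m) * (of_real ((\<theta> n)\<^sup>2 - 1) * quartic \<Lambda> a b m n c))\<bar>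
    \<le> s * 2 powr s / K * (2 * (G * sum lx S * sum x S * Y * Y))"
proof -
  let ?X = "\<Sum>(a,b,m,n)\<in>quads S. of_bool (\<not> lo a \<and> lo b \<and> lo m) * (of_real ((\<theta> n)\<^sup>2 - 1) * quartic \<Lambda> a b m n c)"
  \<comment> \<open>Requiring \<open>n\<close> to be high as well makes the index region invariant
    under the reversal of the four indices. This does not change the sum, as the weight factor
    vanishes for low \<open>n\<close>.\<close>
  let ?J = "\<lambda>a b m n. of_bool (\<not> lo a \<and> lo b \<and> lo m \<and> \<not> lo n)"
  have X: "?X = (\<Sum>(a,b,m,n)\<in>quads S. ?J a b m n * (of_real ((\<theta> n)\<^sup>2 - 1) * quartic \<Lambda> a b m n c))"
  proof (intro sum.cong refl, clarify)
    fix a b m n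
    show "of_bool (\<not> lo a \<and> lo b \<and> lo m) * (of_real ((\<theta> n)\<^sup>2 - 1) * quartic \<Lambda> a b m n c) =
       ?J a b m n * (of_real ((\<theta> n)\<^sup>2 - 1) * quartic \<Lambda> a b m n c)"
      using theta_low[of n] by (cases "lo n") auto
  qed
  have "cnj ?X = (\<Sum>(a,b,m,n)\<in>quads S. ?J n m b a * (of_real ((\<theta> n)\<^sup>2 - 1) * quartic \<Lambda> n m b a c))"
    unfolding X cnj_sum
  proof (intro sum.cong refl, clarify)
    fix a b m n
    have "?J n m b a = ?J a b m n" by (rule arg_cong[of _ _ of_bool]) blast
    then show "cnj (?J a b m n * (of_real ((\<theta> n)\<^sup>2 - 1) * quartic \<Lambda> a b m n c)) =
        ?J n m b a * (of_real ((\<theta> n)\<^sup>2 - 1) * quartic \<Lambda> n m b a c)"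
      by (simp only: complex_cnj_mult cnj_quartic complex_cnj_complex_of_real)
         (auto simp: of_bool_def)
  qed
  also have "\<dots> = (\<Sum>(a,b,m,n)\<in>quads S. ?J a b m n * (of_real ((\<theta> a)\<^sup>2 - 1) * quartic \<Lambda> a b m n c))"
    by (rule sum_quads_perm(3))
  finally have cX: "cnj ?X = (\<Sum>(a,b,m,n)\<in>quads S. ?J a b m n * (of_real ((\<theta> a)\<^sup>2 - 1) * quartic \<Lambda> a b m n c))" .
  have "?X - cnj ?X = (\<Sum>(a,b,m,n)\<in>quads S. ?J a b m n * (of_real ((\<theta> n)\<^sup>2 - (\<theta> a)\<^sup>2) * quartic \<Lambda> a b m n c))"
    unfolding cX unfolding X by (subst sum_subtractf[symmetric], intro sum.cong refl) (auto simp: algebra_simps)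
  then have "cmod (?X - cnj ?X) \<le> (\<Sum>(a,b,m,n)\<in>quads S. of_bool (lo b \<and> lo m) * (\<bar>(\<theta> n)\<^sup>2 - (\<theta> a)\<^sup>2\<bar> * cmod (quartic \<Lambda> a b m n c)))"
    by (simp only:) (intro order.trans[OF norm_sum] sum_mono, auto simp: norm_mult simp del: of_real_diff of_real_power)
  also have "\<dots> \<le> 2 * s * 2 powr s / K * (2 * (G * sum lx S * sum x S * Y * Y))" by (rule commutator_le)
  also have "cmod (?X - cnj ?X) = 2 * \<bar>Im ?X\<bar>" unfolding complex_diff_cnj norm_mult by (simp only: norm_of_real norm_ii)
  finally have "2 * \<bar>Im ?X\<bar> \<le> 2 * (s * 2 powr s / K * (2 * (G * sum lx S * sum x S * Y * Y)))"
    by (simp only: times_divide_eq_left times_divide_eq_right mult.assoc)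
  then show ?thesis by linarith
qed

text \<open>The quadruples are partitioned by their high inputs: none (\<open>A0\<close>), exactly
  one unconjugated (twice \<open>A1\<close>, by the symmetry in \<open>a\<close> and
  \<open>b\<close>), only the conjugated one (\<open>nonresonant\<close>, moved to the left side),
  and at least two (\<open>A2\<close>).\<close>

lemma cubic_pairing_le:
  "\<bar>Im (\<Sum>n\<in>S. of_real ((\<theta> n)\<^sup>2) * (cnj (c n) * cubic \<Lambda> S c n)) - Im (nonresonant K S c)\<bar> \<le>
     G * sum x S * Y\<^sup>2 * (6 * 4 powr s * sum hx S + 3 * 4 powr s / K * sum x S + 4 * s * 2 powr s / K * sum lx S)"
proof -
  let ?t = "\<lambda>a b m n. of_real ((\<theta> n)\<^sup>2 - 1) * quartic \<Lambda> a b m n c"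
  define A0 where "A0 = (\<Sum>(a,b,m,n)\<in>quads S. of_bool (lo a \<and> lo b \<and> lo m) * ?t a b m n)"
  define A1 where "A1 = (\<Sum>(a,b,m,n)\<in>quads S. of_bool (\<not> lo a \<and> lo b \<and> lo m) * ?t a b m n)"
  define A2 where "A2 = (\<Sum>(a,b,m,n)\<in>quads S.
    of_bool ((\<not> lo a \<and> \<not> lo b) \<or> (\<not> lo a \<and> \<not> lo m) \<or> (\<not> lo b \<and> \<not> lo m)) * ?t a b m n)"
  have A1': "A1 = (\<Sum>(a,b,m,n)\<in>quads S. of_bool (lo a \<and> \<not> lo b \<and> lo m) * ?t a b m n)"
  proof -
    have "quartic \<Lambda> b a m n c = quartic \<Lambda> a b m n c" for a b m n
      unfolding quartic_def by (simp add: algebra_simps)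
    then show ?thesis unfolding A1_def by (subst sum_quads_perm(1)) (simp add: conj_ac)
  qed
  have "(\<Sum>(a,b,m,n)\<in>quads S. ?t a b m n) = A0 + A1 + A1 + nonresonant K S c + A2"
    unfolding A0_def nonresonant_def A2_def sum.distrib[symmetric]
    by (subst (1) A1_def, subst A1', unfold sum.distrib[symmetric], intro sum.cong refl) auto
  then have "(\<Sum>n\<in>S. of_real ((\<theta> n)\<^sup>2) * (cnj (c n) * cubic \<Lambda> S c n)) =
     (\<Sum>n\<in>S. cnj (c n) * cubic \<Lambda> S c n) + (A0 + A1 + A1 + nonresonant K S c + A2)"
    by (simp only: cubic_pairing_eq)
  then have e: "Im (\<Sum>n\<in>S. of_real ((\<theta> n)\<^sup>2) * (cnj (c n) * cubic \<Lambda> S c n)) - Im (nonresonant K S c) = Im A0 + 2 * Im A1 + Im A2"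
    using cubic_pairing_real[where S = S and c = c] by (simp only: plus_complex.sel)
  have abs_t: "cmod (of_bool P * ?t a b m n) = of_bool P * (cmod (quartic \<Lambda> a b m n c) * ((\<theta> n)\<^sup>2 - 1))" for P a b m n
    using rho_nonneg[of n] by (simp only: norm_mult norm_of_real) simp
  have "cmod A0 \<le> 4 powr s * (3 / K * (G * sum x S * sum x S * Y * Y))"
    unfolding A0_def
    by (intro order.trans[OF _ all_low_le] order.trans[OF norm_sum] sum_mono) (clarify, simp only: prod.case abs_t order.refl)
  moreover have "cmod A2 \<le> 4 powr s * (6 * (G * sum hx S * sum x S * Y * Y))"
    unfolding A2_def
    by (intro order.trans[OF _ two_high_le] order.trans[OF norm_sum] sum_mono) (clarify, simp only: prod.case abs_t order.refl)
  moreover have "\<bar>Im A1\<bar> \<le> s * 2 powr s / K * (2 * (G * sum lx S * sum x S * Y * Y))"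
    unfolding A1_def by (rule one_high_le)
  ultimately have "\<bar>Im A0 + 2 * Im A1 + Im A2\<bar> \<le> 4 powr s * (3 / K * (G * sum x S * sum x S * Y * Y)) +
     2 * (s * 2 powr s / K * (2 * (G * sum lx S * sum x S * Y * Y))) +
     4 powr s * (6 * (G * sum hx S * sum x S * Y * Y))"
    using abs_Im_le_cmod[of A0] abs_Im_le_cmod[of A2] by linarith
  also have "\<dots> = G * sum x S * Y\<^sup>2 * (6 * 4 powr s * sum hx S + 3 * 4 powr s / K * sum x S + 4 * s * 2 powr s / K * sum lx S)"
    unfolding power2_eq_square divide_inverse by algebra
  finally show ?thesis unfolding e .
qed

end

end

section \<open>Normal form correction and growth rate\<close>

lemma sum_inverse_square_nat:
  fixes A :: "nat set" and K :: nat
  assumes "finite A" "1 \<le> K" "\<And>k. k \<in> A \<Longrightarrow> K < k"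
  shows "(\<Sum>k\<in>A. 1 / (1 + (real k)\<^sup>2)) \<le> 1 / K"
proof -
  have *: "(\<Sum>k\<in>{K<..M}. 1 / (1 + (real k)\<^sup>2)) \<le> 1 / K - 1 / M" if "K \<le> M" for M :: nat
    using that
  proof (induction M rule: dec_induct)
    case (step M)
    have "{K<..Suc M} = insert (Suc M) {K<..M}" using step by auto
    moreover have "1 / (1 + (real (Suc M))\<^sup>2) \<le> 1 / M - 1 / Suc M"
    proof -
      have "1 / (1 + (real (Suc M))\<^sup>2) \<le> 1 / (real M * real (Suc M))"
      proof (rule frac_le)
        show "0 < real M * real (Suc M)" using step assms(2) by simp
        show "real M * real (Suc M) \<le> 1 + (real (Suc M))\<^sup>2" by (simp add: power2_eq_square algebra_simps)
      qed auto
      also have "\<dots> = 1 / M - 1 / Suc M" using step assms(2) by (simp add: field_simps)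
      finally show ?thesis .
    qed
    ultimately show ?case using step by simp
  qed simp
  obtain M where M: "\<And>k. k \<in> A \<Longrightarrow> k \<le> M"
    using assms(1) unfolding finite_nat_set_iff_bounded_le by auto
  have "(\<Sum>k\<in>A. 1 / (1 + (real k)\<^sup>2)) \<le> (\<Sum>k\<in>{K<..max K M}. 1 / (1 + (real k)\<^sup>2))"
  proof (rule sum_mono2)
    show "A \<subseteq> {K<..max K M}"
    proof
      fix k assume "k \<in> A"
      then show "k \<in> {K<..max K M}" using M[of k] assms(3)[of k] by simp
    qed
  qed auto
  also have "\<dots> \<le> 1 / K - 1 / max K M" by (rule *) simp
  also have "\<dots> \<le> 1 / K" by simp
  finally show ?thesis .
qed

lemma sum_inverse_square_int:
  fixes A :: "int set"
  assumes "finite A" "1 \<le> K" "\<And>n. n \<in> A \<Longrightarrow> int K < \<bar>n\<bar>"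
  shows "(\<Sum>n\<in>A. 1 / (1 + (real_of_int n)\<^sup>2)) \<le> 2 / K"
proof -
  let ?f = "\<lambda>n. 1 / (1 + (real_of_int n)\<^sup>2)"
  have *: "sum ?f (A \<inter> B) \<le> 1 / K" if "inj_on (\<lambda>n. nat \<bar>n\<bar>) B" for B :: "int set"
  proof -
    have "sum ?f (A \<inter> B) = (\<Sum>k\<in>(\<lambda>n. nat \<bar>n\<bar>) ` (A \<inter> B). 1 / (1 + (real k)\<^sup>2))"
      by (subst sum.reindex) (use that in \<open>auto intro: inj_on_subset\<close>)
    also have "\<dots> \<le> 1 / K" using assms
      by (intro sum_inverse_square_nat) (auto simp: zless_nat_eq_int_zless)
    finally show ?thesis .
  qed
  have "sum ?f A = sum ?f (A \<inter> {0<..}) + sum ?f (A \<inter> {..0})"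
    using assms(1) by (subst sum.union_disjoint[symmetric]) (auto intro!: sum.cong)
  also have "\<dots> \<le> 1 / K + 1 / K" by (intro add_mono *) (auto simp: inj_on_def)
  finally show ?thesis by simp
qed

lemma sum_inverse_square_le_5:
  fixes A :: "int set"
  assumes "finite A"
  shows "(\<Sum>n\<in>A. 1 / (1 + (real_of_int n)\<^sup>2)) \<le> 5"
proof -
  let ?f = "\<lambda>n. 1 / (1 + (real_of_int n)\<^sup>2)"
  have "sum ?f A = sum ?f (A \<inter> {-1..1}) + sum ?f (A - {-1..1})"
    using assms by (rule sum.Int_Diff)
  also have "\<dots> \<le> 3 + 2 / real 1"
  proof (intro add_mono)
    have "sum ?f (A \<inter> {-1..1}) \<le> sum ?f {-1..1}" by (intro sum_mono2) auto
    also have "\<dots> \<le> (\<Sum>n\<in>{-1..1::int}. 1)"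
      by (intro sum_mono) (simp add: divide_le_eq_1 add_pos_nonneg)
    finally show "sum ?f (A \<inter> {-1..1}) \<le> 3" by simp
    show "sum ?f (A - {-1..1}) \<le> 2 / real 1" using assms by (intro sum_inverse_square_int) auto
  qed
  finally show ?thesis by simp
qed

text \<open>Cauchy-Schwarz with the \<open>H\<^sup>1\<close> weight. The multiplier \<open>v\<close>
  selects the modes in question, so that \<open>\<gamma>\<close> becomes the gain or the loss in
  \<open>K\<close>.\<close>

lemma l1_le_weighted_l2:
  fixes v x :: "int \<Rightarrow> real"
  assumes "finite S" "\<And>n. 0 \<le> x n" "\<And>n. 0 \<le> v n" "(\<Sum>n\<in>S. (1 + (real_of_int n)\<^sup>2) * (x n)\<^sup>2) \<le> \<beta>\<^sup>2"
    and "(\<Sum>n\<in>S. (v n)\<^sup>2 / (1 + (real_of_int n)\<^sup>2)) \<le> \<gamma>\<^sup>2" "0 \<le> \<beta>" "0 \<le> \<gamma>"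
  shows "(\<Sum>n\<in>S. v n * x n) \<le> \<gamma> * \<beta>"
proof -
  let ?b = "\<lambda>n. sqrt (1 + (real_of_int n)\<^sup>2)"
  have pos: "0 < 1 + (real_of_int n)\<^sup>2" for n by (simp add: add_pos_nonneg)
  have "(\<Sum>n\<in>S. v n * x n) = (\<Sum>n\<in>S. \<bar>v n / ?b n\<bar> * \<bar>?b n * x n\<bar>)"
  proof (intro sum.cong refl)
    fix n
    show "v n * x n = \<bar>v n / ?b n\<bar> * \<bar>?b n * x n\<bar>"
      using assms(2,3)[of n] pos[of n] by (simp add: abs_mult)
  qed
  also have "\<dots> \<le> L2_set (\<lambda>n. v n / ?b n) S * L2_set (\<lambda>n. ?b n * x n) S" by (rule L2_set_mult_ineq)
  also have "\<dots> \<le> \<gamma> * \<beta>"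
  proof (intro mult_mono)
    show "L2_set (\<lambda>n. v n / ?b n) S \<le> \<gamma>" "L2_set (\<lambda>n. ?b n * x n) S \<le> \<beta>"
      unfolding L2_set_def using assms pos
      by (auto intro!: real_le_lsqrt sum_nonneg simp: power_divide power_mult_distrib less_imp_le)
  qed (use assms in auto)
  finally show ?thesis .
qed

section \<open>Normal form coefficients and the modified square\<close>

context potential
begin

definition phase :: "int \<Rightarrow> int \<Rightarrow> int \<Rightarrow> int \<Rightarrow> real" where
  "phase a b m n = (of_int n)\<^sup>2 + (of_int m)\<^sup>2 - (of_int a)\<^sup>2 - (of_int b)\<^sup>2"

text \<open>Division by the phase undoes the factor that time differentiation brings down, so that
  the derivative of \<open>corrector\<close> reproduces \<open>nonresonant\<close>. For
  \<open>K\<close> at least 1 a vanishing phase occurs only together with a vanishing numerator,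
  hence the convention for division by 0 is consistent with \<open>kap_phase\<close>.\<close>

definition kap :: "nat \<Rightarrow> int \<Rightarrow> int \<Rightarrow> int \<Rightarrow> int \<Rightarrow> real" where
  "kap K a b m n = of_bool (\<bar>a\<bar> \<le> int K \<and> \<bar>b\<bar> \<le> int K \<and> \<not> \<bar>m\<bar> \<le> int K) *
     ((weight (10 * real K) s n)\<^sup>2 - 1) / phase a b m n"

definition corrector :: "nat \<Rightarrow> int set \<Rightarrow> (int \<Rightarrow> complex) \<Rightarrow> complex" where
  "corrector K S c = (\<Sum>(a,b,m,n)\<in>quads S. of_real (kap K a b m n) * quartic \<Lambda> a b m n c)"

text \<open>The two high frequencies enter with the same sign, so the phase is at least
  \<open>(100 + 1 - 2) * K\<^sup>2\<close>.\<close>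

lemma phase_ge:
  assumes "1 \<le> K" "\<bar>a\<bar> \<le> int K" "\<bar>b\<bar> \<le> int K" "\<not> \<bar>m\<bar> \<le> int K" "\<not> \<bar>n\<bar> \<le> 10 * int K"
  shows "(real K)\<^sup>2 \<le> phase a b m n"
proof -
  have le: "\<bar>real_of_int a\<bar> \<le> K" "\<bar>real_of_int b\<bar> \<le> K" "real K \<le> \<bar>real_of_int m\<bar>" "10 * real K \<le> \<bar>real_of_int n\<bar>"
    using assms by linarith+
  have "(real_of_int a)\<^sup>2 \<le> (real K)\<^sup>2" "(real_of_int b)\<^sup>2 \<le> (real K)\<^sup>2"
      "(real K)\<^sup>2 \<le> (real_of_int m)\<^sup>2" "(10 * real K)\<^sup>2 \<le> (real_of_int n)\<^sup>2"
    using power_mono[OF le(1), of 2] power_mono[OF le(2), of 2] power_mono[OF le(3), of 2] power_mono[OF le(4), of 2]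
    by simp_all
  moreover have "(10 * real K)\<^sup>2 = 100 * (real K)\<^sup>2" by (simp add: power_mult_distrib)
  ultimately show ?thesis unfolding phase_def using zero_le_power2[of "real K"] by linarith
qed

lemma kap_cases:
  assumes "1 \<le> K"
  obtains "kap K a b m n = 0" "of_bool (\<bar>a\<bar> \<le> int K \<and> \<bar>b\<bar> \<le> int K \<and> \<not> \<bar>m\<bar> \<le> int K) *
     ((weight (10 * real K) s n)\<^sup>2 - 1) = 0"
  | "\<bar>a\<bar> \<le> int K" "\<bar>b\<bar> \<le> int K" "\<not> \<bar>m\<bar> \<le> int K" "(real K)\<^sup>2 \<le> phase a b m n"
    "kap K a b m n = ((weight (10 * real K) s n)\<^sup>2 - 1) / phase a b m n"
proof (cases "\<bar>a\<bar> \<le> int K \<and> \<bar>b\<bar> \<le> int K \<and> \<not> \<bar>m\<bar> \<le> int K \<and> \<not> \<bar>n\<bar> \<le> 10 * int K")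
  case True
  then show ?thesis using phase_ge[OF assms, of a b m n] that(2) by (simp add: kap_def)
next
  case False
  then have "of_bool (\<bar>a\<bar> \<le> int K \<and> \<bar>b\<bar> \<le> int K \<and> \<not> \<bar>m\<bar> \<le> int K) *
     ((weight (10 * real K) s n)\<^sup>2 - 1) = 0"
    \<comment> \<open>The context of \<open>theta_low\<close> fixes a finite set of modes; here it
      is taken to be empty.\<close>
    using theta_low[OF assms finite.emptyI, of n] by auto
  then show ?thesis using that(1) by (simp only: kap_def div_0)
qed

lemma kap_phase:
  assumes "1 \<le> K"
  shows "kap K a b m n * phase a b m n = of_bool (\<bar>a\<bar> \<le> int K \<and> \<bar>b\<bar> \<le> int K \<and> \<not> \<bar>m\<bar> \<le> int K) *
     ((weight (10 * real K) s n)\<^sup>2 - 1)"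
proof (cases rule: kap_cases[OF assms, of a b m n])
  case 2
  have "0 < (real K)\<^sup>2" using assms by simp
  then have "phase a b m n \<noteq> 0" using 2(4) by linarith
  then show ?thesis using 2 by simp
qed simp

lemma kap_nonneg:
  assumes "1 \<le> K" shows "0 \<le> kap K a b m n"
proof (cases rule: kap_cases[OF assms, of a b m n])
  case 2
  have "0 \<le> phase a b m n" using 2(4) zero_le_power2[of "real K"] by linarith
  then show ?thesis unfolding 2(5) by (intro divide_nonneg_nonneg rho_nonneg[OF assms finite.emptyI])
qed simp

text \<open>One output weight is kept at \<open>n\<close> and the other is moved to the inputs.
  There \<open>a\<close> and \<open>b\<close> are low with weight 1, so the sum of the input weights
  is at most \<open>3\<close> times the weight of \<open>m\<close>; both high factors end up
  weighted.\<close>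

lemma kap_le:
  assumes K: "1 \<le> K"
  shows "kap K a b m n * cmod (\<Lambda> (n + m - a - b)) \<le> 3 * 4 powr s / (real K)\<^sup>2 *
    (W0 (n + m - a - b) * (weight (10 * real K) s m * weight (10 * real K) s n))"
proof (cases rule: kap_cases[OF K, of a b m n])
  case 1
  then show ?thesis by (simp add: W0_nonneg weight_nonneg)
next
  case 2
  let ?w = "weight (10 * real K) s"
  have K0: "0 < (real K)\<^sup>2" using K by simp
  have "kap K a b m n * cmod (\<Lambda> (n + m - a - b)) \<le> (?w n * ?w n) / (real K)\<^sup>2 * cmod (\<Lambda> (n + m - a - b))"
    unfolding 2(5) using rho_le[OF K finite.emptyI, of n] rho_nonneg[OF K finite.emptyI, of n] 2 K0
    by (intro mult_right_mono frac_le) auto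
  also have "\<dots> = cmod (\<Lambda> (n + m - a - b)) * ?w n * (?w n / (real K)\<^sup>2)" by simp
  also have "\<dots> \<le> 4 powr s * (W0 (n + m - a - b) * (?w a + ?w b + ?w m)) * (?w n / (real K)\<^sup>2)"
    using weight_quad[OF N_ge_1[OF K finite.emptyI], of n m a b] by (intro mult_right_mono) (auto simp: weight_nonneg)
  also have "\<dots> \<le> 4 powr s * (W0 (n + m - a - b) * (3 * ?w m)) * (?w n / (real K)\<^sup>2)"
  proof -
    have "?w a = 1" "?w b = 1" "1 \<le> ?w m"
      using 2 theta_low[OF K finite.emptyI, of a] theta_low[OF K finite.emptyI, of b]
        theta_ge_1[OF K finite.emptyI, of m] by auto
    then show ?thesis by (intro mult_right_mono mult_left_mono) (auto simp: W0_nonneg weight_nonneg)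
  qed
  finally show ?thesis by (simp add: mult_ac)
qed

lemma kap_sum_le:
  assumes K: "1 \<le> K" and S: "finite S"
    and nn: "\<And>i. 0 \<le> f i" "\<And>i. 0 \<le> g i" "\<And>i. 0 \<le> h i" "\<And>i. 0 \<le> k i"
  shows "(\<Sum>(a,b,m,n)\<in>quads S. kap K a b m n * cmod (\<Lambda> (n + m - a - b)) * (f a * g b * h m * k n)) \<le>
    3 * 4 powr s / (real K)\<^sup>2 * (G * sum f S * sum g S *
      L2_set (\<lambda>n. weight (10 * real K) s n * h n) S * L2_set (\<lambda>n. weight (10 * real K) s n * k n) S)"
proof -
  let ?w = "weight (10 * real K) s"
  have "(\<Sum>(a,b,m,n)\<in>quads S. kap K a b m n * cmod (\<Lambda> (n + m - a - b)) * (f a * g b * h m * k n)) \<le>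
    (\<Sum>(a,b,m,n)\<in>quads S. 3 * 4 powr s / (real K)\<^sup>2 * (W0 (n + m - a - b) * (f a * g b * (?w m * h m) * (?w n * k n))))"
  proof (intro sum_mono, clarify)
    fix a b m n
    have "kap K a b m n * cmod (\<Lambda> (n + m - a - b)) * (f a * g b * h m * k n) \<le>
      3 * 4 powr s / (real K)\<^sup>2 * (W0 (n + m - a - b) * (?w m * ?w n)) * (f a * g b * h m * k n)"
      using kap_le[OF K, of a b m n] nn by (intro mult_right_mono) auto
    then show "kap K a b m n * cmod (\<Lambda> (n + m - a - b)) * (f a * g b * h m * k n) \<le>
      3 * 4 powr s / (real K)\<^sup>2 * (W0 (n + m - a - b) * (f a * g b * (?w m * h m) * (?w n * k n)))"
      by (simp only: mult_ac)
  qed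
  also have "\<dots> = 3 * 4 powr s / (real K)\<^sup>2 *
    (\<Sum>(a,b,m,n)\<in>quads S. W0 (n + m - a - b) * (f a * g b * (?w m * h m) * (?w n * k n)))"
    unfolding sum_distrib_left by (intro sum.cong refl) auto
  also have "\<dots> \<le> 3 * 4 powr s / (real K)\<^sup>2 * (G * sum f S * sum g S *
      L2_set (\<lambda>n. ?w n * h n) S * L2_set (\<lambda>n. ?w n * k n) S)"
    by (intro mult_left_mono quads_sum_le S W0_nonneg W0_sum mult_nonneg_nonneg weight_nonneg nn) auto
  finally show ?thesis .
qed

lemma corrector_le:
  assumes K: "1 \<le> K" and S: "finite S"
  shows "cmod (corrector K S c) \<le> 3 * 4 powr s / (real K)\<^sup>2 * (G * (\<Sum>n\<in>S. cmod (c n))\<^sup>2 *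
    (L2_set (\<lambda>n. weight (10 * real K) s n * cmod (c n)) S)\<^sup>2)"
proof -
  have "cmod (corrector K S c) \<le>
    (\<Sum>(a,b,m,n)\<in>quads S. kap K a b m n * cmod (\<Lambda> (n + m - a - b)) * (cmod (c a) * cmod (c b) * cmod (c m) * cmod (c n)))"
    unfolding corrector_def quartic_def
    by (intro order.trans[OF norm_sum] sum_mono, clarify) (simp add: norm_mult kap_nonneg[OF K])
  also note kap_sum_le[OF K S]
  finally show ?thesis by (simp add: power2_eq_square mult_ac)
qed

text \<open>The part of the product rule for \<open>quartic\<close> that stems from \<open>f\<close>
  in the equation \<open>c' = - \<i> * n\<^sup>2 * c - \<i> * f\<close>. Conjugated factors
  contribute with \<open>\<i>\<close> and the others with \<open>- \<i>\<close>.\<close>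

definition quartic_forcing ::
  "int \<Rightarrow> int \<Rightarrow> int \<Rightarrow> int \<Rightarrow> (int \<Rightarrow> complex) \<Rightarrow> (int \<Rightarrow> complex) \<Rightarrow> complex" where
  "quartic_forcing a b m n c f = \<i> * \<Lambda> (n + m - a - b) *
    (c a * c b * cnj (f m) * cnj (c n) + c a * c b * cnj (c m) * cnj (f n)
     - f a * c b * cnj (c m) * cnj (c n) - c a * f b * cnj (c m) * cnj (c n))"

lemma quartic_deriv:
  fixes c :: "real \<Rightarrow> int \<Rightarrow> complex"
  assumes d: "\<And>n. n \<in> S \<Longrightarrow> ((\<lambda>t. c t n) has_vector_derivative (- \<i> * (of_int n)\<^sup>2 * c t n - \<i> * f n)) (at t)"
    and "a \<in> S" "b \<in> S" "m \<in> S" "n \<in> S"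
  shows "((\<lambda>t. quartic \<Lambda> a b m n (c t)) has_vector_derivative
    (\<i> * of_real (phase a b m n) * quartic \<Lambda> a b m n (c t) + quartic_forcing a b m n (c t) f)) (at t)"
  unfolding quartic_def
  by (rule has_vector_derivative_eq_rhs[OF has_vector_derivative_mult_right[OF has_vector_derivative_mult[OF
        has_vector_derivative_mult[OF has_vector_derivative_mult[OF d d] has_vector_derivative_cnj[OF d]]
        has_vector_derivative_cnj[OF d]]]])
     (use assms in \<open>simp_all add: phase_def quartic_forcing_def algebra_simps\<close>)

lemma corrector_deriv:
  fixes c :: "real \<Rightarrow> int \<Rightarrow> complex"
  assumes d: "\<And>n. n \<in> S \<Longrightarrow> ((\<lambda>t. c t n) has_vector_derivative (- \<i> * (of_int n)\<^sup>2 * c t n - \<i> * f n)) (at t)"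
    and K: "1 \<le> K"
  shows "((\<lambda>t. corrector K S (c t)) has_vector_derivative
    (\<i> * nonresonant K S (c t) + (\<Sum>(a,b,m,n)\<in>quads S. of_real (kap K a b m n) * quartic_forcing a b m n (c t) f))) (at t)"
proof -
  have "((\<lambda>t. corrector K S (c t)) has_vector_derivative
    (\<Sum>(a,b,m,n)\<in>quads S. of_real (kap K a b m n) *
     (\<i> * of_real (phase a b m n) * quartic \<Lambda> a b m n (c t) + quartic_forcing a b m n (c t) f))) (at t)"
    unfolding corrector_def split_beta
    by (intro has_vector_derivative_sum has_vector_derivative_mult_right quartic_deriv[OF d]) auto
  also have "(\<Sum>(a,b,m,n)\<in>quads S. of_real (kap K a b m n) *
     (\<i> * of_real (phase a b m n) * quartic \<Lambda> a b m n (c t) + quartic_forcing a b m n (c t) f)) =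
     \<i> * nonresonant K S (c t) + (\<Sum>(a,b,m,n)\<in>quads S. of_real (kap K a b m n) * quartic_forcing a b m n (c t) f)"
  proof -
    have e: "complex_of_real (kap K a b m n) * of_real (phase a b m n) =
      of_bool (\<bar>a\<bar> \<le> int K \<and> \<bar>b\<bar> \<le> int K \<and> \<not> \<bar>m\<bar> \<le> int K) * of_real ((weight (10 * real K) s n)\<^sup>2 - 1)"
      for a b m n
      using arg_cong[OF kap_phase[OF K, of a b m n], of complex_of_real] by simp
    have e2: "of_real (kap K a b m n) *
     (\<i> * of_real (phase a b m n) * quartic \<Lambda> a b m n (c t) + quartic_forcing a b m n (c t) f) =
     \<i> * (of_bool (\<bar>a\<bar> \<le> int K \<and> \<bar>b\<bar> \<le> int K \<and> \<not> \<bar>m\<bar> \<le> int K) *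
       (of_real ((weight (10 * real K) s n)\<^sup>2 - 1) * quartic \<Lambda> a b m n (c t))) +
       of_real (kap K a b m n) * quartic_forcing a b m n (c t) f" for a b m n
      using e[of a b m n] by algebra
    show ?thesis
      unfolding nonresonant_def sum_distrib_left sum.distrib[symmetric] split_beta using e2 by (intro sum.cong refl) simp
  qed
  finally show ?thesis .
qed

text \<open>The forcing is measured in \<open>\<ell>\<^sup>1\<close> where it replaces one of the
  low factors \<open>a\<close> and \<open>b\<close>, and in weighted \<open>\<ell>\<^sup>2\<close>
  where it replaces one of the high factors \<open>m\<close> and \<open>n\<close>.\<close>

lemma forcing_le:
  assumes K: "1 \<le> K" and S: "finite S"
  shows "cmod (\<Sum>(a,b,m,n)\<in>quads S. of_real (kap K a b m n) * quartic_forcing a b m n c f) \<le>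
    3 * 4 powr s / (real K)\<^sup>2 * (2 * G * (\<Sum>n\<in>S. cmod (c n)) * L2_set (\<lambda>n. weight (10 * real K) s n * cmod (c n)) S *
     ((\<Sum>n\<in>S. cmod (f n)) * L2_set (\<lambda>n. weight (10 * real K) s n * cmod (c n)) S +
      (\<Sum>n\<in>S. cmod (c n)) * L2_set (\<lambda>n. weight (10 * real K) s n * cmod (f n)) S))"
proof -
  let ?x = "\<lambda>n. cmod (c n)" and ?f = "\<lambda>n. cmod (f n)"
  let ?T = "\<lambda>f g h k. (\<Sum>(a,b,m,n)\<in>quads S. kap K a b m n * cmod (\<Lambda> (n + m - a - b)) * (f a * g b * h m * k n))"
  have "cmod (\<Sum>(a,b,m,n)\<in>quads S. of_real (kap K a b m n) * quartic_forcing a b m n c f) \<le>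
     ?T ?x ?x ?f ?x + ?T ?x ?x ?x ?f + ?T ?f ?x ?x ?x + ?T ?x ?f ?x ?x"
    unfolding sum.distrib[symmetric]
  proof (intro order.trans[OF norm_sum] sum_mono, clarify)
    fix a b m n
    let ?q = "kap K a b m n * cmod (\<Lambda> (n + m - a - b))"
    have q: "0 \<le> ?q" by (simp add: kap_nonneg[OF K])
    have "cmod (of_real (kap K a b m n) * quartic_forcing a b m n c f) =
      ?q * cmod (c a * c b * cnj (f m) * cnj (c n) + c a * c b * cnj (c m) * cnj (f n)
     - f a * c b * cnj (c m) * cnj (c n) - c a * f b * cnj (c m) * cnj (c n))"
      unfolding quartic_forcing_def by (simp add: norm_mult kap_nonneg[OF K])
    also have "\<dots> \<le> ?q * (?x a * ?x b * ?f m * ?x n + ?x a * ?x b * ?x m * ?f n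
     + ?f a * ?x b * ?x m * ?x n + ?x a * ?f b * ?x m * ?x n)"
      using q by (intro mult_left_mono norm_triangle_le norm_triangle_le_diff add_mono) (auto simp: norm_mult)
    finally show "cmod (of_real (kap K a b m n) * quartic_forcing a b m n c f) \<le>
       ?q * (?x a * ?x b * ?f m * ?x n) + ?q * (?x a * ?x b * ?x m * ?f n) +
       ?q * (?f a * ?x b * ?x m * ?x n) + ?q * (?x a * ?f b * ?x m * ?x n)"
      by (simp only: distrib_left)
  qed
  also have "\<dots> \<le> 3 * 4 powr s / (real K)\<^sup>2 * (G * sum ?x S * sum ?x S *
      L2_set (\<lambda>n. weight (10 * real K) s n * ?f n) S * L2_set (\<lambda>n. weight (10 * real K) s n * ?x n) S) +
     3 * 4 powr s / (real K)\<^sup>2 * (G * sum ?x S * sum ?x S *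
      L2_set (\<lambda>n. weight (10 * real K) s n * ?x n) S * L2_set (\<lambda>n. weight (10 * real K) s n * ?f n) S) +
     3 * 4 powr s / (real K)\<^sup>2 * (G * sum ?f S * sum ?x S *
      L2_set (\<lambda>n. weight (10 * real K) s n * ?x n) S * L2_set (\<lambda>n. weight (10 * real K) s n * ?x n) S) +
     3 * 4 powr s / (real K)\<^sup>2 * (G * sum ?x S * sum ?f S *
      L2_set (\<lambda>n. weight (10 * real K) s n * ?x n) S * L2_set (\<lambda>n. weight (10 * real K) s n * ?x n) S)"
    by (intro add_mono kap_sum_le K S) auto
  also have "\<dots> = 3 * 4 powr s / (real K)\<^sup>2 * (2 * G * sum ?x S * L2_set (\<lambda>n. weight (10 * real K) s n * ?x n) S *
     (sum ?f S * L2_set (\<lambda>n. weight (10 * real K) s n * ?x n) S +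
      sum ?x S * L2_set (\<lambda>n. weight (10 * real K) s n * ?f n) S))"
    unfolding divide_inverse by algebra
  finally show ?thesis .
qed

text \<open>The dispersive term rotates each coefficient and leaves its modulus unchanged, so only
  \<open>f\<close> appears.\<close>

lemma square_sum_deriv:
  fixes c :: "real \<Rightarrow> int \<Rightarrow> complex"
  assumes d: "\<And>n. n \<in> S \<Longrightarrow> ((\<lambda>t. c t n) has_vector_derivative (- \<i> * (of_int n)\<^sup>2 * c t n - \<i> * f n)) (at t)"
  shows "((\<lambda>t. \<Sum>n\<in>S. p n * (cmod (c t n))\<^sup>2) has_vector_derivative
    2 * Im (\<Sum>n\<in>S. of_real (p n) * (cnj (c t n) * f n))) (at t)"
proof -
  have "((\<lambda>t. (cmod (c t n))\<^sup>2) has_vector_derivative 2 * Im (cnj (c t n) * f n)) (at t)" if "n \<in> S" for n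
  proof -
    have "((\<lambda>t. c t n * cnj (c t n)) has_vector_derivative of_real (2 * Im (cnj (c t n) * f n))) (at t)"
      by (rule derivative_eq_intros d that refl)+ (simp add: complex_eq_iff power2_eq_square algebra_simps)
    from bounded_linear.has_vector_derivative[OF bounded_linear_Re this]
    show ?thesis by (simp only: complex_norm_square[symmetric] Re_complex_of_real)
  qed
  then have "((\<lambda>t. \<Sum>n\<in>S. p n * (cmod (c t n))\<^sup>2) has_vector_derivative
    (\<Sum>n\<in>S. p n * (2 * Im (cnj (c t n) * f n)))) (at t)"
    by (intro has_vector_derivative_sum has_vector_derivative_mult_right) auto
  also have "(\<Sum>n\<in>S. p n * (2 * Im (cnj (c t n) * f n))) = 2 * Im (\<Sum>n\<in>S. of_real (p n) * (cnj (c t n) * f n))"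
    unfolding Im_sum sum_distrib_left by (intro sum.cong refl) (simp add: algebra_simps)
  finally show ?thesis .
qed

text \<open>The derivative of the weighted square contains
  \<open>2 * Im (nonresonant K S c)\<close>, and that of the corrector contains
  \<open>\<i> * nonresonant K S c\<close>. Twice its real part is the negative of the former, which
  fixes the factor 2 and the sign.\<close>

definition modified_square :: "nat \<Rightarrow> int set \<Rightarrow> (int \<Rightarrow> complex) \<Rightarrow> real" where
  "modified_square K S c = (\<Sum>n\<in>S. (weight (10 * real K) s n)\<^sup>2 * (cmod (c n))\<^sup>2) + 2 * Re (corrector K S c)"

lemma weighted_square_eq:
  "(\<Sum>n\<in>S. (weight N s n)\<^sup>2 * (cmod (c n))\<^sup>2) = (L2_set (\<lambda>n. weight N s n * cmod (c n)) S)\<^sup>2"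
  unfolding L2_set_def by (simp add: sum_nonneg power_mult_distrib)

text \<open>\<open>e\<close> is the truncation error. It is a single sequence because the equation
  is used at the one time \<open>t\<close> only.\<close>

lemma modified_square_deriv:
  fixes c :: "real \<Rightarrow> int \<Rightarrow> complex"
  assumes d: "\<And>n. n \<in> S \<Longrightarrow> ((\<lambda>t. c t n) has_vector_derivative
      (- \<i> * (of_int n)\<^sup>2 * c t n - \<i> * (cubic \<Lambda> S (c t) n + e n))) (at t)"
    and K: "1 \<le> K" and S: "finite S"
  defines "X \<equiv> \<Sum>n\<in>S. cmod (c t n)" and "Y \<equiv> L2_set (\<lambda>n. weight (10 * real K) s n * cmod (c t n)) S"
    and "E1 \<equiv> \<Sum>n\<in>S. cmod (e n)" and "E2 \<equiv> L2_set (\<lambda>n. weight (10 * real K) s n * cmod (e n)) S"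
    and "H \<equiv> \<Sum>n\<in>S. of_bool (\<not> \<bar>n\<bar> \<le> int K) * cmod (c t n)"
    and "V \<equiv> \<Sum>n\<in>S. of_bool (\<bar>n\<bar> \<le> int K) * (1 + \<bar>real_of_int n\<bar>) * cmod (c t n)"
  shows "\<exists>D. ((\<lambda>t. modified_square K S (c t)) has_real_derivative D) (at t) \<and>
    \<bar>D\<bar> \<le> 2 * (G * X * Y\<^sup>2 * (6 * 4 powr s * H + 3 * 4 powr s / K * X + 4 * s * 2 powr s / K * V)) + 2 * (Y * E2) +
      2 * (3 * 4 powr s / (real K)\<^sup>2 * (2 * G * X * Y * ((G * X ^ 3 + E1) * Y + X * (3 * 4 powr s * G * X\<^sup>2 * Y + E2))))"
proof -
  let ?w = "weight (10 * real K) s"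
  let ?f = "\<lambda>n. cubic \<Lambda> S (c t) n + e n"
  define F where "F = (\<Sum>(a,b,m,n)\<in>quads S. of_real (kap K a b m n) * quartic_forcing a b m n (c t) ?f)"
  define R1 where "R1 = (\<Sum>n\<in>S. of_real ((?w n)\<^sup>2) * (cnj (c t n) * cubic \<Lambda> S (c t) n))"
  define R2 where "R2 = (\<Sum>n\<in>S. of_real ((?w n)\<^sup>2) * (cnj (c t n) * e n))"
  define D where "D = 2 * Im (R1 + R2) + 2 * Re (\<i> * nonresonant K S (c t) + F)"
  have nn: "0 \<le> X" "0 \<le> Y" "0 \<le> E1" "0 \<le> E2" unfolding X_def Y_def E1_def E2_def by (auto intro: sum_nonneg)
  have N: "1 \<le> 10 * real K" using K by linarith
  have "((\<lambda>t. modified_square K S (c t)) has_vector_derivative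
     2 * Im (\<Sum>n\<in>S. of_real ((?w n)\<^sup>2) * (cnj (c t n) * ?f n)) + 2 * Re (\<i> * nonresonant K S (c t) + F)) (at t)"
    unfolding modified_square_def F_def
    by (intro has_vector_derivative_add square_sum_deriv[OF d] has_vector_derivative_mult_right
          bounded_linear.has_vector_derivative[OF bounded_linear_Re corrector_deriv[OF d K]])
  also have "(\<Sum>n\<in>S. of_real ((?w n)\<^sup>2) * (cnj (c t n) * ?f n)) = R1 + R2"
    unfolding R1_def R2_def by (simp add: sum.distrib[symmetric] algebra_simps)
  finally have der: "((\<lambda>t. modified_square K S (c t)) has_real_derivative D) (at t)"
    unfolding D_def has_real_derivative_iff_has_vector_derivative .
  have D2: "D = 2 * (Im R1 - Im (nonresonant K S (c t))) + 2 * Im R2 + 2 * Re F"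
    unfolding D_def by simp
  have b1: "\<bar>Im R1 - Im (nonresonant K S (c t))\<bar> \<le>
      G * X * Y\<^sup>2 * (6 * 4 powr s * H + 3 * 4 powr s / K * X + 4 * s * 2 powr s / K * V)"
    unfolding R1_def X_def Y_def H_def V_def by (rule cubic_pairing_le[OF K S])
  have b2: "cmod R2 \<le> Y * E2"
  proof -
    have "cmod R2 \<le> (\<Sum>n\<in>S. \<bar>?w n * cmod (c t n)\<bar> * \<bar>?w n * cmod (e n)\<bar>)"
      unfolding R2_def
      by (intro order.trans[OF norm_sum] sum_mono) (simp add: norm_mult norm_power power2_eq_square abs_mult mult_ac)
    also have "\<dots> \<le> Y * E2" unfolding Y_def E2_def by (rule L2_set_mult_ineq)
    finally show ?thesis .
  qed
  have b3: "cmod F \<le> 3 * 4 powr s / (real K)\<^sup>2 *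
      (2 * G * X * Y * ((G * X ^ 3 + E1) * Y + X * (3 * 4 powr s * G * X\<^sup>2 * Y + E2)))"
  proof -
    have "cmod F \<le> 3 * 4 powr s / (real K)\<^sup>2 *
      (2 * G * X * Y * ((\<Sum>n\<in>S. cmod (?f n)) * Y + X * L2_set (\<lambda>n. ?w n * cmod (?f n)) S))"
      unfolding F_def X_def Y_def by (rule forcing_le[OF K S])
    also have "\<dots> \<le> 3 * 4 powr s / (real K)\<^sup>2 *
      (2 * G * X * Y * ((G * X ^ 3 + E1) * Y + X * (3 * 4 powr s * G * X\<^sup>2 * Y + E2)))"
    proof (intro mult_left_mono add_mono mult_right_mono)
      have "(\<Sum>n\<in>S. cmod (?f n)) \<le> (\<Sum>n\<in>S. cmod (cubic \<Lambda> S (c t) n)) + E1"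
        unfolding E1_def sum.distrib[symmetric] by (intro sum_mono norm_triangle_ineq)
      also have "\<dots> \<le> G * X ^ 3 + E1" unfolding X_def by (intro add_right_mono cubic_l1_le S)
      finally show "(\<Sum>n\<in>S. cmod (?f n)) \<le> G * X ^ 3 + E1" .
      have "L2_set (\<lambda>n. ?w n * cmod (?f n)) S \<le> L2_set (\<lambda>n. ?w n * cmod (cubic \<Lambda> S (c t) n) + ?w n * cmod (e n)) S"
        unfolding distrib_left[symmetric]
        by (intro L2_set_mono mult_left_mono norm_triangle_ineq mult_nonneg_nonneg weight_nonneg) auto
      also have "\<dots> \<le> L2_set (\<lambda>n. ?w n * cmod (cubic \<Lambda> S (c t) n)) S + E2"
        unfolding E2_def by (rule L2_set_triangle_ineq)
      also have "\<dots> \<le> 3 * 4 powr s * G * X\<^sup>2 * Y + E2"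
        unfolding X_def Y_def by (intro add_right_mono cubic_weight_le S N)
      finally show "L2_set (\<lambda>n. ?w n * cmod (?f n)) S \<le> 3 * 4 powr s * G * X\<^sup>2 * Y + E2" .
    qed (use nn G_nonneg in auto)
    finally show ?thesis .
  qed
  have tri: "\<bar>2 * u + 2 * Im R2 + 2 * Re F\<bar> \<le> 2 * v + 2 * w + 2 * z"
    if "\<bar>u\<bar> \<le> v" "cmod R2 \<le> w" "cmod F \<le> z" for u v w z
    using that abs_Im_le_cmod[of R2] abs_Re_le_cmod[of F] by linarith
  show ?thesis
    by (rule exI[of _ D], rule conjI[OF der], unfold D2) (rule tri[OF b1 b2 b3])
qed

text \<open>The tail of \<open>1 / (1 + n\<^sup>2)\<close> above \<open>K\<close> is at most
  \<open>2 / K\<close>, and there are at most \<open>2 * K + 1\<close> low modes, each contributing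
  at most 2 to the sum for the derivative. The constants 3 come from \<open>5 \<le> 9\<close> and
  \<open>2 * (2 * K + 1) \<le> 9 * K\<close>.\<close>

lemma mode_sums_le:
  fixes x :: "int \<Rightarrow> real"
  assumes K: "1 \<le> K" and S: "finite S" and x: "\<And>n. 0 \<le> x n" "(\<Sum>n\<in>S. (1 + (real_of_int n)\<^sup>2) * (x n)\<^sup>2) \<le> \<beta>\<^sup>2"
    and \<beta>: "0 \<le> \<beta>"
  shows "sum x S \<le> 3 * \<beta>"
    and "(\<Sum>n\<in>S. of_bool (\<not> \<bar>n\<bar> \<le> int K) * x n) \<le> 2 / sqrt K * \<beta>"
    and "(\<Sum>n\<in>S. of_bool (\<bar>n\<bar> \<le> int K) * (1 + \<bar>real_of_int n\<bar>) * x n) \<le> 3 * sqrt K * \<beta>"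
proof -
  have pos: "0 < 1 + (real_of_int n)\<^sup>2" for n by (simp add: add_pos_nonneg)
  have "(\<Sum>n\<in>S. 1 * x n) \<le> 3 * \<beta>"
    using sum_inverse_square_le_5[OF S] by (intro l1_le_weighted_l2[OF S x(1) _ x(2)] \<beta>) auto
  then show "sum x S \<le> 3 * \<beta>" by simp
  show "(\<Sum>n\<in>S. of_bool (\<not> \<bar>n\<bar> \<le> int K) * x n) \<le> 2 / sqrt K * \<beta>"
  proof (intro l1_le_weighted_l2[OF S x(1) _ x(2)] \<beta>)
    have "(\<Sum>n\<in>S. (of_bool (\<not> \<bar>n\<bar> \<le> int K))\<^sup>2 / (1 + (real_of_int n)\<^sup>2)) =
      (\<Sum>n\<in>{n\<in>S. \<not> \<bar>n\<bar> \<le> int K}. 1 / (1 + (real_of_int n)\<^sup>2))"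
      using S by (intro sum.mono_neutral_cong_right) auto
    also have "\<dots> \<le> 2 / K" using S K by (intro sum_inverse_square_int) auto
    also have "\<dots> \<le> (2 / sqrt K)\<^sup>2" using K by (simp add: power_divide divide_right_mono)
    finally show "(\<Sum>n\<in>S. (of_bool (\<not> \<bar>n\<bar> \<le> int K))\<^sup>2 / (1 + (real_of_int n)\<^sup>2)) \<le> (2 / sqrt K)\<^sup>2" .
  qed auto
  show "(\<Sum>n\<in>S. of_bool (\<bar>n\<bar> \<le> int K) * (1 + \<bar>real_of_int n\<bar>) * x n) \<le> 3 * sqrt K * \<beta>"
  proof (intro l1_le_weighted_l2[OF S x(1) _ x(2)] \<beta>)
    have "(\<Sum>n\<in>S. (of_bool (\<bar>n\<bar> \<le> int K) * (1 + \<bar>real_of_int n\<bar>))\<^sup>2 / (1 + (real_of_int n)\<^sup>2)) \<le>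
      (\<Sum>n\<in>{n\<in>S. \<bar>n\<bar> \<le> int K}. 2)"
    proof -
      have "(\<Sum>n\<in>S. (of_bool (\<bar>n\<bar> \<le> int K) * (1 + \<bar>real_of_int n\<bar>))\<^sup>2 / (1 + (real_of_int n)\<^sup>2)) =
        (\<Sum>n\<in>{n\<in>S. \<bar>n\<bar> \<le> int K}. (1 + \<bar>real_of_int n\<bar>)\<^sup>2 / (1 + (real_of_int n)\<^sup>2))"
        using S by (intro sum.mono_neutral_cong_right) auto
      also have "\<dots> \<le> (\<Sum>n\<in>{n\<in>S. \<bar>n\<bar> \<le> int K}. 2)"
      proof (intro sum_mono)
        fix n
        have "0 \<le> (1 - \<bar>real_of_int n\<bar>)\<^sup>2" by simp
        then have "(1 + \<bar>real_of_int n\<bar>)\<^sup>2 \<le> 2 * (1 + (real_of_int n)\<^sup>2)"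
          by (simp add: power2_eq_square algebra_simps)
        then show "(1 + \<bar>real_of_int n\<bar>)\<^sup>2 / (1 + (real_of_int n)\<^sup>2) \<le> 2"
          using pos[of n] by (simp add: divide_le_eq)
      qed
      finally show ?thesis .
    qed
    also have "\<dots> = 2 * real (card {n\<in>S. \<bar>n\<bar> \<le> int K})" by simp
    also have "\<dots> \<le> 2 * real (card {- int K..int K})"
      by (intro mult_left_mono of_nat_mono card_mono) auto
    also have "\<dots> \<le> (3 * sqrt K)\<^sup>2" using K by (simp add: power_mult_distrib)
    finally show "(\<Sum>n\<in>S. (of_bool (\<bar>n\<bar> \<le> int K) * (1 + \<bar>real_of_int n\<bar>))\<^sup>2 / (1 + (real_of_int n)\<^sup>2)) \<le> (3 * sqrt K)\<^sup>2" .
  qed auto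
qed

text \<open>Chosen to dominate each constant needed below: the coefficients 126, 72 and 36 of the
  main part of the rate, \<open>2 + 144 * 4 powr s * G\<close> for the truncation error, and
  \<open>54 * 4 powr s * G\<close> for the corrector; \<open>198 = 144 + 54\<close>.\<close>

definition growth_const :: real where
  "growth_const = 3 + (126 * 4 powr s + 72 * (s * 2 powr s)) * G +
     36 * 4 powr s * G * (27 * G + 81 * 4 powr s * G) + 198 * 4 powr s * G"

lemma growth_const_ge: "3 \<le> growth_const"
  unfolding growth_const_def using s_ge_1 G_nonneg by simp

text \<open>The corrector is even of size \<open>1 / K\<^sup>2\<close>. This is weakened to
  \<open>1 / sqrt K\<close> so that the same small parameter controls both the closeness and the
  growth rate.\<close>

lemma modified_square_close:
  assumes K: "1 \<le> K" and S: "finite S" and \<beta>: "1 \<le> \<beta>" "(\<Sum>n\<in>S. (1 + (real_of_int n)\<^sup>2) * (cmod (c n))\<^sup>2) \<le> \<beta>\<^sup>2"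
  shows "\<bar>modified_square K S c - (\<Sum>n\<in>S. (weight (10 * real K) s n)\<^sup>2 * (cmod (c n))\<^sup>2)\<bar>
    \<le> growth_const * \<beta> ^ 4 / sqrt K * (\<Sum>n\<in>S. (weight (10 * real K) s n)\<^sup>2 * (cmod (c n))\<^sup>2)"
proof -
  let ?Q = "(\<Sum>n\<in>S. (weight (10 * real K) s n)\<^sup>2 * (cmod (c n))\<^sup>2)"
  have Q: "0 \<le> ?Q" by (simp add: sum_nonneg)
  have X: "(\<Sum>n\<in>S. cmod (c n)) \<le> 3 * \<beta>" using mode_sums_le(1)[OF K S _ \<beta>(2)] \<beta> by simp
  have K1: "1 \<le> sqrt K" "sqrt K \<le> (real K)\<^sup>2"
  proof -
    show 1: "1 \<le> sqrt K" using K by simp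
    have "sqrt K ^ 4 = (real K)\<^sup>2" using power_mult[of "sqrt K" 2 2] by simp
    then show "sqrt K \<le> (real K)\<^sup>2" using power_increasing[of 1 4 "sqrt K"] 1 by simp
  qed
  have "\<bar>modified_square K S c - ?Q\<bar> \<le> 2 * cmod (corrector K S c)"
    unfolding modified_square_def using abs_Re_le_cmod[of "corrector K S c"] by simp
  also have "\<dots> \<le> 2 * (3 * 4 powr s / (real K)\<^sup>2 * (G * (\<Sum>n\<in>S. cmod (c n))\<^sup>2 * ?Q))"
    unfolding weighted_square_eq by (intro mult_left_mono corrector_le K S) auto
  also have "\<dots> \<le> 2 * (3 * 4 powr s / sqrt K * (G * (3 * \<beta>)\<^sup>2 * ?Q))"
    using X K1 Q G_nonneg \<beta> by (intro mult_left_mono mult_mono divide_left_mono power_mono) (auto intro: sum_nonneg)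
  also have "\<dots> = (54 * 4 powr s * G) * \<beta>\<^sup>2 / sqrt K * ?Q" by (simp add: power_mult_distrib)
  also have "\<dots> \<le> growth_const * \<beta> ^ 4 / sqrt K * ?Q"
  proof (intro mult_right_mono divide_right_mono mult_mono)
    show "54 * 4 powr s * G \<le> growth_const" unfolding growth_const_def using s_ge_1 G_nonneg by simp
    show "\<beta>\<^sup>2 \<le> \<beta> ^ 4" using \<beta> by (intro power_increasing) auto
  qed (use Q growth_const_ge in auto)
  finally show ?thesis .
qed

text \<open>The fourth power of \<open>\<beta>\<close> comes from the cubic term inserted into the
  corrector, where six factors meet and four of them are measured in \<open>\<ell>\<^sup>1\<close>;
  the direct terms only need \<open>\<beta>\<^sup>2\<close>.\<close>

lemma growth_rate:
  fixes c :: "real \<Rightarrow> int \<Rightarrow> complex"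
  assumes d: "\<And>n. n \<in> S \<Longrightarrow> ((\<lambda>t. c t n) has_vector_derivative
      (- \<i> * (of_int n)\<^sup>2 * c t n - \<i> * (cubic \<Lambda> S (c t) n + e n))) (at t)"
    and K: "1 \<le> K" and S: "finite S" and \<beta>: "1 \<le> \<beta>" "(\<Sum>n\<in>S. (1 + (real_of_int n)\<^sup>2) * (cmod (c t n))\<^sup>2) \<le> \<beta>\<^sup>2"
    and e: "(\<Sum>n\<in>S. cmod (e n)) \<le> \<eta>" "L2_set (\<lambda>n. weight (10 * real K) s n * cmod (e n)) S \<le> \<eta>"
  defines "Q \<equiv> (\<Sum>n\<in>S. (weight (10 * real K) s n)\<^sup>2 * (cmod (c t n))\<^sup>2)"
  shows "\<exists>D. ((\<lambda>t. modified_square K S (c t)) has_real_derivative D) (at t) \<and>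
    \<bar>D\<bar> \<le> growth_const * \<beta> ^ 4 / sqrt K * Q + growth_const * \<beta>\<^sup>2 * \<eta> * (1 + Q)"
proof -
  define X where "X = (\<Sum>n\<in>S. cmod (c t n))"
  define Y where "Y = L2_set (\<lambda>n. weight (10 * real K) s n * cmod (c t n)) S"
  define E1 where "E1 = (\<Sum>n\<in>S. cmod (e n))"
  define E2 where "E2 = L2_set (\<lambda>n. weight (10 * real K) s n * cmod (e n)) S"
  define H where "H = (\<Sum>n\<in>S. of_bool (\<not> \<bar>n\<bar> \<le> int K) * cmod (c t n))"
  define V where "V = (\<Sum>n\<in>S. of_bool (\<bar>n\<bar> \<le> int K) * (1 + \<bar>real_of_int n\<bar>) * cmod (c t n))"
  define r where "r = sqrt K"
  define q where "q = 4 powr s"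
  define p where "p = s * 2 powr s"
  have r: "1 \<le> r" "0 < r" "r * r = K" using K unfolding r_def by auto
  have q: "0 \<le> q" "0 \<le> p" "0 \<le> G" unfolding q_def p_def using s_ge_1 G_nonneg by auto
  have Qeq: "Q = Y\<^sup>2" unfolding Q_def Y_def by (rule weighted_square_eq)
  have nn: "0 \<le> X" "0 \<le> Y" "0 \<le> E1" "0 \<le> E2" "0 \<le> H" "0 \<le> V"
    unfolding X_def Y_def E1_def E2_def H_def V_def by (auto intro!: sum_nonneg)
  have E: "E1 \<le> \<eta>" "E2 \<le> \<eta>" using e unfolding E1_def E2_def .
  have \<eta>: "0 \<le> \<eta>" using E nn by linarith
  have X: "X \<le> 3 * \<beta>" unfolding X_def using mode_sums_le(1)[OF K S _ \<beta>(2)] \<beta> by simp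
  have H: "H \<le> 2 * \<beta> / r" unfolding H_def r_def using mode_sums_le(2)[OF K S _ \<beta>(2)] \<beta> by simp
  have V: "V \<le> 3 * r * \<beta>" unfolding V_def r_def using mode_sums_le(3)[OF K S _ \<beta>(2)] \<beta> by simp
  have Kr: "1 / real K \<le> 1 / r" "1 / (real K)\<^sup>2 \<le> 1 / r"
  proof -
    have 1: "r \<le> r * r" using mult_left_mono[of 1 r r] r(1) by simp
    have "1 \<le> r * r" using 1 r(1) by linarith
    then have "r \<le> (r * r) * (r * r)" using mult_right_mono[of 1 "r * r" "r * r"] 1 by linarith
    with 1 show "1 / real K \<le> 1 / r" "1 / (real K)\<^sup>2 \<le> 1 / r"
      unfolding r(3)[symmetric] power2_eq_square using r by (auto intro!: divide_left_mono)
  qed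
  obtain D where D: "((\<lambda>t. modified_square K S (c t)) has_real_derivative D) (at t)"
    and Dle: "\<bar>D\<bar> \<le> 2 * (G * X * Y\<^sup>2 * (6 * q * H + 3 * q / K * X + 4 * s * 2 powr s / K * V)) + 2 * (Y * E2) +
      2 * (3 * q / (real K)\<^sup>2 * (2 * G * X * Y * ((G * X ^ 3 + E1) * Y + X * (3 * q * G * X\<^sup>2 * Y + E2))))"
    using modified_square_deriv[OF d K S] unfolding X_def Y_def E1_def E2_def H_def V_def q_def by blast
  have Y1: "Y \<le> 1 + Y\<^sup>2" "Y\<^sup>2 \<le> 1 + Y\<^sup>2"
  proof -
    have "2 * Y \<le> 1 + Y\<^sup>2" using zero_le_power2[of "Y - 1"] by (simp add: power2_eq_square algebra_simps)
    then show "Y \<le> 1 + Y\<^sup>2" "Y\<^sup>2 \<le> 1 + Y\<^sup>2" using nn(2) by linarith+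
  qed
  have t1: "2 * (G * X * Y\<^sup>2 * (6 * q * H + 3 * q / K * X + 4 * s * 2 powr s / K * V)) \<le>
    (126 * q + 72 * p) * G * \<beta> ^ 4 / r * Y\<^sup>2"
  proof -
    have "6 * q * H \<le> 12 * q * \<beta> / r" using mult_left_mono[OF H, of "6 * q"] q by simp
    moreover have "3 * q / K * X \<le> 9 * q * \<beta> / r"
      using mult_mono[OF mult_left_mono[OF Kr(1), of "3 * q"] X] q r nn by simp
    \<comment> \<open>\<open>V\<close> may be as large as \<open>sqrt K\<close>, so of the factor
      \<open>1 / K\<close> of the commutator only \<open>1 / r\<close> survives.\<close>
    moreover have "4 * s * 2 powr s / K * V \<le> 12 * p * \<beta> / r"
    proof -
      have "4 * s * 2 powr s / K * V \<le> 4 * p / (r * r) * (3 * r * \<beta>)"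
        using mult_left_mono[OF V, of "4 * p / K"] q unfolding r(3) by (simp add: p_def)
      also have "\<dots> = 12 * p * \<beta> / r" using r(2) by (simp add: field_simps)
      finally show ?thesis .
    qed
    moreover have "(21 * q + 12 * p) * \<beta> / r = 12 * q * \<beta> / r + 9 * q * \<beta> / r + 12 * p * \<beta> / r"
      using r(2) by (simp add: field_simps)
    ultimately have a: "6 * q * H + 3 * q / K * X + 4 * s * 2 powr s / K * V \<le> (21 * q + 12 * p) * \<beta> / r"
      by linarith
    have "2 * (G * X * Y\<^sup>2 * (6 * q * H + 3 * q / K * X + 4 * s * 2 powr s / K * V)) \<le>
       2 * (G * (3 * \<beta>) * Y\<^sup>2 * ((21 * q + 12 * p) * \<beta> / r))"
      using a X nn q \<beta> r s_ge_1 by (intro mult_left_mono mult_mono) auto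
    also have "\<dots> = (126 * q + 72 * p) * G * \<beta>\<^sup>2 / r * Y\<^sup>2"
      unfolding divide_inverse by algebra
    also have "\<dots> \<le> (126 * q + 72 * p) * G * \<beta> ^ 4 / r * Y\<^sup>2"
      using \<beta> q r by (intro mult_right_mono divide_right_mono mult_left_mono power_increasing) auto
    finally show ?thesis .
  qed
  have t2: "2 * (Y * E2) \<le> 2 * \<beta>\<^sup>2 * \<eta> * (1 + Y\<^sup>2)"
  proof -
    have "2 * (Y * E2) \<le> 2 * ((1 + Y\<^sup>2) * \<eta>)" using Y1 E nn by (intro mult_left_mono mult_mono) auto
    also have "\<dots> \<le> 2 * (((1 + Y\<^sup>2) * \<eta>) * \<beta>\<^sup>2)"
      using \<eta> \<beta> mult_left_mono[of 1 "\<beta>\<^sup>2" "(1 + Y\<^sup>2) * \<eta>"] by simp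
    finally show ?thesis by (simp only: mult_ac)
  qed
  have t3: "2 * (3 * q / (real K)\<^sup>2 * (2 * G * X * Y * ((G * X ^ 3 + E1) * Y + X * (3 * q * G * X\<^sup>2 * Y + E2)))) \<le>
    36 * q * G * (27 * G + 81 * q * G) * \<beta> ^ 4 / r * Y\<^sup>2 + 144 * q * G * \<beta>\<^sup>2 * \<eta> * (1 + Y\<^sup>2)"
  proof -
    have "2 * (3 * q / (real K)\<^sup>2 * (2 * G * X * Y * ((G * X ^ 3 + E1) * Y + X * (3 * q * G * X\<^sup>2 * Y + E2)))) \<le>
      2 * (3 * q * (1 / r) * (2 * G * (3 * \<beta>) * Y * ((G * (3 * \<beta>) ^ 3 + \<eta>) * Y + (3 * \<beta>) * (3 * q * G * (3 * \<beta>)\<^sup>2 * Y + \<eta>))))"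
      using X E nn q \<beta> r mult_left_mono[OF Kr(2), of "3 * q"]
      by (intro mult_left_mono mult_mono add_mono power_mono mult_nonneg_nonneg add_nonneg_nonneg) auto
    also have "\<dots> = 36 * q * G * (27 * G + 81 * q * G) * \<beta> ^ 4 / r * Y\<^sup>2 +
        (1 / r) * (36 * q * G * \<eta> * (\<beta> * Y\<^sup>2 + 3 * (\<beta>\<^sup>2 * Y)))"
      unfolding divide_inverse by algebra
    also have "(1 / r) * (36 * q * G * \<eta> * (\<beta> * Y\<^sup>2 + 3 * (\<beta>\<^sup>2 * Y))) \<le>
        1 * (36 * q * G * \<eta> * (\<beta>\<^sup>2 * (1 + Y\<^sup>2) + 3 * (\<beta>\<^sup>2 * (1 + Y\<^sup>2))))"
      using r q \<eta> \<beta> nn Y1 self_le_power[of \<beta> 2] by (intro mult_mono mult_left_mono add_mono) auto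
    also have "\<dots> = 144 * q * G * \<beta>\<^sup>2 * \<eta> * (1 + Y\<^sup>2)" by (simp add: algebra_simps)
    finally show ?thesis by simp
  qed
  have d1: "(126 * q + 72 * p) * G * \<beta> ^ 4 / r * Y\<^sup>2 + 36 * q * G * (27 * G + 81 * q * G) * \<beta> ^ 4 / r * Y\<^sup>2 =
      ((126 * q + 72 * p) * G + 36 * q * G * (27 * G + 81 * q * G)) * (\<beta> ^ 4 / r * Y\<^sup>2)"
    unfolding divide_inverse by algebra
  have d2: "2 * \<beta>\<^sup>2 * \<eta> * (1 + Y\<^sup>2) + 144 * q * G * \<beta>\<^sup>2 * \<eta> * (1 + Y\<^sup>2) =
      (2 + 144 * q * G) * (\<beta>\<^sup>2 * \<eta> * (1 + Y\<^sup>2))"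
    by algebra
  have sum4: "\<bar>D\<bar> \<le> u' + v'" if "\<bar>D\<bar> \<le> u + v + w" "u \<le> x1" "v \<le> x2" "w \<le> x3 + x4" "x1 + x3 = u'" "x2 + x4 = v'"
    for u v w x1 x2 x3 x4 u' v' :: real
    using that by linarith
  have "\<bar>D\<bar> \<le> ((126 * q + 72 * p) * G + 36 * q * G * (27 * G + 81 * q * G)) * (\<beta> ^ 4 / r * Y\<^sup>2) +
      (2 + 144 * q * G) * (\<beta>\<^sup>2 * \<eta> * (1 + Y\<^sup>2))"
    by (rule sum4[OF Dle t1 t2 t3 d1 d2])
  also have "\<dots> \<le> growth_const * (\<beta> ^ 4 / r * Y\<^sup>2) + growth_const * (\<beta>\<^sup>2 * \<eta> * (1 + Y\<^sup>2))"
  proof (intro add_mono mult_right_mono)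
    have "0 \<le> 36 * q * G * (27 * G + 81 * q * G)" "0 \<le> (126 * q + 72 * p) * G" "0 \<le> q * G" using q by auto
    then show "(126 * q + 72 * p) * G + 36 * q * G * (27 * G + 81 * q * G) \<le> growth_const"
      "2 + 144 * q * G \<le> growth_const"
      unfolding growth_const_def q_def p_def by linarith+
  qed (use \<beta> r \<eta> in auto)
  finally show ?thesis using D unfolding Qeq r_def by (intro exI[of _ D]) (simp add: mult_ac)
qed

end

section \<open>Fourier series on the circle\<close>

definition circ :: "real measure" where
  "circ = restrict_space lborel {0..2*pi}"

text \<open>With this normalisation a function is the sum of its coefficients times characters, and
  products turn into convolutions without factors of \<open>2 * pi\<close>.\<close>

definition fc :: "(real \<Rightarrow> complex) \<Rightarrow> int \<Rightarrow> complex" where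
  "fc f n = fourier_coeff f n / (2 * pi)"

abbreviation modes :: "nat \<Rightarrow> int set" where "modes L \<equiv> {- int L..int L}"

definition tpoly :: "int set \<Rightarrow> (int \<Rightarrow> complex) \<Rightarrow> real \<Rightarrow> complex" where
  "tpoly A a x = (\<Sum>n\<in>A. a n * cis (of_int n * x))"

abbreviation psum :: "(int \<Rightarrow> complex) \<Rightarrow> nat \<Rightarrow> real \<Rightarrow> complex" where
  "psum a L \<equiv> tpoly (modes L) a"

definition ser :: "(int \<Rightarrow> complex) \<Rightarrow> real \<Rightarrow> complex" where
  "ser a x = (\<Sum>\<^sub>\<infinity>n. a n * cis (of_int n * x))"

lemma space_circ: "space circ = {0..2*pi}"
  by (simp add: circ_def space_restrict_space)

lemma finite_measure_circ: "finite_measure circ"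
  unfolding circ_def by (intro finite_measureI) (simp add: emeasure_restrict_space space_restrict_space)

lemma measure_circ: "measure circ (space circ) = 2 * pi"
  unfolding circ_def by (simp add: measure_restrict_space space_restrict_space)

lemma circ_measurable: "f \<in> borel_measurable borel \<Longrightarrow> f \<in> borel_measurable circ"
  unfolding circ_def by (intro measurable_restrict_space1) simp

lemma circle_integral_eq: "circle_integral f = integral\<^sup>L circ f"
  unfolding circ_def set_lebesgue_integral_def by (simp add: integral_restrict_space)

lemma circle_integrable_eq:
  fixes f :: "real \<Rightarrow> 'b::{banach, second_countable_topology}"
  shows "set_integrable lborel {0..2*pi} f \<longleftrightarrow> integrable circ f"
  unfolding circ_def set_integrable_def
  by (rule integrable_restrict_space[symmetric]) simp

lemma AE_circ_iff: "(AE x in circ. P x) \<longleftrightarrow> (AE x in lborel. x \<in> {0..2*pi} \<longrightarrow> P x)"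
  unfolding circ_def by (subst AE_restrict_space_iff) auto

lemma AE_circ_interior: "AE x in circ. 0 < x \<and> x < 2 * pi"
proof -
  have "AE x in lborel. x \<noteq> 0 \<and> x \<noteq> 2 * pi" by (intro AE_conjI AE_lborel_singleton)
  then show ?thesis unfolding AE_circ_iff by eventually_elim auto
qed

lemma integrable_circ_bounded:
  fixes f :: "real \<Rightarrow> 'b::{banach, second_countable_topology}"
  assumes "f \<in> borel_measurable circ" "AE x in circ. norm (f x) \<le> B"
  shows "integrable circ f"
  using finite_measure.integrable_const_bound[OF finite_measure_circ] assms by blast

lemma integral_circ_bound:
  fixes f :: "real \<Rightarrow> 'b::{banach, second_countable_topology}"
  assumes "AE x in circ. norm (f x) \<le> B" "0 \<le> B"
  shows "norm (integral\<^sup>L circ f) \<le> B * (2 * pi)"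
proof (cases "integrable circ f")
  case True
  have "norm (integral\<^sup>L circ f) \<le> (\<integral>x. norm (f x) \<partial>circ)" by (rule integral_norm_bound)
  also have "\<dots> \<le> (\<integral>x. B \<partial>circ)"
    using assms True by (intro integral_mono_AE) (auto intro!: integrable_circ_bounded[where B = B])
  also have "\<dots> = B * (2 * pi)" using measure_circ by (simp add: mult.commute)
  finally show ?thesis .
next
  case False
  then show ?thesis using assms by (simp add: not_integrable_integral_eq)
qed

lemma cis_measurable [measurable]: "(\<lambda>x. cis (c * x)) \<in> borel_measurable borel"
  by (intro borel_measurable_continuous_onI continuous_intros)

lemma fc_eq: "fc f n = (\<integral>x. f x * cis (- (of_int n * x)) \<partial>circ) / (2 * pi)"
  unfolding fc_def fourier_coeff_def circle_integral_eq ..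

lemma integrable_mult_cis:
  assumes "integrable circ f" shows "integrable circ (\<lambda>x. f x * cis (c * x))"
proof (rule Bochner_Integration.integrable_bound[OF assms])
  show "(\<lambda>x. f x * cis (c * x)) \<in> borel_measurable circ"
    by (intro borel_measurable_times borel_measurable_integrable[OF assms] circ_measurable cis_measurable)
qed (simp add: norm_mult)

lemma has_vector_derivative_cis_mult:
  "((\<lambda>x. cis (c * x)) has_vector_derivative (\<i> * of_real c * cis (c * x))) (at x within A)"
  unfolding has_vector_derivative_def
  by (rule has_derivative_eq_rhs, rule has_derivative_cis, rule has_derivative_mult_right, rule has_derivative_ident)
     (simp add: scaleR_conv_of_real fun_eq_iff)

lemma integral_cis: "(\<integral>x. cis (of_int k * x) \<partial>circ) = (if k = 0 then 2 * pi else 0)"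
proof (cases "k = 0")
  case True
  then show ?thesis using measure_circ by (simp add: scaleR_conv_of_real)
next
  case False
  let ?F = "\<lambda>x. cis (of_int k * x) / (\<i> * of_int k)"
  have "(?F has_vector_derivative (cis (of_int k * x))) (at x within A)" for x A
    using has_vector_derivative_divide[OF has_vector_derivative_cis_mult[of "of_int k" x A], of "\<i> * of_int k"] False
    by simp
  then have "(\<integral>x. indicator {0..2*pi} x *\<^sub>R cis (of_int k * x) \<partial>lborel) = ?F (2 * pi) - ?F 0"
    by (intro integral_FTC_Icc continuous_intros) auto
  also have "\<dots> = 0"
    using cis_multiple_2pi[of "of_int k"] by (simp add: mult_ac)
  finally show ?thesis using False unfolding circ_def by (simp add: integral_restrict_space)
qed

section \<open>Uniqueness of Fourier coefficients\<close>

lemma integrable_mult_circle: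
  fixes f :: "complex \<Rightarrow> complex"
  assumes h: "integrable circ h" and f: "continuous_on UNIV f"
  shows "integrable circ (\<lambda>x. h x * f (cis x))"
proof -
  have "compact (f ` sphere 0 1)" by (intro compact_continuous_image continuous_on_subset[OF f]) auto
  then have "bounded (f ` sphere 0 1)" by (rule compact_imp_bounded)
  then obtain B where B: "\<forall>z\<in>sphere 0 1. norm (f z) \<le> B"
    unfolding bounded_iff by auto
  show ?thesis
  proof (rule Bochner_Integration.integrable_bound[OF integrable_mult_left[OF h, of "of_real B"]])
    show "AE x in circ. norm (h x * f (cis x)) \<le> norm (h x * of_real B)"
    proof (rule AE_I2)
      fix x
      have "norm (f (cis x)) \<le> \<bar>B\<bar>" using bspec[OF B, of "cis x"] by simp
      then show "norm (h x * f (cis x)) \<le> norm (h x * of_real B)"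
        by (simp add: norm_mult mult_left_mono)
    qed
    have "(\<lambda>x. f (cis x)) \<in> borel_measurable borel"
      by (intro borel_measurable_continuous_onI continuous_on_compose2[OF f] continuous_intros) auto
    then show "(\<lambda>x. h x * f (cis x)) \<in> borel_measurable circ"
      by (intro borel_measurable_times borel_measurable_integrable[OF h] circ_measurable)
  qed
qed

text \<open>The trigonometric polynomials are the polynomials in \<open>Re (cis x)\<close> and \<open>Im (cis x)\<close>, so
  Stone-Weierstrass on the unit circle applies; being orthogonal to all characters is preserved
  under multiplication by them.\<close>

lemma orthogonal_polynomial:
  fixes h :: "real \<Rightarrow> complex" and p :: "complex \<Rightarrow> real"
  assumes h: "integrable circ h" and p: "real_polynomial_function p"
    and w: "continuous_on UNIV w" "\<And>k::int. (\<integral>x. h x * w (cis x) * cis (of_int k * x) \<partial>circ) = 0"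
  shows "(\<integral>x. h x * (w (cis x) * of_real (p (cis x))) * cis (of_int k * x) \<partial>circ) = 0"
  using p w
\<comment> \<open>Keeping \<open>w\<close> arbitrary settles products: the first factor is absorbed
  into \<open>w\<close> before the hypothesis for the second one is applied.\<close>
proof (induction p arbitrary: w k)
  case (linear f)
  have int: "integrable circ (\<lambda>x. h x * w (cis x) * cis (of_int j * x))" for j :: int
    by (intro integrable_mult_cis integrable_mult_circle h linear)
  interpret f: bounded_linear f by fact
  \<comment> \<open>A real linear functional on the circle is a combination of cosine and sine,
    hence of \<open>cis x\<close> and \<open>cis (- x)\<close>; multiplying by it only shifts
    \<open>k\<close> by one.\<close>
  have fcis: "complex_of_real (f (cis x)) = of_real (f 1) * ((cis x + cis (- x)) / 2) + of_real (f \<i>) * ((cis x - cis (- x)) / (2 * \<i>))" for x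
  proof -
    have "cis x = cos x *\<^sub>R 1 + sin x *\<^sub>R \<i>" by (simp add: complex_eq_iff)
    then have "f (cis x) = cos x * f 1 + sin x * f \<i>" by (simp add: f.add f.scaleR)
    moreover have "(cis x + cis (- x)) / 2 = of_real (cos x)" "(cis x - cis (- x)) / (2 * \<i>) = of_real (sin x)"
      by (simp_all add: complex_eq_iff)
    ultimately show ?thesis by (simp only: of_real_add of_real_mult mult.commute)
  qed
  have eq: "h x * (w (cis x) * of_real (f (cis x))) * cis (of_int k * x) =
      (of_real (f 1) / 2 + of_real (f \<i>) / (2 * \<i>)) * (h x * w (cis x) * cis (of_int (k + 1) * x)) +
      (of_real (f 1) / 2 - of_real (f \<i>) / (2 * \<i>)) * (h x * w (cis x) * cis (of_int (k - 1) * x))" for x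
  proof -
    have 1: "cis (of_int (k + 1) * x) = cis (of_int k * x) * cis x" "cis (of_int (k - 1) * x) = cis (of_int k * x) * cis (- x)"
      unfolding cis_mult by (simp_all add: algebra_simps)
    show ?thesis unfolding 1 fcis divide_inverse by algebra
  qed
  show ?case unfolding eq
    by (subst Bochner_Integration.integral_add[OF integrable_mult_right[OF int] integrable_mult_right[OF int]])
       (simp only: integral_mult_right_zero linear(3) mult_zero_right add_0)
next
  case (const c)
  have "(\<integral>x. h x * (w (cis x) * of_real c) * cis (of_int k * x) \<partial>circ) =
     (\<integral>x. of_real c * (h x * w (cis x) * cis (of_int k * x)) \<partial>circ)"
    by (simp only: mult_ac)
  then show ?case using const by simp
next
  case (add f g)
  have int: "integrable circ (\<lambda>x. h x * (w (cis x) * of_real (q (cis x))) * cis (of_int k * x))"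
    if "real_polynomial_function q" for q
    using that
    by (intro integrable_mult_cis integrable_mult_circle[of h "\<lambda>z. w z * of_real (q z)"] h continuous_intros
        add.prems continuous_on_polymonial_function) (simp add: real_polynomial_function_eq)
  show ?case
    using add.IH(1)[OF add.prems] add.IH(2)[OF add.prems] Bochner_Integration.integral_add[OF int[OF add.hyps(1)] int[OF add.hyps(2)]]
    by (simp add: distrib_left distrib_right)
next
  case (mult f g)
  have "continuous_on UNIV (\<lambda>z. w z * of_real (f z))"
    using mult.hyps by (intro continuous_intros mult.prems continuous_on_polymonial_function) (simp add: real_polynomial_function_eq)
  from mult.IH(2)[OF this mult.IH(1)[OF mult.prems]] show ?case by (simp add: mult_ac)
qed

lemma orthogonal_continuous:
  fixes h :: "real \<Rightarrow> complex" and \<psi> :: "complex \<Rightarrow> real"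
  assumes h: "integrable circ h" "\<And>k::int. (\<integral>x. h x * cis (of_int k * x) \<partial>circ) = 0"
    and \<psi>: "continuous_on UNIV \<psi>"
  shows "(\<integral>x. h x * of_real (\<psi> (cis x)) \<partial>circ) = 0"
proof -
  let ?I = "\<integral>x. norm (h x) \<partial>circ"
  have bnd: "integrable circ (\<lambda>x. h x * of_real (q (cis x)))" if q: "continuous_on UNIV q" for q :: "complex \<Rightarrow> real"
    by (intro integrable_mult_circle[of h "\<lambda>z. of_real (q z)"] h continuous_on_of_real q)
  have bound: "norm (\<integral>x. h x * of_real (\<psi> (cis x)) \<partial>circ) \<le> e * ?I" if e: "0 < e" for e
  proof -
    obtain p where p: "real_polynomial_function p" "\<And>z. z \<in> sphere 0 1 \<Longrightarrow> \<bar>\<psi> z - p z\<bar> < e"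
      using Stone_Weierstrass_real_polynomial_function[of "sphere 0 1" \<psi> e] e continuous_on_subset[OF \<psi>] by auto
    have pc: "continuous_on UNIV p"
      using p(1) by (intro continuous_on_polymonial_function) (simp add: real_polynomial_function_eq)
    have "(\<integral>x. h x * of_real (p (cis x)) \<partial>circ) = 0"
      using orthogonal_polynomial[OF h(1) p(1), of "\<lambda>_. 1" 0] h(2) by simp
    then have "(\<integral>x. h x * of_real (\<psi> (cis x)) \<partial>circ) = (\<integral>x. h x * of_real (\<psi> (cis x) - p (cis x)) \<partial>circ)"
      using Bochner_Integration.integral_diff[OF bnd[OF \<psi>] bnd[OF pc]] by (simp add: right_diff_distrib)
    also have "norm \<dots> \<le> (\<integral>x. norm (h x * of_real (\<psi> (cis x) - p (cis x))) \<partial>circ)" by (rule integral_norm_bound)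
    also have "\<dots> \<le> (\<integral>x. e * norm (h x) \<partial>circ)"
    proof (rule integral_mono)
      show "integrable circ (\<lambda>x. norm (h x * of_real (\<psi> (cis x) - p (cis x))))"
        by (intro integrable_norm bnd[of "\<lambda>z. \<psi> z - p z"] continuous_intros \<psi> pc)
      show "norm (h x * of_real (\<psi> (cis x) - p (cis x))) \<le> e * norm (h x)" for x
        using p(2)[of "cis x"] by (simp add: norm_mult mult.commute[of e] mult_left_mono less_imp_le flip: of_real_diff)
    qed (use h in auto)
    finally show ?thesis by simp
  qed
  have "norm (\<integral>x. h x * of_real (\<psi> (cis x)) \<partial>circ) \<le> 0 + d" if d: "0 < d" for d
  proof -
    define I where "I = ?I"
    have I: "0 \<le> I" unfolding I_def by (rule Bochner_Integration.integral_nonneg) simp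
    then have "d / (I + 1) * I \<le> d"
      using d by (simp add: divide_le_eq mult_left_mono)
    then show ?thesis using bound[of "d / (I + 1)"] d I unfolding I_def[symmetric] by simp
  qed
  then have "norm (\<integral>x. h x * of_real (\<psi> (cis x)) \<partial>circ) \<le> 0" by (rule field_le_epsilon)
  then show ?thesis by simp
qed

text \<open>The indicator of a closed set is the pointwise limit of truncated multiples of the
  distance to its image on the unit circle, and these are continuous functions of
  \<open>cis x\<close>. Working with the image identifies 0 with \<open>2 * pi\<close>, so the limit
  is claimed only in the open interval.\<close>

lemma orthogonal_closed_set:
  fixes h :: "real \<Rightarrow> complex"
  assumes h: "integrable circ h" "\<And>k::int. (\<integral>x. h x * cis (of_int k * x) \<partial>circ) = 0"
    and A: "closed A"
  shows "(\<integral>x. indicator A x *\<^sub>R h x \<partial>circ) = 0"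
proof (cases "A \<inter> {0..2*pi} = {}")
  case True
  then have "(\<integral>x. indicator A x *\<^sub>R h x \<partial>circ) = (\<integral>x. 0 \<partial>circ)"
    by (intro Bochner_Integration.integral_cong) (auto simp: space_circ indicator_def)
  then show ?thesis by simp
next
  case False
  define C where "C = cis ` (A \<inter> {0..2*pi})"
  have "compact C" unfolding C_def
    by (intro compact_continuous_image closed_Int_compact A continuous_intros) auto
  then have C: "closed C" "C \<noteq> {}" using False by (auto simp: C_def compact_imp_closed)
  let ?\<psi> = "\<lambda>k z. max 0 (1 - real k * infdist z C)"
  have cont: "continuous_on UNIV (?\<psi> k)" for k by (intro continuous_intros)
  have z: "(\<integral>x. h x * of_real (?\<psi> k (cis x)) \<partial>circ) = 0" for k
    by (rule orthogonal_continuous[OF h cont])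
  have "(\<lambda>k. \<integral>x. h x * of_real (?\<psi> k (cis x)) \<partial>circ) \<longlonglongrightarrow> (\<integral>x. indicator A x *\<^sub>R h x \<partial>circ)"
  proof (rule integral_dominated_convergence[where w = "\<lambda>x. norm (h x)"])
    show "(\<lambda>x. indicator A x *\<^sub>R h x) \<in> borel_measurable circ"
      by (rule borel_measurable_scaleR[OF circ_measurable[OF borel_measurable_indicator[OF borel_closed[OF A]]]
            borel_measurable_integrable[OF h(1)]])
    show "(\<lambda>x. h x * of_real (?\<psi> k (cis x))) \<in> borel_measurable circ" for k
      using integrable_mult_circle[OF h(1) continuous_on_of_real[OF cont]] by (rule borel_measurable_integrable)
    show "AE x in circ. norm (h x * of_real (?\<psi> k (cis x))) \<le> norm (h x)" for k
    proof (rule AE_I2)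
      fix x
      have "\<bar>?\<psi> k (cis x)\<bar> \<le> 1" using infdist_nonneg[of "cis x" C] by (auto simp: max_def)
      then show "norm (h x * of_real (?\<psi> k (cis x))) \<le> norm (h x)"
        unfolding norm_mult norm_of_real by (intro mult_left_le) auto
    qed
    show "AE x in circ. (\<lambda>k. h x * of_real (?\<psi> k (cis x))) \<longlonglongrightarrow> indicator A x *\<^sub>R h x"
      using AE_circ_interior
    proof eventually_elim
      case (elim x)
      \<comment> \<open>As \<open>x\<close> lies strictly between 0 and \<open>2 * pi\<close>, it
        differs from any point of the closed interval by less than a full period, so
        \<open>cis\<close> cannot identify it with another one.\<close>
      have mem: "cis x \<in> C \<longleftrightarrow> x \<in> A"
      proof
        assume "cis x \<in> C"
        then obtain y where y: "y \<in> A" "0 \<le> y" "y \<le> 2 * pi" "cis x = cis y" unfolding C_def by auto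
        then have "sin x = sin y" "cos x = cos y" by (auto simp: complex_eq_iff)
        then obtain n :: int where n: "x = y + 2 * pi * n" using sin_cos_eq_iff[of x y] by blast
        have "2 * pi * n < 2 * pi * 1" "2 * pi * (- 1) < 2 * pi * n" using n y elim by linarith+
        then have "real_of_int n < 1" "- 1 < real_of_int n"
          using mult_less_cancel_left_pos[of "2 * pi" "of_int n" 1] mult_less_cancel_left_pos[of "2 * pi" "- 1" "of_int n"]
          by simp_all
        then have "n = 0" by linarith
        then show "x \<in> A" using n y by simp
      qed (use elim in \<open>auto simp: C_def\<close>)
      have "(\<lambda>k. ?\<psi> k (cis x)) \<longlonglongrightarrow> indicator A x"
      proof (cases "x \<in> A")
        case True
        then have "infdist (cis x) C = 0" using mem by simp
        then show ?thesis using True by simp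
      next
        case False
        then have d: "0 < infdist (cis x) C" using mem C infdist_pos_not_in_closed by blast
        obtain K :: nat where K: "1 / infdist (cis x) C \<le> K" using real_arch_simple by blast
        have "?\<psi> k (cis x) = 0" if "K \<le> k" for k
        proof -
          have "1 / infdist (cis x) C \<le> k" using K that by (meson of_nat_le_iff order_trans)
          then have "1 \<le> k * infdist (cis x) C" using d by (simp add: divide_le_eq)
          then show ?thesis by simp
        qed
        then have "eventually (\<lambda>k. ?\<psi> k (cis x) = 0) sequentially" unfolding eventually_sequentially by blast
        then show ?thesis using False by (auto intro: tendsto_eventually)
      qed
      from tendsto_mult_left[OF tendsto_of_real[OF this], of "h x"]
      show ?case by (simp add: scaleR_conv_of_real mult.commute indicator_def split: if_splits)
    qed
  qed (use h in auto)
  then show ?thesis unfolding z by (simp add: LIMSEQ_const_iff)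
qed

text \<open>The closed sets are stable under intersection and generate the Borel sets, so Dynkin's
  argument extends the vanishing integrals to all Borel sets. A function whose integral over every
  measurable set is zero vanishes almost everywhere.\<close>

theorem fourier_unique:
  fixes h :: "real \<Rightarrow> complex"
  assumes h: "integrable circ h" "\<And>k::int. (\<integral>x. h x * cis (of_int k * x) \<partial>circ) = 0"
  shows "AE x in circ. h x = 0"
proof -
  have int: "integrable circ (\<lambda>x. indicator A x *\<^sub>R h x)" if "A \<in> sets borel" for A
  proof (rule Bochner_Integration.integrable_bound[OF h(1)])
    show "(\<lambda>x. indicator A x *\<^sub>R h x) \<in> borel_measurable circ"
      by (rule borel_measurable_scaleR[OF circ_measurable[OF borel_measurable_indicator[OF that]]
            borel_measurable_integrable[OF h(1)]])
  qed (auto simp: indicator_def)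
  have zero: "(\<integral>x. indicator A x *\<^sub>R h x \<partial>circ) = 0" if "A \<in> sets borel" for A
  proof -
    have sb: "sets borel = sigma_sets UNIV (Collect (closed :: real set \<Rightarrow> bool))"
      by (subst borel_eq_closed) (simp add: sets_measure_of)
    have A: "A \<in> sigma_sets UNIV (Collect closed)" using that sb by simp
    have st: "Int_stable (Collect (closed :: real set \<Rightarrow> bool))" by (auto simp: Int_stable_def)
    have "Collect closed \<subseteq> Pow (UNIV :: real set)" by simp
    from st this A show ?thesis
    proof (induction rule: sigma_sets_induct_disjoint)
      case (basic A)
      then show ?case using orthogonal_closed_set[OF h] by simp
    next
      case empty
      then show ?case by simp
    next
      case (compl A)
      then have Ab: "A \<in> sets borel" using sb by simp
      have "(\<integral>x. indicator (UNIV - A) x *\<^sub>R h x \<partial>circ) = (\<integral>x. h x - indicator A x *\<^sub>R h x \<partial>circ)"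
        by (intro Bochner_Integration.integral_cong) (auto simp: indicator_def)
      also have "\<dots> = (\<integral>x. h x \<partial>circ) - 0"
        using Bochner_Integration.integral_diff[OF h(1) int[OF Ab]] compl by simp
      finally show ?case using h(2)[of 0] by simp
    next
      case (union A)
      have A1: "A i \<in> sets borel" for i using union(2) sb by auto
      have A2: "(\<Union>i. A i) \<in> sets borel" using A1 by auto
      note A = A1 A2
      have "(\<lambda>N. \<integral>x. indicator (\<Union>i<N. A i) x *\<^sub>R h x \<partial>circ) \<longlonglongrightarrow> (\<integral>x. indicator (\<Union>i. A i) x *\<^sub>R h x \<partial>circ)"
      proof (rule integral_dominated_convergence[where w = "\<lambda>x. norm (h x)"])
        have *: "(\<Union>i<N. A i) \<in> sets borel" for N using A by auto
        show "(\<lambda>x. indicator (\<Union>i<N. A i) x *\<^sub>R h x) \<in> borel_measurable circ" for N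
          using int[OF *] by (rule borel_measurable_integrable)
        show "(\<lambda>x. indicator (\<Union>i. A i) x *\<^sub>R h x) \<in> borel_measurable circ"
          using int[OF A(2)] by (rule borel_measurable_integrable)
        show "AE x in circ. (\<lambda>N. indicator (\<Union>i<N. A i) x *\<^sub>R h x) \<longlonglongrightarrow> indicator (\<Union>i. A i) x *\<^sub>R h x"
          by (intro AE_I2 tendsto_scaleR LIMSEQ_indicator_UN tendsto_const)
      qed (use h in \<open>auto simp: indicator_def\<close>)
      moreover have "(\<integral>x. indicator (\<Union>i<N. A i) x *\<^sub>R h x \<partial>circ) = 0" for N
      proof -
        have "(\<integral>x. indicator (\<Union>i<N. A i) x *\<^sub>R h x \<partial>circ) = (\<integral>x. (\<Sum>i<N. indicator (A i) x *\<^sub>R h x) \<partial>circ)"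
        proof (intro Bochner_Integration.integral_cong refl)
          fix x
          have "indicator (\<Union>i<N. A i) x = (\<Sum>i<N. indicator (A i) x :: real)"
            using union(1) by (intro indicator_UN_disjoint) (auto simp: disjoint_family_on_def)
          then show "indicator (\<Union>i<N. A i) x *\<^sub>R h x = (\<Sum>i<N. indicator (A i) x *\<^sub>R h x)"
            by (simp add: scaleR_sum_left)
        qed
        also have "\<dots> = 0" using int[OF A(1)] union by (subst Bochner_Integration.integral_sum) auto
        finally show ?thesis .
      qed
      ultimately show ?case by (simp add: LIMSEQ_const_iff)
    qed
  qed
  have sc: "sets circ = {A \<inter> {0..2*pi} |A. A \<in> sets borel}" unfolding circ_def sets_restrict_space by auto
  have zero': "(\<integral>x. indicator B x *\<^sub>R h x \<partial>circ) = 0" "integrable circ (\<lambda>x. indicator B x *\<^sub>R h x)" if "B \<in> sets circ" for B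
    using that zero[of "_ \<inter> {0..2*pi}"] int[of "_ \<inter> {0..2*pi}"] unfolding sc by auto
  have "AE x in circ. Re (h x) = 0"
  proof (rule density_unique_real)
    show "integrable circ (\<lambda>x. Re (h x))" using h(1) by simp
    fix B assume B: "B \<in> sets circ"
    have "(\<integral>x. Re (indicator B x *\<^sub>R h x) \<partial>circ) = 0"
      using integral_Re[OF zero'(2)[OF B]] zero'(1)[OF B] by simp
    then show "(LINT x:B|circ. Re (h x)) = (LINT x:B|circ. 0)" unfolding set_lebesgue_integral_def by simp
  qed simp
  moreover have "AE x in circ. Im (h x) = 0"
  proof (rule density_unique_real)
    show "integrable circ (\<lambda>x. Im (h x))" using h(1) by simp
    fix B assume B: "B \<in> sets circ"
    have "(\<integral>x. Im (indicator B x *\<^sub>R h x) \<partial>circ) = 0"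
      using integral_Im[OF zero'(2)[OF B]] zero'(1)[OF B] by simp
    then show "(LINT x:B|circ. Im (h x)) = (LINT x:B|circ. 0)" unfolding set_lebesgue_integral_def by simp
  qed simp
  ultimately show ?thesis by eventually_elim (simp add: complex_eq_iff)
qed

section \<open>Absolutely convergent Fourier series and their symmetric partial sums\<close>

lemma filterlim_modes: "filterlim modes (finite_subsets_at_top UNIV) sequentially"
  unfolding filterlim_finite_subsets_at_top
proof safe
  fix X :: "int set" assume X: "finite X"
  define M where "M = Max (insert 0 ((\<lambda>n. nat \<bar>n\<bar>) ` X))"
  have M: "nat \<bar>n\<bar> \<le> M" if "n \<in> X" for n
    unfolding M_def using X that by (intro Max_ge) auto
  show "\<forall>\<^sub>F L in sequentially. finite (modes L) \<and> X \<subseteq> modes L \<and> modes L \<subseteq> UNIV"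
    using eventually_ge_at_top[of M]
  proof eventually_elim
    case (elim L)
    have "X \<subseteq> modes L"
    proof
      fix n assume "n \<in> X"
      then have "nat \<bar>n\<bar> \<le> L" using M elim by (meson order_trans)
      then show "n \<in> modes L" by (simp, linarith)
    qed
    then show ?case by simp
  qed
qed

lemma has_sum_modes:
  assumes "(f has_sum S) UNIV" shows "(\<lambda>L. sum f (modes L)) \<longlonglongrightarrow> S"
  by (rule filterlim_compose[OF assms[unfolded has_sum_def] filterlim_modes])

abbreviation l1 :: "(int \<Rightarrow> complex) \<Rightarrow> bool" where
  "l1 a \<equiv> (\<lambda>n. cmod (a n)) summable_on UNIV"

definition tail :: "(int \<Rightarrow> complex) \<Rightarrow> nat \<Rightarrow> real" where
  "tail a L = infsum (\<lambda>n. cmod (a n)) UNIV - (\<Sum>n\<in>modes L. cmod (a n))"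

lemma tail_tendsto: assumes "l1 a" shows "tail a \<longlonglongrightarrow> 0"
proof -
  have "(\<lambda>L. infsum (\<lambda>n. cmod (a n)) UNIV - (\<Sum>n\<in>modes L. cmod (a n))) \<longlonglongrightarrow>
      infsum (\<lambda>n. cmod (a n)) UNIV - infsum (\<lambda>n. cmod (a n)) UNIV"
    by (rule tendsto_diff[OF tendsto_const has_sum_modes[OF has_sum_infsum[OF assms]]])
  then show ?thesis by (simp only: tail_def[abs_def] diff_self)
qed

lemma abs_summable_mult_cis: "l1 a \<Longrightarrow> (\<lambda>n. norm (a n * cis (of_int n * x))) summable_on UNIV"
  by (simp only: norm_mult norm_cis mult_1_right)

lemma ser_has_sum: assumes "l1 a" shows "((\<lambda>n. a n * cis (of_int n * x)) has_sum ser a x) UNIV"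
  unfolding ser_def by (rule has_sum_infsum[OF abs_summable_summable[OF abs_summable_mult_cis[OF assms]]])

lemma psum_tendsto: "l1 a \<Longrightarrow> (\<lambda>L. psum a L x) \<longlonglongrightarrow> ser a x"
  unfolding tpoly_def by (rule has_sum_modes[OF ser_has_sum])

lemma norm_ser_le:
  assumes "l1 a" shows "norm (ser a x) \<le> infsum (\<lambda>n. cmod (a n)) UNIV"
  using norm_infsum_bound[OF abs_summable_mult_cis[OF assms]]
  by (simp only: ser_def norm_mult norm_cis mult_1_right)

lemma norm_tpoly_le: "norm (tpoly A a x) \<le> (\<Sum>n\<in>A. cmod (a n))"
  unfolding tpoly_def by (rule order.trans[OF norm_sum]) (simp add: norm_mult)

lemma sum_le_infsum:
  fixes f :: "'a \<Rightarrow> real"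
  assumes "f summable_on UNIV" "\<And>n. 0 \<le> f n" "finite A"
  shows "sum f A \<le> infsum f UNIV"
  by (rule finite_sum_le_infsum) (use assms in auto)

lemma ser_psum_le:
  assumes "l1 a" shows "norm (ser a x - psum a L x) \<le> tail a L"
proof (rule tendsto_upperbound[of "\<lambda>M. norm (psum a M x - psum a L x)" _ sequentially])
  show "(\<lambda>M. norm (psum a M x - psum a L x)) \<longlonglongrightarrow> norm (ser a x - psum a L x)"
    by (intro tendsto_norm tendsto_diff psum_tendsto assms tendsto_const)
  show "\<forall>\<^sub>F M in sequentially. norm (psum a M x - psum a L x) \<le> tail a L"
    using eventually_ge_at_top[of L]
  proof eventually_elim
    case (elim M)
    then have sub: "modes L \<subseteq> modes M" by auto
    have "psum a M x - psum a L x = (\<Sum>n\<in>modes M - modes L. a n * cis (of_int n * x))"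
      unfolding tpoly_def using sub by (subst sum_diff) auto
    also have "norm \<dots> \<le> (\<Sum>n\<in>modes M - modes L. cmod (a n))"
      by (rule order.trans[OF norm_sum]) (simp add: norm_mult)
    also have "\<dots> = (\<Sum>n\<in>modes M. cmod (a n)) - (\<Sum>n\<in>modes L. cmod (a n))" using sub by (subst sum_diff) auto
    also have "\<dots> \<le> tail a L" unfolding tail_def using sum_le_infsum[OF assms, of "modes M"] by simp
    finally show ?case .
  qed
qed auto

lemma tpoly_measurable: "tpoly A a \<in> borel_measurable borel"
  unfolding tpoly_def[abs_def] by measurable

lemma ser_measurable: assumes "l1 a" shows "ser a \<in> borel_measurable borel"
  by (rule borel_measurable_LIMSEQ_metric[of "psum a"]) (auto intro: psum_tendsto assms tpoly_measurable)

lemma ser_integrable: assumes "l1 a" shows "integrable circ (ser a)"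
  by (intro integrable_circ_bounded[where B = "infsum (\<lambda>n. cmod (a n)) UNIV"] circ_measurable ser_measurable assms)
     (simp add: norm_ser_le assms)

lemma tpoly_integrable: "integrable circ (tpoly A a)"
  by (intro integrable_circ_bounded[where B = "\<Sum>n\<in>A. cmod (a n)"] circ_measurable tpoly_measurable)
     (simp add: norm_tpoly_le)

lemma fc_diff: "integrable circ f \<Longrightarrow> integrable circ g \<Longrightarrow> fc (\<lambda>x. f x - g x) n = fc f n - fc g n"
  using integrable_mult_cis[of f "- of_int n"] integrable_mult_cis[of g "- of_int n"]
  by (simp add: fc_eq left_diff_distrib diff_divide_distrib)

lemma norm_fc_le:
  assumes "AE x in circ. norm (f x) \<le> B" "0 \<le> B" shows "norm (fc f n) \<le> B"
proof -
  have "norm (\<integral>x. f x * cis (- (of_int n * x)) \<partial>circ) \<le> B * (2 * pi)"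
    using assms by (intro integral_circ_bound) (simp_all add: norm_mult)
  then show ?thesis by (simp add: fc_eq norm_divide divide_le_eq)
qed

lemma integral_cis_int: "(\<integral>x. cis ((of_int j - of_int k) * x) \<partial>circ) = (if j = k then 2 * pi else 0)"
  using integral_cis[of "j - k"] by simp

lemma integrable_cis: "integrable circ (\<lambda>x. cis (c * x))"
  by (intro integrable_circ_bounded[where B = 1] circ_measurable cis_measurable) simp

lemma cis_mult_minus: "cis (c * x) * cis (- (d * x)) = cis ((c - d) * x)"
  by (simp add: cis_mult algebra_simps)

lemma fc_tpoly: assumes "finite A" "k \<in> A" shows "fc (tpoly A a) k = a k"
proof -
  have "(\<integral>x. tpoly A a x * cis (- (of_int k * x)) \<partial>circ) = (\<integral>x. (\<Sum>n\<in>A. a n * cis ((of_int n - of_int k) * x)) \<partial>circ)"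
    unfolding tpoly_def sum_distrib_right mult.assoc cis_mult_minus ..
  also have "\<dots> = (\<Sum>n\<in>A. a n * (if n = k then 2 * pi else 0))"
    by (subst Bochner_Integration.integral_sum) (auto intro!: integrable_mult_right integrable_cis simp: integral_cis_int)
  also have "\<dots> = a k * (2 * pi)" using assms by (subst sum.remove[of _ k]) (auto intro!: sum.neutral)
  finally show ?thesis by (simp add: fc_eq)
qed

lemma integrable_mult_tpoly:
  assumes "integrable circ g" shows "integrable circ (\<lambda>x. g x * cnj (tpoly A a x))"
proof -
  have "integrable circ (\<lambda>x. \<Sum>n\<in>A. cnj (a n) * (g x * cis (- of_int n * x)))"
    by (intro Bochner_Integration.integrable_sum integrable_mult_right integrable_mult_cis assms)
  then show ?thesis by (simp add: tpoly_def sum_distrib_left cis_cnj mult_ac)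
qed

lemma integral_mult_tpoly:
  assumes "integrable circ g"
  shows "(\<integral>x. g x * cnj (tpoly A a x) \<partial>circ) = 2 * pi * (\<Sum>n\<in>A. cnj (a n) * fc g n)"
proof -
  have "(\<integral>x. g x * cnj (tpoly A a x) \<partial>circ) = (\<integral>x. (\<Sum>n\<in>A. cnj (a n) * (g x * cis (- of_int n * x))) \<partial>circ)"
    by (simp add: tpoly_def sum_distrib_left cis_cnj mult_ac)
  also have "\<dots> = (\<Sum>n\<in>A. cnj (a n) * (\<integral>x. g x * cis (- of_int n * x) \<partial>circ))"
    by (subst Bochner_Integration.integral_sum) (simp_all add: integrable_mult_cis[OF assms, of "- of_int _", simplified])
  also have "\<dots> = 2 * pi * (\<Sum>n\<in>A. cnj (a n) * fc g n)"
    by (simp add: fc_eq sum_distrib_left)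
  finally show ?thesis .
qed

lemma fc_ser: assumes "l1 a" shows "fc (ser a) k = a k"
proof (rule LIMSEQ_unique)
  show "(\<lambda>L. fc (psum a L) k) \<longlonglongrightarrow> fc (ser a) k"
  proof (rule LIM_zero_cancel, rule Lim_null_comparison)
    show "\<forall>\<^sub>F L in sequentially. norm (fc (psum a L) k - fc (ser a) k) \<le> tail a L"
    proof (rule always_eventually, rule allI)
      fix L
      have "norm (fc (\<lambda>x. psum a L x - ser a x) k) \<le> tail a L"
        using ser_psum_le[OF assms, of 0 L] order.trans[OF norm_ge_zero ser_psum_le[OF assms, of 0 L]]
        by (intro norm_fc_le AE_I2) (simp_all add: norm_minus_commute ser_psum_le assms)
      then show "norm (fc (psum a L) k - fc (ser a) k) \<le> tail a L"
        by (simp add: fc_diff tpoly_integrable ser_integrable assms)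
    qed
    show "tail a \<longlonglongrightarrow> 0" by (rule tail_tendsto[OF assms])
  qed
  show "(\<lambda>L. fc (psum a L) k) \<longlonglongrightarrow> a k"
  proof (rule tendsto_eventually)
    show "\<forall>\<^sub>F L in sequentially. fc (psum a L) k = a k"
      using eventually_ge_at_top[of "nat \<bar>k\<bar>"]
    proof eventually_elim
      case (elim L)
      then have "k \<in> modes L" by auto
      then show ?case by (intro fc_tpoly) auto
    qed
  qed
qed

section \<open>Square integrable functions: inversion and Bessel's inequality\<close>

lemma L2_circle_measurable: "f \<in> L2_circle \<Longrightarrow> f \<in> borel_measurable circ"
  by (simp add: L2_circle_def circ_measurable)

lemma L2_circle_square: "f \<in> L2_circle \<Longrightarrow> integrable circ (\<lambda>x. (cmod (f x))\<^sup>2)"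
  by (simp add: L2_circle_def circle_integrable_eq)

lemma L2_circle_integrable: assumes "f \<in> L2_circle" shows "integrable circ f"
proof (rule Bochner_Integration.integrable_bound)
  show "integrable circ (\<lambda>x. 1 + (cmod (f x))\<^sup>2)"
    by (intro Bochner_Integration.integrable_add L2_circle_square assms integrable_circ_bounded[where B = 1]) auto
  show "AE x in circ. norm (f x) \<le> norm (1 + (cmod (f x))\<^sup>2)"
  proof (rule AE_I2)
    fix x
    have "2 * cmod (f x) \<le> 1 + (cmod (f x))\<^sup>2"
      using zero_le_power2[of "cmod (f x) - 1"] by (simp add: power2_eq_square algebra_simps)
    moreover have "norm (1 + (cmod (f x))\<^sup>2) = 1 + (cmod (f x))\<^sup>2" by simp
    ultimately show "norm (f x) \<le> norm (1 + (cmod (f x))\<^sup>2)" using norm_ge_zero[of "f x"] by linarith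
  qed
qed (rule L2_circle_measurable[OF assms])

text \<open>Both sides have the same coefficients by \<open>fc_ser\<close>, so uniqueness applies to
  their difference.\<close>

theorem fourier_inversion:
  assumes f: "integrable circ f" "l1 (fc f)" shows "AE x in circ. f x = ser (fc f) x"
proof -
  have "AE x in circ. f x - ser (fc f) x = 0"
  proof (rule fourier_unique)
    show "integrable circ (\<lambda>x. f x - ser (fc f) x)" by (intro Bochner_Integration.integrable_diff f ser_integrable)
    fix k :: int
    have "fc (\<lambda>x. f x - ser (fc f) x) (- k) = 0" by (simp add: fc_diff f ser_integrable fc_ser)
    then show "(\<integral>x. (f x - ser (fc f) x) * cis (of_int k * x) \<partial>circ) = 0" by (simp add: fc_eq)
  qed
  then show ?thesis by eventually_elim simp
qed

text \<open>Expands the nonnegative integral of \<open>\<bar>g - p\<bar>\<^sup>2\<close> for the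
  partial sum \<open>p\<close>. Mass and kinetic energy of the data are only ever used as upper
  bounds for sums of coefficients, and those follow from this inequality.\<close>

lemma bessel:
  assumes g: "g \<in> L2_circle" and A: "finite A"
  shows "2 * pi * (\<Sum>n\<in>A. (cmod (fc g n))\<^sup>2) \<le> (\<integral>x. (cmod (g x))\<^sup>2 \<partial>circ)"
proof -
  define p where "p = tpoly A (fc g)"
  let ?S = "\<Sum>n\<in>A. (cmod (fc g n))\<^sup>2"
  have gint: "integrable circ g" by (rule L2_circle_integrable[OF g])
  have gp: "integrable circ (\<lambda>x. g x * cnj (p x))"
    unfolding p_def by (rule integrable_mult_tpoly[OF gint])
  have pp: "integrable circ (\<lambda>x. p x * cnj (p x))"
    unfolding p_def by (rule integrable_mult_tpoly[OF tpoly_integrable])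
  have S: "2 * pi * (\<Sum>n\<in>A. cnj (fc g n) * fc g n) = of_real (2 * pi * ?S)"
    by (simp only: of_real_mult of_real_sum complex_norm_square mult.commute[of "cnj _"] of_real_numeral)
  have i1: "(\<integral>x. g x * cnj (p x) \<partial>circ) = of_real (2 * pi * ?S)"
    unfolding p_def integral_mult_tpoly[OF gint] by (rule S)
  have "(\<integral>x. p x * cnj (p x) \<partial>circ) = 2 * pi * (\<Sum>n\<in>A. cnj (fc g n) * fc p n)"
    unfolding p_def by (rule integral_mult_tpoly[OF tpoly_integrable])
  also have "(\<Sum>n\<in>A. cnj (fc g n) * fc p n) = (\<Sum>n\<in>A. cnj (fc g n) * fc g n)"
    unfolding p_def using A by (intro sum.cong refl) (simp add: fc_tpoly)
  finally have i2: "(\<integral>x. p x * cnj (p x) \<partial>circ) = of_real (2 * pi * ?S)" using S by (simp only:)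
  have "0 \<le> (\<integral>x. (cmod (g x - p x))\<^sup>2 \<partial>circ)" by (rule Bochner_Integration.integral_nonneg) simp
  also have "\<dots> = (\<integral>x. (cmod (g x))\<^sup>2 - 2 * Re (g x * cnj (p x)) + Re (p x * cnj (p x)) \<partial>circ)"
    by (intro Bochner_Integration.integral_cong refl) (simp add: cmod_power2, simp add: power2_eq_square algebra_simps)
  also have "\<dots> = (\<integral>x. (cmod (g x))\<^sup>2 \<partial>circ) - 2 * Re (\<integral>x. g x * cnj (p x) \<partial>circ) + Re (\<integral>x. p x * cnj (p x) \<partial>circ)"
  proof -
    have "(\<integral>x. f x - 2 * h x + k x \<partial>circ) = (\<integral>x. f x \<partial>circ) - 2 * (\<integral>x. h x \<partial>circ) + (\<integral>x. k x \<partial>circ)"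
      if "integrable circ f" "integrable circ h" "integrable circ k" for f h k :: "real \<Rightarrow> real"
      using that by simp
    from this[OF L2_circle_square[OF g] integrable_Re[OF gp] integrable_Re[OF pp]] show ?thesis
      by (simp only: integral_Re[OF gp] integral_Re[OF pp])
  qed
  also have "\<dots> = (\<integral>x. (cmod (g x))\<^sup>2 \<partial>circ) - 2 * (2 * pi * ?S) + 2 * pi * ?S"
    unfolding i1 i2 by (simp only: Re_complex_of_real)
  finally show ?thesis by simp
qed

lemma fc_cong_AE:
  assumes "AE x in circ. f x = g x" "f \<in> borel_measurable circ" "g \<in> borel_measurable circ"
  shows "fc f n = fc g n"
proof -
  have "(\<integral>x. f x * cis (- (of_int n * x)) \<partial>circ) = (\<integral>x. g x * cis (- (of_int n * x)) \<partial>circ)"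
  proof (rule integral_cong_AE)
    have c: "(\<lambda>x. cis (- (of_int n * x))) \<in> borel_measurable circ"
      using circ_measurable[OF cis_measurable[of "- of_int n"]] by simp
    show "(\<lambda>x. f x * cis (- (of_int n * x))) \<in> borel_measurable circ"
      "(\<lambda>x. g x * cis (- (of_int n * x))) \<in> borel_measurable circ"
      by (rule borel_measurable_times[OF assms(2) c], rule borel_measurable_times[OF assms(3) c])
    show "AE x in circ. f x * cis (- (of_int n * x)) = g x * cis (- (of_int n * x))"
      using assms(1) by eventually_elim simp
  qed
  then show ?thesis by (simp add: fc_eq)
qed

section \<open>The cubic nonlinearity on trigonometric polynomials\<close>

lemma cube_diff_le:
  fixes z w :: complex
  assumes "norm z \<le> R" "norm w \<le> R"
  shows "norm (of_real ((cmod z)\<^sup>2) * z - of_real ((cmod w)\<^sup>2) * w) \<le> 3 * R\<^sup>2 * norm (z - w)"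
proof -
  have R: "0 \<le> R" using assms(1) norm_ge_zero[of z] by linarith
  have "of_real ((cmod z)\<^sup>2) * z - of_real ((cmod w)\<^sup>2) * w =
    (z - w) * cnj z * z + w * cnj (z - w) * z + w * cnj w * (z - w)"
    unfolding complex_norm_square by (simp add: algebra_simps)
  also have "norm \<dots> \<le> norm (z - w) * R * R + R * norm (z - w) * R + R * R * norm (z - w)"
    using assms R
    by (intro norm_triangle_le add_mono) (auto simp: norm_mult simp del: complex_cnj_diff intro!: mult_mono mult_nonneg_nonneg)
  finally show ?thesis by (simp add: power2_eq_square algebra_simps)
qed

lemma tpoly_cube:
  "of_real ((cmod (tpoly S a x))\<^sup>2) * tpoly S a x =
    (\<Sum>i\<in>S. \<Sum>j\<in>S. \<Sum>m\<in>S. a i * a j * cnj (a m) * cis ((of_int i + of_int j - of_int m) * x))"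
proof -
  have c: "cis (of_int i * x) * (cis (of_int j * x) * cis (- (of_int m * x))) = cis ((of_int i + of_int j - of_int m) * x)"
    for i j m :: int
    by (simp add: cis_mult algebra_simps)
  have "of_real ((cmod (tpoly S a x))\<^sup>2) * tpoly S a x = tpoly S a x * (tpoly S a x * cnj (tpoly S a x))"
    unfolding complex_norm_square by simp
  also have "\<dots> = (\<Sum>i\<in>S. \<Sum>j\<in>S. \<Sum>m\<in>S. a i * cis (of_int i * x) * (a j * cis (of_int j * x) * cnj (a m * cis (of_int m * x))))"
    unfolding tpoly_def cnj_sum by (subst sum_product, subst sum_product, simp only: sum_distrib_left)
  also have "\<dots> = (\<Sum>i\<in>S. \<Sum>j\<in>S. \<Sum>m\<in>S. a i * a j * cnj (a m) * (cis (of_int i * x) * (cis (of_int j * x) * cis (- (of_int m * x)))))"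
    by (intro sum.cong refl) (simp add: cis_cnj)
  finally show ?thesis unfolding c .
qed

lemma fc_cubic:
  fixes lam :: "real \<Rightarrow> complex"
  assumes lam: "integrable circ lam"
  shows "fc (\<lambda>x. lam x * (of_real ((cmod (tpoly S a x))\<^sup>2) * tpoly S a x)) n = cubic (fc lam) S a n"
proof -
  have c: "cis ((of_int i + of_int j - of_int m) * x) * cis (- (of_int n * x)) = cis (- of_int (n + m - i - j) * x)"
    for i j m :: int and x by (simp add: cis_mult algebra_simps)
  have "(\<integral>x. lam x * (of_real ((cmod (tpoly S a x))\<^sup>2) * tpoly S a x) * cis (- (of_int n * x)) \<partial>circ) =
    (\<integral>x. (\<Sum>i\<in>S. \<Sum>j\<in>S. \<Sum>m\<in>S. a i * a j * cnj (a m) * (lam x * cis (- of_int (n + m - i - j) * x))) \<partial>circ)"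
    unfolding tpoly_cube sum_distrib_left sum_distrib_right c[symmetric] by (simp only: mult_ac)
  also have "\<dots> = (\<Sum>i\<in>S. \<Sum>j\<in>S. \<Sum>m\<in>S. a i * a j * cnj (a m) * (\<integral>x. lam x * cis (- of_int (n + m - i - j) * x) \<partial>circ))"
    by (simp only: Bochner_Integration.integral_sum Bochner_Integration.integrable_sum integrable_mult_right
        integrable_mult_cis[OF lam] integral_mult_right_zero)
  also have "\<dots> = 2 * pi * cubic (fc lam) S a n"
    unfolding cubic_def sum_distrib_left
    by (intro sum.cong refl) (simp only: fc_eq mult_minus_left, simp del: of_int_diff of_int_add)
  finally show ?thesis by (simp add: fc_eq)
qed

lemma integral_quartic:
  fixes lam :: "real \<Rightarrow> real"
  assumes lam: "integrable circ (\<lambda>x. complex_of_real (lam x))"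
  shows "(\<integral>x. lam x * (cmod (tpoly S a x)) ^ 4 \<partial>circ) =
    2 * pi * Re (\<Sum>n\<in>S. cnj (a n) * cubic (fc (\<lambda>x. complex_of_real (lam x))) S a n)"
proof -
  let ?g = "\<lambda>x. complex_of_real (lam x) * (of_real ((cmod (tpoly S a x))\<^sup>2) * tpoly S a x)"
  have g: "integrable circ ?g"
    unfolding tpoly_cube sum_distrib_left mult.left_commute[of "complex_of_real (lam _)"]
    by (intro Bochner_Integration.integrable_sum integrable_mult_right integrable_mult_cis lam)
  have "complex_of_real (\<integral>x. lam x * (cmod (tpoly S a x)) ^ 4 \<partial>circ) =
     (\<integral>x. complex_of_real (lam x * (cmod (tpoly S a x)) ^ 4) \<partial>circ)" by (rule integral_complex_of_real[symmetric])
  also have "\<dots> = (\<integral>x. ?g x * cnj (tpoly S a x) \<partial>circ)"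
  proof (intro Bochner_Integration.integral_cong refl)
    fix x
    have "complex_of_real ((cmod (tpoly S a x)) ^ 4) = of_real ((cmod (tpoly S a x))\<^sup>2) * of_real ((cmod (tpoly S a x))\<^sup>2)"
      by (simp add: power_add[symmetric])
    then show "complex_of_real (lam x * (cmod (tpoly S a x)) ^ 4) = ?g x * cnj (tpoly S a x)"
      by (simp only: of_real_mult complex_norm_square mult_ac)
  qed
  also have "\<dots> = 2 * pi * (\<Sum>n\<in>S. cnj (a n) * fc ?g n)" by (rule integral_mult_tpoly[OF g])
  also have "\<dots> = 2 * pi * (\<Sum>n\<in>S. cnj (a n) * cubic (fc (\<lambda>x. complex_of_real (lam x))) S a n)"
    by (simp only: fc_cubic[OF lam])
  finally have "(\<integral>x. lam x * (cmod (tpoly S a x)) ^ 4 \<partial>circ) =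
    Re (2 * pi * (\<Sum>n\<in>S. cnj (a n) * cubic (fc (\<lambda>x. complex_of_real (lam x))) S a n))"
    by (metis Re_complex_of_real)
  then show ?thesis by (simp del: Re_sum)
qed

lemma h1_imp_l1:
  assumes "\<And>A. finite A \<Longrightarrow> (\<Sum>n\<in>A. (1 + (real_of_int n)\<^sup>2) * (cmod (a n))\<^sup>2) \<le> \<beta>\<^sup>2" "0 \<le> \<beta>"
  shows "l1 a" "infsum (\<lambda>n. cmod (a n)) UNIV \<le> 3 * \<beta>" "finite A \<Longrightarrow> (\<Sum>n\<in>A. cmod (a n)) \<le> 3 * \<beta>"
proof -
  show f: "(\<Sum>n\<in>A. cmod (a n)) \<le> 3 * \<beta>" if "finite A" for A
    using l1_le_weighted_l2[OF that, of "\<lambda>n. cmod (a n)" "\<lambda>_. 1" \<beta> 3] sum_inverse_square_le_5[OF that] assms(1)[OF that] assms(2)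
    by simp
  show l1: "l1 a" by (rule nonneg_bdd_above_summable_on) (auto intro!: bdd_aboveI[where M = "3 * \<beta>"] f)
  show "infsum (\<lambda>n. cmod (a n)) UNIV \<le> 3 * \<beta>"
    using l1 f by (intro infsum_le_finite_sums) auto
qed
section \<open>The cubic nonlinearity on Sobolev spaces\<close>

definition nonlin :: "(real \<Rightarrow> real) \<Rightarrow> (real \<Rightarrow> complex) \<Rightarrow> real \<Rightarrow> complex" where
  "nonlin lam f x = of_real (lam x * (cmod (f x))\<^sup>2) * f x"

lemma bracket_le_weight_1:
  assumes "1 \<le> s" shows "1 + (real_of_int n)\<^sup>2 \<le> 2 * (weight 1 s n)\<^sup>2"
proof -
  have g: "1 \<le> grow 1 n" "\<bar>real_of_int n\<bar> \<le> grow 1 n" by (simp_all add: grow_def)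
  have "grow 1 n powr 1 \<le> grow 1 n powr s" using g assms by (intro powr_mono) auto
  then have "grow 1 n \<le> weight 1 s n" using g by (simp add: weight_def)
  then have "1\<^sup>2 \<le> (weight 1 s n)\<^sup>2" "\<bar>real_of_int n\<bar>\<^sup>2 \<le> (weight 1 s n)\<^sup>2"
    using g by (intro power_mono; linarith)+
  then show ?thesis by simp
qed

lemma weighted_l1_le:
  assumes "1 \<le> s" "finite A" shows "(\<Sum>n\<in>A. cmod (a n)) \<le> 6 * L2_set (\<lambda>n. weight 1 s n * cmod (a n)) A"
proof -
  let ?L = "L2_set (\<lambda>n. weight 1 s n * cmod (a n)) A"
  have "(\<Sum>n\<in>A. (1 + (real_of_int n)\<^sup>2) * (cmod (a n))\<^sup>2) \<le> (\<Sum>n\<in>A. 2 * (weight 1 s n)\<^sup>2 * (cmod (a n))\<^sup>2)"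
    by (intro sum_mono mult_right_mono bracket_le_weight_1 assms) auto
  also have "\<dots> = 2 * ?L\<^sup>2"
    unfolding L2_set_def by (simp add: sum_nonneg power_mult_distrib sum_distrib_left mult_ac)
  also have "\<dots> \<le> (2 * ?L)\<^sup>2" by (simp add: power_mult_distrib)
  finally have "(\<Sum>n\<in>A. (1 + (real_of_int n)\<^sup>2) * (cmod (a n))\<^sup>2) \<le> (2 * ?L)\<^sup>2" .
  from l1_le_weighted_l2[OF assms(2) _ _ this, of "\<lambda>_. 1" 3] sum_inverse_square_le_5[OF assms(2)]
  show ?thesis by simp
qed

text \<open>\<open>weight 1 s n\<close> is \<open>max 1 \<bar>n\<bar> powr s\<close>, so this
  describes \<open>H\<^sup>s\<close> by an equivalent norm to which the multilinear estimates for
  \<open>weight N s\<close> apply with \<open>N = 1\<close>.\<close>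

definition hs :: "real \<Rightarrow> (int \<Rightarrow> complex) \<Rightarrow> bool" where
  "hs s a \<longleftrightarrow> (\<lambda>n. (weight 1 s n * cmod (a n))\<^sup>2) summable_on UNIV"

definition hnorm :: "real \<Rightarrow> (int \<Rightarrow> complex) \<Rightarrow> real" where
  "hnorm s a = sqrt (infsum (\<lambda>n. (weight 1 s n * cmod (a n))\<^sup>2) UNIV)"

text \<open>The weighted \<open>\<ell>\<^sup>2\<close> norm of the coefficients outside
  \<open>modes L\<close>, for sequences satisfying \<open>hs s\<close>.\<close>

definition htail :: "real \<Rightarrow> (int \<Rightarrow> complex) \<Rightarrow> nat \<Rightarrow> real" where
  "htail s a L = sqrt ((hnorm s a)\<^sup>2 - (\<Sum>n\<in>modes L. (weight 1 s n * cmod (a n))\<^sup>2))"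

lemma hnorm_square: "hs s a \<Longrightarrow> (hnorm s a)\<^sup>2 = infsum (\<lambda>n. (weight 1 s n * cmod (a n))\<^sup>2) UNIV"
  unfolding hnorm_def by (intro real_sqrt_pow2 infsum_nonneg) simp

lemma hnorm_nonneg: "0 \<le> hnorm s a"
  unfolding hnorm_def by (intro real_sqrt_ge_zero infsum_nonneg) simp

lemma sum_le_hnorm:
  assumes "hs s a" "finite A" shows "(\<Sum>n\<in>A. (weight 1 s n * cmod (a n))\<^sup>2) \<le> (hnorm s a)\<^sup>2"
  unfolding hnorm_square[OF assms(1)] by (rule sum_le_infsum) (use assms in \<open>auto simp: hs_def\<close>)

lemma L2_set_le_hnorm: "hs s a \<Longrightarrow> finite A \<Longrightarrow> L2_set (\<lambda>n. weight 1 s n * cmod (a n)) A \<le> hnorm s a"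
  unfolding L2_set_def using sum_le_hnorm hnorm_nonneg by (intro real_le_lsqrt) auto

lemma hsI:
  assumes "\<And>A. finite A \<Longrightarrow> L2_set (\<lambda>n. weight 1 s n * cmod (a n)) A \<le> B"
  shows "hs s a" "hnorm s a \<le> B"
proof -
  have B: "0 \<le> B" using assms[of "{}"] by simp
  have le: "(\<Sum>n\<in>A. (weight 1 s n * cmod (a n))\<^sup>2) \<le> B\<^sup>2" if "finite A" for A
  proof -
    have "(L2_set (\<lambda>n. weight 1 s n * cmod (a n)) A)\<^sup>2 \<le> B\<^sup>2" using assms[OF that] by (intro power_mono) auto
    then show ?thesis unfolding L2_set_def by (simp add: sum_nonneg)
  qed
  show h: "hs s a" unfolding hs_def
    by (rule nonneg_bdd_above_summable_on) (auto intro!: bdd_aboveI[where M = "B\<^sup>2"] le)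
  show "hnorm s a \<le> B" unfolding hnorm_def
    using h B unfolding hs_def by (intro real_le_lsqrt infsum_le_finite_sums) (auto intro: le)
qed

lemma hs_l1: assumes "1 \<le> s" "hs s a" shows "l1 a" "infsum (\<lambda>n. cmod (a n)) UNIV \<le> 6 * hnorm s a"
proof -
  have le: "(\<Sum>n\<in>A. cmod (a n)) \<le> 6 * hnorm s a" if "finite A" for A
    using weighted_l1_le[OF assms(1) that, of a] L2_set_le_hnorm[OF assms(2) that] by linarith
  show l1: "l1 a" by (rule nonneg_bdd_above_summable_on) (auto intro!: bdd_aboveI[where M = "6 * hnorm s a"] le)
  show "infsum (\<lambda>n. cmod (a n)) UNIV \<le> 6 * hnorm s a"
    using l1 le by (intro infsum_le_finite_sums) auto
qed

lemma htail_nonneg: "0 \<le> htail s a L" if "hs s a"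
  unfolding htail_def using sum_le_hnorm[OF that] by (intro real_sqrt_ge_zero) simp

lemma L2_set_le_htail:
  assumes "hs s a" "L \<le> M"
  shows "L2_set (\<lambda>n. weight 1 s n * cmod (a n)) (modes M - modes L) \<le> htail s a L"
proof -
  have "(\<Sum>n\<in>modes M - modes L. (weight 1 s n * cmod (a n))\<^sup>2) =
    (\<Sum>n\<in>modes M. (weight 1 s n * cmod (a n))\<^sup>2) - (\<Sum>n\<in>modes L. (weight 1 s n * cmod (a n))\<^sup>2)"
    using assms(2) by (intro sum_diff) auto
  then show ?thesis unfolding L2_set_def htail_def
    using sum_le_hnorm[OF assms(1), of "modes M"] by (intro real_sqrt_le_mono) simp
qed

lemma hnorm_diff:
  assumes "hs s a" "hs s b" shows "hs s (\<lambda>n. a n - b n)"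
    and "hnorm s a \<le> hnorm s b + hnorm s (\<lambda>n. a n - b n)"
    and "htail s a L \<le> htail s b L + hnorm s (\<lambda>n. a n - b n)"
proof -
  let ?w = "weight 1 s" and ?d = "\<lambda>n. a n - b n"
  have "L2_set (\<lambda>n. ?w n * cmod (?d n)) A \<le> hnorm s a + hnorm s b" if A: "finite A" for A
  proof -
    have "L2_set (\<lambda>n. ?w n * cmod (?d n)) A \<le> L2_set (\<lambda>n. ?w n * cmod (a n) + ?w n * cmod (b n)) A"
      unfolding distrib_left[symmetric]
      by (intro L2_set_mono mult_left_mono norm_triangle_ineq4 mult_nonneg_nonneg weight_nonneg) auto
    also have "\<dots> \<le> L2_set (\<lambda>n. ?w n * cmod (a n)) A + L2_set (\<lambda>n. ?w n * cmod (b n)) A" by (rule L2_set_triangle_ineq)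
    finally show ?thesis using L2_set_le_hnorm[OF assms(1) A] L2_set_le_hnorm[OF assms(2) A] by linarith
  qed
  then show d: "hs s ?d" by (rule hsI)
  have tri: "L2_set (\<lambda>n. ?w n * cmod (a n)) A \<le> L2_set (\<lambda>n. ?w n * cmod (b n)) A + hnorm s ?d" if A: "finite A" for A
  proof -
    have "L2_set (\<lambda>n. ?w n * cmod (a n)) A \<le> L2_set (\<lambda>n. ?w n * cmod (b n) + ?w n * cmod (?d n)) A"
      unfolding distrib_left[symmetric]
      by (intro L2_set_mono mult_left_mono norm_triangle_sub mult_nonneg_nonneg weight_nonneg) auto
    also have "\<dots> \<le> L2_set (\<lambda>n. ?w n * cmod (b n)) A + L2_set (\<lambda>n. ?w n * cmod (?d n)) A" by (rule L2_set_triangle_ineq)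
    finally show ?thesis using L2_set_le_hnorm[OF d A] by linarith
  qed
  show "hnorm s a \<le> hnorm s b + hnorm s ?d"
    by (rule hsI) (use tri L2_set_le_hnorm[OF assms(2)] in \<open>fastforce intro: order.trans\<close>)
  have "(\<lambda>M. L2_set (\<lambda>n. ?w n * cmod (a n)) (modes M - modes L)) \<longlonglongrightarrow> htail s a L"
    if a: "hs s a" for a
  proof -
    have "(\<lambda>M. sqrt ((\<Sum>n\<in>modes M. (?w n * cmod (a n))\<^sup>2) - (\<Sum>n\<in>modes L. (?w n * cmod (a n))\<^sup>2))) \<longlonglongrightarrow> htail s a L"
      unfolding htail_def hnorm_square[OF a]
      by (intro tendsto_real_sqrt tendsto_diff tendsto_const has_sum_modes has_sum_infsum a[unfolded hs_def])
    moreover have "\<forall>\<^sub>F M in sequentially. sqrt ((\<Sum>n\<in>modes M. (?w n * cmod (a n))\<^sup>2) - (\<Sum>n\<in>modes L. (?w n * cmod (a n))\<^sup>2)) =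
      L2_set (\<lambda>n. ?w n * cmod (a n)) (modes M - modes L)"
      using eventually_ge_at_top[of L]
    proof eventually_elim
      case (elim M)
      then show ?case unfolding L2_set_def by (subst sum_diff) auto
    qed
    ultimately show ?thesis by (rule Lim_transform_eventually)
  qed
  note lim = this[OF assms(1)]
  show "htail s a L \<le> htail s b L + hnorm s ?d"
  proof (rule tendsto_upperbound[OF lim])
    show "\<forall>\<^sub>F M in sequentially. L2_set (\<lambda>n. ?w n * cmod (a n)) (modes M - modes L) \<le> htail s b L + hnorm s ?d"
      using eventually_ge_at_top[of L]
    proof eventually_elim
      case (elim M)
      show ?case using tri[of "modes M - modes L"] L2_set_le_htail[OF assms(2) elim] by simp
    qed
  qed auto
qed

lemma htail_tendsto: assumes "hs s a" shows "htail s a \<longlonglongrightarrow> 0"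
proof -
  have "htail s a \<longlonglongrightarrow> sqrt ((hnorm s a)\<^sup>2 - (hnorm s a)\<^sup>2)"
    unfolding htail_def[abs_def]
    by (intro tendsto_real_sqrt tendsto_diff tendsto_const)
       (unfold hnorm_square[OF assms], intro has_sum_modes has_sum_infsum assms[unfolded hs_def])
  then show ?thesis by simp
qed

context potential
begin

text \<open>Cutting \<open>c\<close> off to \<open>T\<close> turns the difference into one of two
  cubic terms over the same \<open>S\<close>, and by trilinearity each piece contains a factor
  supported outside \<open>T\<close>. The constant is \<open>324 = 3 * 36 + 6 * 36\<close>, as every
  \<open>\<ell>\<^sup>1\<close> norm costs a factor 6.\<close>

lemma cubic_diff_le:
  assumes S: "finite S" and T: "T \<subseteq> S"
  shows "L2_set (\<lambda>n. weight 1 s n * cmod (cubic \<Lambda> S c n - cubic \<Lambda> T c n)) S \<le>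
    324 * 4 powr s * G * (L2_set (\<lambda>n. weight 1 s n * cmod (c n)) S)\<^sup>2 * L2_set (\<lambda>n. weight 1 s n * cmod (c n)) (S - T)"
proof -
  let ?w = "weight 1 s" and ?x = "\<lambda>n. cmod (c n)"
  define d where "d n = of_bool (n \<in> T) * c n" for n
  define y where "y n = cmod (c n - d n)" for n
  have y: "y n = of_bool (n \<notin> T) * ?x n" for n by (auto simp: y_def d_def)
  have red: "(\<Sum>m\<in>S. f m) = (\<Sum>m\<in>T. f m)" if "\<And>m. m \<notin> T \<Longrightarrow> f m = 0" for f :: "int \<Rightarrow> complex"
    by (rule sum.mono_neutral_right[OF S T]) (use that in auto)
  have "cubic \<Lambda> S d n = (\<Sum>a\<in>T. \<Sum>b\<in>T. \<Sum>m\<in>T. \<Lambda> (n + m - a - b) * (d a * d b * cnj (d m)))" for n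
    unfolding cubic_def by (subst red, simp add: d_def, subst red, simp add: d_def, subst red, simp_all add: d_def)
  also have "\<dots> n = cubic \<Lambda> T c n" for n
    unfolding cubic_def by (intro sum.cong refl) (simp add: d_def)
  finally have d: "cubic \<Lambda> S d n = cubic \<Lambda> T c n" for n .
  define B where "B f g h n = (\<Sum>a\<in>S. \<Sum>b\<in>S. \<Sum>m\<in>S. cmod (\<Lambda> (n + m - a - b)) * (f a * g b * h m))" for f g h :: "int \<Rightarrow> real" and n
  have Bnn: "0 \<le> B f g h n" if "\<And>n. 0 \<le> f n" "\<And>n. 0 \<le> g n" "\<And>n. 0 \<le> h n" for f g h n
    unfolding B_def by (intro sum_nonneg mult_nonneg_nonneg that) auto
  have nn: "0 \<le> y n" "0 \<le> ?x n" for n by (auto simp: y_def)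
  have "cmod (cubic \<Lambda> S c n - cubic \<Lambda> S d n) \<le> B y ?x ?x n + B ?x y ?x n + B ?x ?x y n" for n
  proof -
    have "cmod (c a * c b * cnj (c m) - d a * d b * cnj (d m)) \<le> y a * ?x b * ?x m + ?x a * y b * ?x m + ?x a * ?x b * y m" for a b m
      unfolding y_def d_def by (cases "a \<in> T"; cases "b \<in> T"; cases "m \<in> T") (simp_all add: norm_mult)
    then have *: "cmod (\<Lambda> l * (c a * c b * cnj (c m)) - \<Lambda> l * (d a * d b * cnj (d m))) \<le>
      cmod (\<Lambda> l) * (y a * ?x b * ?x m) + cmod (\<Lambda> l) * (?x a * y b * ?x m) + cmod (\<Lambda> l) * (?x a * ?x b * y m)" for l a b m
      unfolding right_diff_distrib[symmetric] distrib_left[symmetric] norm_mult[of "\<Lambda> l"] by (intro mult_left_mono) auto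
    show ?thesis unfolding cubic_def B_def sum_subtractf[symmetric] sum.distrib[symmetric]
      by (intro order.trans[OF norm_sum] sum_mono *)
  qed
  then have "L2_set (\<lambda>n. ?w n * cmod (cubic \<Lambda> S c n - cubic \<Lambda> T c n)) S \<le>
    L2_set (\<lambda>n. (?w n * B y ?x ?x n + ?w n * B ?x y ?x n) + ?w n * B ?x ?x y n) S"
    unfolding d[symmetric] distrib_left[symmetric]
    by (intro L2_set_mono mult_left_mono mult_nonneg_nonneg weight_nonneg) auto
  also have "\<dots> \<le> L2_set (\<lambda>n. ?w n * B y ?x ?x n) S + L2_set (\<lambda>n. ?w n * B ?x y ?x n) S + L2_set (\<lambda>n. ?w n * B ?x ?x y n) S"
    by (intro order.trans[OF L2_set_triangle_ineq] add_right_mono L2_set_triangle_ineq)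
  also have "\<dots> \<le> 4 powr s * G * (L2_set (\<lambda>n. ?w n * y n) S * sum ?x S * sum ?x S +
        sum y S * L2_set (\<lambda>n. ?w n * ?x n) S * sum ?x S + sum y S * sum ?x S * L2_set (\<lambda>n. ?w n * ?x n) S) +
     4 powr s * G * (L2_set (\<lambda>n. ?w n * ?x n) S * sum y S * sum ?x S +
        sum ?x S * L2_set (\<lambda>n. ?w n * y n) S * sum ?x S + sum ?x S * sum y S * L2_set (\<lambda>n. ?w n * ?x n) S) +
     4 powr s * G * (L2_set (\<lambda>n. ?w n * ?x n) S * sum ?x S * sum y S +
        sum ?x S * L2_set (\<lambda>n. ?w n * ?x n) S * sum y S + sum ?x S * sum ?x S * L2_set (\<lambda>n. ?w n * y n) S)"
    unfolding B_def by (intro add_mono trilinear_le S nn) auto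
  also have "\<dots> = 4 powr s * G * (3 * (L2_set (\<lambda>n. ?w n * y n) S * (sum ?x S)\<^sup>2) +
      6 * (sum y S * sum ?x S * L2_set (\<lambda>n. ?w n * ?x n) S))" by algebra
  also have "\<dots> \<le> 4 powr s * G * (3 * (L2_set (\<lambda>n. ?w n * y n) S * (6 * L2_set (\<lambda>n. ?w n * ?x n) S)\<^sup>2) +
      6 * ((6 * L2_set (\<lambda>n. ?w n * y n) S) * (6 * L2_set (\<lambda>n. ?w n * ?x n) S) * L2_set (\<lambda>n. ?w n * ?x n) S))"
  proof (intro mult_left_mono add_mono mult_mono power_mono)
    show "sum ?x S \<le> 6 * L2_set (\<lambda>n. ?w n * ?x n) S" by (rule weighted_l1_le[OF s_ge_1 S])
    show "sum y S \<le> 6 * L2_set (\<lambda>n. ?w n * y n) S"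
      unfolding y_def by (rule weighted_l1_le[OF s_ge_1 S])
  qed (auto intro!: sum_nonneg mult_nonneg_nonneg weighted_l1_le[OF s_ge_1 S] simp: nn G_nonneg)
  also have "\<dots> = 324 * 4 powr s * G * (L2_set (\<lambda>n. ?w n * ?x n) S)\<^sup>2 * L2_set (\<lambda>n. ?w n * y n) S" by algebra
  also have "L2_set (\<lambda>n. ?w n * y n) S = L2_set (\<lambda>n. ?w n * ?x n) (S - T)"
    unfolding L2_set_def y using S by (intro arg_cong[of _ _ sqrt] sum.mono_neutral_cong_right) auto
  finally show ?thesis .
qed

end

locale nls =
  fixes lam :: "real \<Rightarrow> real" and s G B :: real
  assumes lam_measurable: "lam \<in> borel_measurable borel"
    and lam_nonneg: "0 \<le> lam x" and lam_le: "lam x \<le> B"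
    and potential: "potential (fc (\<lambda>x. complex_of_real (lam x))) s G"

sublocale nls \<subseteq> potential "fc (\<lambda>x. complex_of_real (lam x))" s G
  by (rule potential)

context nls
begin

abbreviation (input) F :: "(int \<Rightarrow> complex) \<Rightarrow> nat \<Rightarrow> int \<Rightarrow> complex" where
  "F a L \<equiv> cubic (fc (\<lambda>x. complex_of_real (lam x))) (modes L) a"

lemma B_nonneg: "0 \<le> B"
  using lam_nonneg[of 0] lam_le[of 0] by linarith

lemma lam_complex_measurable: "(\<lambda>x. complex_of_real (lam x)) \<in> borel_measurable borel"
  by (rule measurable_compose[OF lam_measurable borel_measurable_of_real])

lemma lam_integrable: "integrable circ (\<lambda>x. complex_of_real (lam x))"
  by (rule integrable_circ_bounded[where B = B])
     (use lam_nonneg lam_le in \<open>auto intro: circ_measurable lam_complex_measurable\<close>)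

lemma nonlin_eq: "nonlin lam f x = of_real (lam x) * (of_real ((cmod (f x))\<^sup>2) * f x)"
  by (simp add: nonlin_def)

lemma nonlin_measurable:
  assumes "f \<in> borel_measurable circ" shows "nonlin lam f \<in> borel_measurable circ"
proof -
  have "(\<lambda>x. (cmod (f x))\<^sup>2) \<in> borel_measurable circ"
    by (rule borel_measurable_power[OF measurable_compose[OF assms borel_measurable_norm]])
  from measurable_compose[OF this borel_measurable_of_real] show ?thesis unfolding nonlin_eq[abs_def]
    by (intro borel_measurable_times[OF circ_measurable[OF lam_complex_measurable]]
        borel_measurable_times[OF _ assms])
qed

lemma nonlin_diff_le:
  assumes "norm (f x) \<le> R" "norm (g x) \<le> R"
  shows "norm (nonlin lam f x - nonlin lam g x) \<le> B * (3 * R\<^sup>2 * norm (f x - g x))"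
proof -
  have "norm (nonlin lam f x - nonlin lam g x) =
    lam x * norm (of_real ((cmod (f x))\<^sup>2) * f x - of_real ((cmod (g x))\<^sup>2) * g x)"
    unfolding nonlin_eq right_diff_distrib[symmetric] norm_mult using lam_nonneg[of x] by simp
  also have "\<dots> \<le> B * (3 * R\<^sup>2 * norm (f x - g x))"
    using lam_nonneg[of x] lam_le[of x] B_nonneg by (intro mult_mono cube_diff_le assms) auto
  finally show ?thesis .
qed

lemma nonlin_le:
  assumes "norm (f x) \<le> R" shows "norm (nonlin lam f x) \<le> B * (3 * R\<^sup>2 * R)"
proof -
  have R: "0 \<le> R" using assms norm_ge_zero[of "f x"] by linarith
  have "norm (nonlin lam f x) \<le> B * (3 * R\<^sup>2 * norm (f x))"
    using nonlin_diff_le[of f x R "\<lambda>_. 0"] assms R by (simp add: nonlin_def)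
  also have "\<dots> \<le> B * (3 * R\<^sup>2 * R)" using assms B_nonneg by (intro mult_left_mono) auto
  finally show ?thesis .
qed

lemma nonlin_integrable:
  assumes "f \<in> borel_measurable circ" "AE x in circ. norm (f x) \<le> R"
  shows "integrable circ (nonlin lam f)"
proof (rule integrable_circ_bounded[OF nonlin_measurable[OF assms(1)]])
  show "AE x in circ. norm (nonlin lam f x) \<le> B * (3 * R\<^sup>2 * R)"
    using assms(2) by eventually_elim (rule nonlin_le)
qed

lemma fc_nonlin_diff:
  assumes f: "f \<in> borel_measurable circ" "AE x in circ. norm (f x) \<le> R"
    and g: "g \<in> borel_measurable circ" "AE x in circ. norm (g x) \<le> R"
    and d: "AE x in circ. norm (f x - g x) \<le> \<delta>"
  shows "norm (fc (nonlin lam f) n - fc (nonlin lam g) n) \<le> B * (3 * R\<^sup>2 * \<delta>)"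
proof -
  \<comment> \<open>\<open>\<delta>\<close> is nonnegative because it bounds a norm almost
    everywhere on a space of positive measure.\<close>
  have "\<not> (AE x in circ. False)"
  proof
    assume "AE x in circ. False"
    then have "emeasure circ (space circ) = 0" by (simp add: AE_iff_measurable[of "space circ" circ])
    then have "measure circ (space circ) = 0" by (simp add: measure_def)
    then show False using measure_circ by simp
  qed
  moreover have "AE x in circ. 0 \<le> \<delta>" using d by eventually_elim (rule order.trans[OF norm_ge_zero])
  ultimately have \<delta>: "0 \<le> \<delta>" by (cases "0 \<le> \<delta>") simp_all
  have "norm (fc (\<lambda>x. nonlin lam f x - nonlin lam g x) n) \<le> B * (3 * R\<^sup>2 * \<delta>)"
  proof (rule norm_fc_le)
    show "AE x in circ. norm (nonlin lam f x - nonlin lam g x) \<le> B * (3 * R\<^sup>2 * \<delta>)"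
      using f(2) g(2) d
    proof eventually_elim
      case (elim x)
      have "B * (3 * R\<^sup>2 * norm (f x - g x)) \<le> B * (3 * R\<^sup>2 * \<delta>)"
        using elim B_nonneg by (intro mult_left_mono) auto
      then show ?case using nonlin_diff_le[of f x R g] elim by linarith
    qed
  qed (use \<delta> B_nonneg in auto)
  then show ?thesis using fc_diff[OF nonlin_integrable[OF f] nonlin_integrable[OF g]] by simp
qed

lemma fc_nonlin_ser_cubic:
  assumes "l1 a"
  shows "norm (fc (nonlin lam (ser a)) n - F a L n) \<le> B * (3 * (infsum (\<lambda>n. cmod (a n)) UNIV)\<^sup>2 * tail a L)"
proof -
  have "F a L n = fc (nonlin lam (psum a L)) n"
    unfolding nonlin_eq[abs_def] by (rule fc_cubic[OF lam_integrable, symmetric])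
  moreover have "norm (fc (nonlin lam (ser a)) n - fc (nonlin lam (psum a L)) n) \<le>
      B * (3 * (infsum (\<lambda>n. cmod (a n)) UNIV)\<^sup>2 * tail a L)"
    using assms
    by (intro fc_nonlin_diff AE_I2 circ_measurable ser_measurable tpoly_measurable norm_ser_le ser_psum_le
        order.trans[OF norm_tpoly_le sum_le_infsum]) auto
  ultimately show ?thesis by simp
qed

lemma F_tendsto:
  assumes "l1 a" shows "(\<lambda>L. F a L n) \<longlonglongrightarrow> fc (nonlin lam (ser a)) n"
proof (rule LIM_zero_cancel, rule Lim_null_comparison)
  show "\<forall>\<^sub>F L in sequentially. norm (F a L n - fc (nonlin lam (ser a)) n) \<le>
      B * (3 * (infsum (\<lambda>n. cmod (a n)) UNIV)\<^sup>2 * tail a L)"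
    by (rule always_eventually) (simp add: norm_minus_commute fc_nonlin_ser_cubic[OF assms])
  have "(\<lambda>L. B * (3 * (infsum (\<lambda>n. cmod (a n)) UNIV)\<^sup>2 * tail a L)) \<longlonglongrightarrow> B * (3 * (infsum (\<lambda>n. cmod (a n)) UNIV)\<^sup>2 * 0)"
    by (intro tendsto_mult_left tail_tendsto assms)
  then show "(\<lambda>L. B * (3 * (infsum (\<lambda>n. cmod (a n)) UNIV)\<^sup>2 * tail a L)) \<longlonglongrightarrow> 0" by simp
qed

lemma L2_set_tendsto:
  assumes "\<And>n. (\<lambda>L. f L n) \<longlonglongrightarrow> (g n :: complex)"
  shows "(\<lambda>L. L2_set (\<lambda>n. w n * cmod (f L n)) A) \<longlonglongrightarrow> L2_set (\<lambda>n. w n * cmod (g n)) A"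
  unfolding L2_set_def by (intro tendsto_intros assms)

text \<open>Compare the truncation at \<open>L\<close> with the one at a larger \<open>M\<close>,
  where \<open>cubic_diff_le\<close> produces the tail of \<open>a\<close>, and let \<open>M\<close>
  tend to infinity. Only finitely many coordinates are measured, so coefficientwise convergence is
  enough.\<close>

lemma truncation_error:
  assumes a: "hs s a"
  shows "L2_set (\<lambda>n. weight 1 s n * cmod (fc (nonlin lam (ser a)) n - F a L n)) (modes L) \<le>
    324 * 4 powr s * G * (hnorm s a)\<^sup>2 * htail s a L"
proof (rule tendsto_upperbound)
  have l1: "l1 a" by (rule hs_l1[OF s_ge_1 a])
  show "(\<lambda>M. L2_set (\<lambda>n. weight 1 s n * cmod (F a M n - F a L n)) (modes L)) \<longlonglongrightarrow>
    L2_set (\<lambda>n. weight 1 s n * cmod (fc (nonlin lam (ser a)) n - F a L n)) (modes L)"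
    by (intro L2_set_tendsto tendsto_diff F_tendsto l1 tendsto_const)
  show "\<forall>\<^sub>F M in sequentially. L2_set (\<lambda>n. weight 1 s n * cmod (F a M n - F a L n)) (modes L) \<le>
    324 * 4 powr s * G * (hnorm s a)\<^sup>2 * htail s a L"
    using eventually_ge_at_top[of L]
  proof eventually_elim
    case (elim M)
    have "L2_set (\<lambda>n. weight 1 s n * cmod (F a M n - F a L n)) (modes L) \<le>
      L2_set (\<lambda>n. weight 1 s n * cmod (F a M n - F a L n)) (modes M)"
      unfolding L2_set_def using elim by (intro real_sqrt_le_mono sum_mono2) auto
    also have "\<dots> \<le> 324 * 4 powr s * G * (L2_set (\<lambda>n. weight 1 s n * cmod (a n)) (modes M))\<^sup>2 *
        L2_set (\<lambda>n. weight 1 s n * cmod (a n)) (modes M - modes L)"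
      using elim by (intro cubic_diff_le) auto
    also have "\<dots> \<le> 324 * 4 powr s * G * (hnorm s a)\<^sup>2 * htail s a L"
      using G_nonneg by (intro mult_mono mult_left_mono power_mono L2_set_le_hnorm L2_set_le_htail a elim) auto
    finally show ?case .
  qed
qed auto

lemma F_le:
  assumes a: "hs s a"
  shows "L2_set (\<lambda>n. weight 1 s n * cmod (F a M n)) (modes M) \<le> 108 * 4 powr s * G * hnorm s a ^ 3"
proof -
  let ?h = "L2_set (\<lambda>n. weight 1 s n * cmod (a n)) (modes M)"
  have "L2_set (\<lambda>n. weight 1 s n * cmod (F a M n)) (modes M) \<le> 3 * 4 powr s * G * (\<Sum>n\<in>modes M. cmod (a n))\<^sup>2 * ?h"
    by (intro cubic_weight_le) auto
  also have "\<dots> \<le> 3 * 4 powr s * G * (6 * ?h)\<^sup>2 * ?h"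
    using G_nonneg by (intro mult_right_mono mult_left_mono power_mono weighted_l1_le s_ge_1 sum_nonneg) auto
  also have "\<dots> = 108 * 4 powr s * G * ?h ^ 3" by (simp add: power2_eq_square power3_eq_cube)
  also have "\<dots> \<le> 108 * 4 powr s * G * hnorm s a ^ 3"
    using G_nonneg by (intro mult_left_mono power_mono L2_set_le_hnorm a) auto
  finally show ?thesis .
qed

text \<open>The bound of \<open>F_le\<close> does not depend on \<open>M\<close>, hence it survives
  the coefficientwise limit on every finite set of modes.\<close>

lemma nonlin_hs:
  assumes a: "hs s a"
  shows "hs s (fc (nonlin lam (ser a)))" "hnorm s (fc (nonlin lam (ser a))) \<le> 108 * 4 powr s * G * hnorm s a ^ 3"
proof -
  have l1: "l1 a" by (rule hs_l1[OF s_ge_1 a])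
  have "L2_set (\<lambda>n. weight 1 s n * cmod (fc (nonlin lam (ser a)) n)) A \<le> 108 * 4 powr s * G * hnorm s a ^ 3"
    if A: "finite A" for A
  proof (rule tendsto_upperbound)
    show "(\<lambda>M. L2_set (\<lambda>n. weight 1 s n * cmod (F a M n)) A) \<longlonglongrightarrow>
      L2_set (\<lambda>n. weight 1 s n * cmod (fc (nonlin lam (ser a)) n)) A"
      by (intro L2_set_tendsto F_tendsto l1)
    have "\<forall>\<^sub>F M in sequentially. finite (modes M) \<and> A \<subseteq> modes M \<and> modes M \<subseteq> UNIV"
      using filterlim_modes A unfolding filterlim_finite_subsets_at_top by blast
    then show "\<forall>\<^sub>F M in sequentially. L2_set (\<lambda>n. weight 1 s n * cmod (F a M n)) A \<le> 108 * 4 powr s * G * hnorm s a ^ 3"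
    proof eventually_elim
      case (elim M)
      have "L2_set (\<lambda>n. weight 1 s n * cmod (F a M n)) A \<le> L2_set (\<lambda>n. weight 1 s n * cmod (F a M n)) (modes M)"
        unfolding L2_set_def using elim by (intro real_sqrt_le_mono sum_mono2) auto
      also have "\<dots> \<le> 108 * 4 powr s * G * hnorm s a ^ 3" by (rule F_le[OF a])
      finally show ?case .
    qed
  qed auto
  note bound = this
  show "hs s (fc (nonlin lam (ser a)))" by (rule hsI(1)[OF bound])
  show "hnorm s (fc (nonlin lam (ser a))) \<le> 108 * 4 powr s * G * hnorm s a ^ 3" by (rule hsI(2)[OF bound])
qed

lemma fc_nonlin_ser:
  assumes f: "integrable circ f" "hs s (fc f)"
  shows "fc (nonlin lam f) n = fc (nonlin lam (ser (fc f))) n"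
proof (rule fc_cong_AE)
  have l1: "l1 (fc f)" by (rule hs_l1[OF s_ge_1 f(2)])
  show "AE x in circ. nonlin lam f x = nonlin lam (ser (fc f)) x"
    using fourier_inversion[OF f(1) l1] by eventually_elim (simp add: nonlin_def)
  show "nonlin lam f \<in> borel_measurable circ" by (intro nonlin_measurable borel_measurable_integrable f)
  show "nonlin lam (ser (fc f)) \<in> borel_measurable circ" by (intro nonlin_measurable circ_measurable ser_measurable l1)
qed

lemma fc_nonlin_ser_diff:
  assumes a: "hs s a" and b: "hs s b" and R: "hnorm s a \<le> R" "hnorm s b \<le> R"
  shows "norm (fc (nonlin lam (ser a)) n - fc (nonlin lam (ser b)) n) \<le> B * (3 * (6 * R)\<^sup>2 * (6 * hnorm s (\<lambda>n. a n - b n)))"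
proof -
  have l1: "l1 a" "l1 b" "l1 (\<lambda>n. a n - b n)"
    by (rule hs_l1[OF s_ge_1 a], rule hs_l1[OF s_ge_1 b], rule hs_l1[OF s_ge_1 hnorm_diff(1)[OF a b]])
  have "ser a x - ser b x = ser (\<lambda>n. a n - b n) x" for x
  proof (rule LIMSEQ_unique)
    show "(\<lambda>L. psum a L x - psum b L x) \<longlonglongrightarrow> ser a x - ser b x"
      by (intro tendsto_diff psum_tendsto l1)
    have "psum (\<lambda>n. a n - b n) L x = psum a L x - psum b L x" for L
      unfolding tpoly_def by (simp add: left_diff_distrib sum_subtractf)
    then show "(\<lambda>L. psum a L x - psum b L x) \<longlonglongrightarrow> ser (\<lambda>n. a n - b n) x"
      using psum_tendsto[OF l1(3), of x] by simp
  qed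
  then have d: "norm (ser a x - ser b x) \<le> 6 * hnorm s (\<lambda>n. a n - b n)" for x
    using norm_ser_le[OF l1(3), of x] hs_l1(2)[OF s_ge_1 hnorm_diff(1)[OF a b]] by simp
  have "norm (ser a x) \<le> 6 * R" "norm (ser b x) \<le> 6 * R" for x
    using norm_ser_le[OF l1(1), of x] norm_ser_le[OF l1(2), of x] hs_l1(2)[OF s_ge_1 a] hs_l1(2)[OF s_ge_1 b] R by linarith+
  then show ?thesis using d l1
    by (intro fc_nonlin_diff AE_I2 circ_measurable ser_measurable) auto
qed

end

section \<open>Solutions in Fourier variables\<close>

lemma bracket_powr_square: "japanese_bracket n powr (2 * s) = (japanese_bracket n powr s)\<^sup>2"
  by (simp add: power2_eq_square powr_add[symmetric])

lemma grow_le_japanese_bracket: assumes "1 \<le> N" shows "grow N n \<le> japanese_bracket n"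
proof -
  have "\<bar>real_of_int n\<bar> / N \<le> \<bar>real_of_int n\<bar>" using assms by (simp add: divide_le_eq mult_le_cancel_left1)
  also have "\<dots> \<le> japanese_bracket n" unfolding japanese_bracket_def by (rule real_le_rsqrt) simp
  finally show ?thesis by (simp add: grow_def japanese_bracket_def)
qed

lemma weight_le_japanese_bracket:
  assumes "1 \<le> N" "0 \<le> s" shows "weight N s n \<le> japanese_bracket n powr s"
  unfolding weight_def using grow_ge_1[of N n] grow_le_japanese_bracket[OF assms(1), of n] assms(2)
  by (intro powr_mono2) auto

text \<open>The loss \<open>N powr s\<close> is where the growth in time of the final estimate
  arises: the weighted norm stays bounded by a constant multiple of the initial norm, while
  \<open>N\<close> is chosen of order \<open>(1 + \<bar>t\<bar>)\<^sup>2\<close>.\<close>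

lemma japanese_bracket_le_weight:
  assumes "1 \<le> N" "0 \<le> s" shows "japanese_bracket n powr s \<le> (2 * N) powr s * weight N s n"
proof -
  have g: "\<bar>real_of_int n\<bar> \<le> N * grow N n" "1 \<le> N * grow N n"
  proof -
    have "\<bar>real_of_int n\<bar> / N \<le> grow N n" by (simp add: grow_def)
    then show "\<bar>real_of_int n\<bar> \<le> N * grow N n" using assms(1) by (simp add: divide_le_eq mult.commute)
    show "1 \<le> N * grow N n" using mult_mono[OF assms(1) grow_ge_1[of N n]] assms(1) by simp
  qed
  have "japanese_bracket n \<le> 1 + \<bar>real_of_int n\<bar>"
    unfolding japanese_bracket_def by (rule real_le_lsqrt) (auto simp: power2_eq_square algebra_simps)
  also have "\<dots> \<le> 2 * N * grow N n" using g by simp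
  finally have "japanese_bracket n powr s \<le> (2 * N * grow N n) powr s"
    using assms by (intro powr_mono2) (auto simp: japanese_bracket_def)
  also have "\<dots> = (2 * N) powr s * weight N s n"
    unfolding weight_def using assms grow_ge_1[of N n] by (simp add: powr_mult)
  finally show ?thesis .
qed

lemma fourier_coeff_eq: "fourier_coeff f n = 2 * pi * fc f n"
  by (simp add: fc_def)

lemma hs_summable:
  assumes "0 \<le> s" "hs s (fc f)"
  shows "(\<lambda>n. (cmod (fourier_coeff f n))\<^sup>2 * japanese_bracket n powr (2 * s)) summable_on UNIV"
proof -
  let ?f = "\<lambda>n. (cmod (fourier_coeff f n))\<^sup>2 * japanese_bracket n powr (2 * s)"
  let ?g = "\<lambda>n. (2 * pi)\<^sup>2 * ((2 powr s)\<^sup>2 * (weight 1 s n * cmod (fc f n))\<^sup>2)"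
  have "(\<lambda>n. (2 * pi)\<^sup>2 * ((2 powr s)\<^sup>2 * (weight 1 s n * cmod (fc f n))\<^sup>2)) summable_on UNIV"
    using assms(2) unfolding hs_def by (intro summable_on_cmult_right)
  note g = this
  have fg: "?f n \<le> ?g n" for n
  proof -
  have "(japanese_bracket n powr s)\<^sup>2 \<le> (2 powr s * weight 1 s n)\<^sup>2"
    using japanese_bracket_le_weight[of 1 s n] assms(1) by (intro power_mono) auto
  then have "(2 * pi)\<^sup>2 * ((cmod (fc f n))\<^sup>2 * (japanese_bracket n powr s)\<^sup>2) \<le>
     (2 * pi)\<^sup>2 * ((cmod (fc f n))\<^sup>2 * (2 powr s * weight 1 s n)\<^sup>2)"
    by (intro mult_left_mono) auto
  then show ?thesis
    unfolding bracket_powr_square fourier_coeff_eq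
    by (simp add: norm_mult power_mult_distrib mult_ac)
  qed
  have "sum ?f A \<le> infsum ?g UNIV" if "finite A" for A
    using sum_mono[of A ?f ?g] fg sum_le_infsum[OF g _ that] by fastforce
  then show ?thesis
    by (intro nonneg_bdd_above_summable_on) (auto intro!: bdd_aboveI[where M = "infsum ?g UNIV"])
qed

lemma weight_sum_le_Hs_norm:
  assumes "1 \<le> N" "0 \<le> s" "(\<lambda>n. (cmod (fourier_coeff f n))\<^sup>2 * japanese_bracket n powr (2 * s)) summable_on UNIV"
    and A: "finite A"
  shows "2 * pi * L2_set (\<lambda>n. weight N s n * cmod (fc f n)) A \<le> Hs_norm s f"
proof -
  have "(2 * pi * L2_set (\<lambda>n. weight N s n * cmod (fc f n)) A)\<^sup>2 = (\<Sum>n\<in>A. (2 * pi * (weight N s n * cmod (fc f n)))\<^sup>2)"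
    by (simp add: L2_set_def power_mult_distrib sum_nonneg sum_distrib_left)
  also have "\<dots> \<le> (\<Sum>n\<in>A. (cmod (fourier_coeff f n))\<^sup>2 * japanese_bracket n powr (2 * s))"
  proof (rule sum_mono)
    fix n
    have "(2 * pi * (weight N s n * cmod (fc f n)))\<^sup>2 \<le> (2 * pi * (japanese_bracket n powr s * cmod (fc f n)))\<^sup>2"
      using weight_le_japanese_bracket[OF assms(1,2), of n]
      by (intro power_mono mult_left_mono mult_right_mono) (auto simp: weight_nonneg)
    then show "(2 * pi * (weight N s n * cmod (fc f n)))\<^sup>2 \<le> (cmod (fourier_coeff f n))\<^sup>2 * japanese_bracket n powr (2 * s)"
      unfolding bracket_powr_square fourier_coeff_eq by (simp add: norm_mult power_mult_distrib mult_ac)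
  qed
  also have "\<dots> \<le> infsum (\<lambda>n. (cmod (fourier_coeff f n))\<^sup>2 * japanese_bracket n powr (2 * s)) UNIV"
    by (rule sum_le_infsum[OF assms(3) _ A]) simp
  finally show ?thesis unfolding Hs_norm_def by (rule real_le_rsqrt)
qed

lemma Hs_norm_le:
  assumes "1 \<le> N" "0 \<le> s" "\<And>A. finite A \<Longrightarrow> L2_set (\<lambda>n. weight N s n * cmod (fc f n)) A \<le> b"
    and "(\<lambda>n. (cmod (fourier_coeff f n))\<^sup>2 * japanese_bracket n powr (2 * s)) summable_on UNIV"
  shows "Hs_norm s f \<le> 2 * pi * (2 * N) powr s * b"
  unfolding Hs_norm_def
proof (rule real_le_lsqrt)
  have b: "0 \<le> b" using assms(3)[of "{}"] by simp
  then show "0 \<le> 2 * pi * (2 * N) powr s * b" by simp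
  show "infsum (\<lambda>n. (cmod (fourier_coeff f n))\<^sup>2 * japanese_bracket n powr (2 * s)) UNIV \<le> (2 * pi * (2 * N) powr s * b)\<^sup>2"
  proof (rule infsum_le_finite_sums[OF assms(4)])
    fix A :: "int set" assume A: "finite A"
    have "(\<Sum>n\<in>A. (cmod (fourier_coeff f n))\<^sup>2 * japanese_bracket n powr (2 * s)) \<le>
      (\<Sum>n\<in>A. (2 * pi * (2 * N) powr s)\<^sup>2 * (weight N s n * cmod (fc f n))\<^sup>2)"
    proof (rule sum_mono)
      fix n
      have "(2 * pi * (japanese_bracket n powr s * cmod (fc f n)))\<^sup>2 \<le> (2 * pi * ((2 * N) powr s * weight N s n * cmod (fc f n)))\<^sup>2"
        using japanese_bracket_le_weight[OF assms(1,2), of n]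
        by (intro power_mono mult_left_mono mult_right_mono) auto
      then show "(cmod (fourier_coeff f n))\<^sup>2 * japanese_bracket n powr (2 * s) \<le>
         (2 * pi * (2 * N) powr s)\<^sup>2 * (weight N s n * cmod (fc f n))\<^sup>2"
        unfolding bracket_powr_square fourier_coeff_eq by (simp add: norm_mult power_mult_distrib mult_ac)
    qed
    also have "\<dots> = (2 * pi * (2 * N) powr s * L2_set (\<lambda>n. weight N s n * cmod (fc f n)) A)\<^sup>2"
      by (simp add: L2_set_def power_mult_distrib sum_nonneg sum_distrib_left mult_ac)
    also have "\<dots> \<le> (2 * pi * (2 * N) powr s * b)\<^sup>2"
      using assms(3)[OF A] by (intro power_mono mult_left_mono) auto
    finally show "(\<Sum>n\<in>A. (cmod (fourier_coeff f n))\<^sup>2 * japanese_bracket n powr (2 * s)) \<le> (2 * pi * (2 * N) powr s * b)\<^sup>2" .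
  qed
qed

lemma Hs_circle_hs: assumes "0 \<le> s" "f \<in> Hs_circle s" shows "hs s (fc f)"
proof (rule hsI(1))
  fix A :: "int set" assume "finite A"
  then show "L2_set (\<lambda>n. weight 1 s n * cmod (fc f n)) A \<le> Hs_norm s f / (2 * pi)"
    using weight_sum_le_Hs_norm[of 1 s f A] assms by (simp add: Hs_circle_def field_simps)
qed

lemma hnorm_le_Hs_norm: assumes "0 \<le> s" "hs s (fc f)" shows "hnorm s (fc f) \<le> Hs_norm s f / (2 * pi)"
proof (rule hsI(2))
  fix A :: "int set" assume "finite A"
  then show "L2_set (\<lambda>n. weight 1 s n * cmod (fc f n)) A \<le> Hs_norm s f / (2 * pi)"
    using weight_sum_le_Hs_norm[of 1 s f A] hs_summable[OF assms] assms by (simp add: field_simps)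
qed

lemma propagator_eq: "schroedinger_propagator t f x = ser (\<lambda>n. cis (- ((of_int n)\<^sup>2 * t)) * fc f n) x"
  unfolding schroedinger_propagator_def ser_def infsum_cmult_right'[symmetric] fc_def
  by (intro infsum_cong) simp

text \<open>The sign allows positive and negative times to be treated with the same set
  integral.\<close>

lemma interval_integral_signed:
  fixes g :: "real \<Rightarrow> complex"
  shows "(LBINT \<tau>=0..ereal t. g \<tau>) = (if 0 \<le> t then 1 else - 1) * (LINT \<tau>:{min 0 t..max 0 t}|lborel. g \<tau>)"
proof (cases "0 \<le> t")
  case True
  then show ?thesis using interval_integral_Icc[of 0 t g] by (simp add: zero_ereal_def)
next
  case False
  have "(LBINT \<tau>=0..ereal t. g \<tau>) = - (LBINT \<tau>=ereal t..0. g \<tau>)" by (rule interval_integral_endpoints_reverse)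
  then show ?thesis using interval_integral_Icc[of t 0 g] False by (simp add: zero_ereal_def)
qed

text \<open>Exchanges time integration and Fourier series by dominated convergence of the partial
  sums, with the constant \<open>C\<close> as majorant. Measurability in time comes from the
  continuity of each coefficient.\<close>

lemma integral_ser:
  fixes b :: "real \<Rightarrow> int \<Rightarrow> complex"
  assumes cont: "\<And>n. continuous_on {p..q} (\<lambda>\<tau>. b \<tau> n)" and l1: "\<And>\<tau>. \<tau> \<in> {p..q} \<Longrightarrow> l1 (b \<tau>)"
    and C: "\<And>\<tau>. \<tau> \<in> {p..q} \<Longrightarrow> infsum (\<lambda>n. cmod (b \<tau> n)) UNIV \<le> C"
  defines "J \<equiv> \<lambda>n. LINT \<tau>:{p..q}|lborel. b \<tau> n"
  shows "l1 J" and "(LINT \<tau>:{p..q}|lborel. ser (b \<tau>) x) = ser J x"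
proof -
  let ?M = "restrict_space lborel {p..q}"
  have fin: "finite_measure ?M"
    by (intro finite_measureI) (simp add: emeasure_restrict_space space_restrict_space emeasure_lborel_Icc_eq)
  have sp: "space ?M = {p..q}" by (simp add: space_restrict_space)
  have Jeq: "J n = (\<integral>\<tau>. b \<tau> n \<partial>?M)" for n
    unfolding J_def set_lebesgue_integral_def by (simp add: integral_restrict_space)
  have meas: "(\<lambda>\<tau>. b \<tau> n) \<in> borel_measurable ?M" for n
  proof -
    have "measurable ?M borel = measurable (restrict_space borel {p..q}) (borel :: complex measure)"
      by (intro measurable_cong_sets sets_restrict_space_cong) simp_all
    then show ?thesis using borel_measurable_continuous_on_restrict[OF cont] by simp
  qed
  have le: "(\<Sum>n\<in>A. cmod (b \<tau> n)) \<le> C" if "\<tau> \<in> {p..q}" "finite A" for \<tau> A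
    using sum_le_infsum[OF l1[OF that(1)] _ that(2)] C[OF that(1)] by fastforce
  have int: "integrable ?M (\<lambda>\<tau>. b \<tau> n)" for n
  proof (rule finite_measure.integrable_const_bound[OF fin _ meas])
    show "AE \<tau> in ?M. norm (b \<tau> n) \<le> C" using le[of _ "{n}"] sp by (intro AE_I2) auto
  qed
  have sumJ: "(\<Sum>n\<in>A. cmod (J n)) \<le> C * measure ?M (space ?M)" if A: "finite A" for A
  proof -
    have "(\<Sum>n\<in>A. cmod (J n)) \<le> (\<Sum>n\<in>A. \<integral>\<tau>. cmod (b \<tau> n) \<partial>?M)"
      unfolding Jeq by (intro sum_mono integral_norm_bound)
    also have "\<dots> = (\<integral>\<tau>. (\<Sum>n\<in>A. cmod (b \<tau> n)) \<partial>?M)"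
      using int by (intro Bochner_Integration.integral_sum[symmetric]) auto
    also have "\<dots> \<le> (\<integral>\<tau>. C \<partial>?M)"
      using int le[OF _ A] sp finite_measure.integrable_const[OF fin] by (intro integral_mono) auto
    finally show ?thesis by (simp add: mult.commute)
  qed
  show l1J: "l1 J" by (rule nonneg_bdd_above_summable_on)
      (auto intro!: bdd_aboveI[where M = "C * measure ?M (space ?M)"] sumJ)
  have "(\<lambda>L. \<integral>\<tau>. psum (b \<tau>) L x \<partial>?M) \<longlonglongrightarrow> (\<integral>\<tau>. ser (b \<tau>) x \<partial>?M)"
  proof (rule integral_dominated_convergence[where w = "\<lambda>_. C"])
    show pm: "(\<lambda>\<tau>. psum (b \<tau>) L x) \<in> borel_measurable ?M" for L
      unfolding tpoly_def by (intro borel_measurable_sum borel_measurable_times meas) simp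
    show lim: "AE \<tau> in ?M. (\<lambda>L. psum (b \<tau>) L x) \<longlonglongrightarrow> ser (b \<tau>) x"
      using sp l1 by (intro AE_I2 psum_tendsto) auto
    show "(\<lambda>\<tau>. ser (b \<tau>) x) \<in> borel_measurable ?M"
      by (rule borel_measurable_LIMSEQ_metric[OF pm], rule psum_tendsto, rule l1) (simp only: sp)
    show "AE \<tau> in ?M. norm (psum (b \<tau>) L x) \<le> C" for L
      using sp by (intro AE_I2 order.trans[OF norm_tpoly_le le]) auto
  qed (rule finite_measure.integrable_const[OF fin])
  moreover have "(\<integral>\<tau>. psum (b \<tau>) L x \<partial>?M) = psum J L x" for L
    unfolding tpoly_def Jeq using int
    by (subst Bochner_Integration.integral_sum) (auto intro!: integrable_mult_left)
  moreover have "(\<lambda>L. psum J L x) \<longlonglongrightarrow> ser J x" by (rule psum_tendsto[OF l1J])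
  ultimately have "(\<integral>\<tau>. ser (b \<tau>) x \<partial>?M) = ser J x" using LIMSEQ_unique by (simp only:) blast
  then show "(LINT \<tau>:{p..q}|lborel. ser (b \<tau>) x) = ser J x"
    unfolding set_lebesgue_integral_def by (simp add: integral_restrict_space)
qed

section \<open>The coefficients of a solution and their differential equation\<close>

locale nls_flow = nls +
  fixes \<Phi> :: "real \<Rightarrow> complex" and u :: "real \<Rightarrow> real \<Rightarrow> complex"
  assumes data: "\<Phi> \<in> Hs_circle s" and solution: "global_NLS_solution lam s \<Phi> u"
begin

definition c :: "real \<Rightarrow> int \<Rightarrow> complex" where "c t = fc (u t)"

text \<open>Formed from the series with the coefficients of \<open>u t\<close>, a bounded
  representative of \<open>u t\<close>, because the estimates for the nonlinearity are stated for
  series. By \<open>fc_nonlin_ser\<close> these are also the coefficients of the nonlinearity of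
  \<open>u t\<close> itself.\<close>

definition \<F> :: "real \<Rightarrow> int \<Rightarrow> complex" where "\<F> t = fc (nonlin lam (ser (c t)))"

lemma s_nonneg: "0 \<le> s"
  using s_ge_1 by linarith

lemma u_Hs: "u t \<in> Hs_circle s"
  using solution by (simp add: global_NLS_solution_def)

lemma u_integrable: "integrable circ (u t)"
  using u_Hs[of t] by (intro L2_circle_integrable) (simp add: Hs_circle_def)

lemma \<Phi>_integrable: "integrable circ \<Phi>"
  using data by (intro L2_circle_integrable) (simp add: Hs_circle_def)

lemma c_hs: "hs s (c t)"
  unfolding c_def by (rule Hs_circle_hs[OF s_nonneg u_Hs])

lemma c_diff_hs: "hs s (\<lambda>n. c t n - c r n)"
  by (rule hnorm_diff(1)[OF c_hs c_hs])

lemma c_continuous: "((\<lambda>t. hnorm s (\<lambda>n. c t n - c r n)) \<longlongrightarrow> 0) (at r)"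
proof (rule Lim_null_comparison)
  have "((\<lambda>t. Hs_norm s (\<lambda>x. u t x - u r x)) \<longlongrightarrow> 0) (at r)"
    using solution by (simp add: global_NLS_solution_def)
  from tendsto_divide[OF this tendsto_const, of "2 * pi"]
  show "((\<lambda>t. Hs_norm s (\<lambda>x. u t x - u r x) / (2 * pi)) \<longlongrightarrow> 0) (at r)" by simp
  have "hnorm s (\<lambda>n. c t n - c r n) \<le> Hs_norm s (\<lambda>x. u t x - u r x) / (2 * pi)" for t
  proof -
    have "fc (\<lambda>x. u t x - u r x) = (\<lambda>n. c t n - c r n)"
      unfolding c_def by (rule ext) (rule fc_diff[OF u_integrable u_integrable])
    then show ?thesis using hnorm_le_Hs_norm[OF s_nonneg, of "\<lambda>x. u t x - u r x"] c_diff_hs[of t r] by simp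
  qed
  then show "\<forall>\<^sub>F t in at r. norm (hnorm s (\<lambda>n. c t n - c r n)) \<le> Hs_norm s (\<lambda>x. u t x - u r x) / (2 * pi)"
    by (intro always_eventually allI) (simp add: hnorm_nonneg)
qed

lemma hnorm_c_continuous: "continuous_on A (\<lambda>t. hnorm s (c t))"
proof (intro continuous_at_imp_continuous_on ballI)
  fix r
  have "((\<lambda>t. hnorm s (c t) - hnorm s (c r)) \<longlongrightarrow> 0) (at r)"
  proof (rule Lim_null_comparison[OF _ c_continuous[of r]], intro always_eventually allI)
    fix t
    have "hnorm s (\<lambda>n. c r n - c t n) = hnorm s (\<lambda>n. c t n - c r n)" by (simp add: hnorm_def norm_minus_commute)
    then show "norm (hnorm s (c t) - hnorm s (c r)) \<le> hnorm s (\<lambda>n. c t n - c r n)"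
      using hnorm_diff(2)[OF c_hs[of t] c_hs[of r]] hnorm_diff(2)[OF c_hs[of r] c_hs[of t]] by simp
  qed
  then show "isCont (\<lambda>t. hnorm s (c t)) r" unfolding isCont_def by (rule LIM_zero_cancel)
qed

lemma hnorm_c_bounded: obtains R where "0 < R" "\<And>t. t \<in> {p..q} \<Longrightarrow> hnorm s (c t) \<le> R"
proof -
  have "compact ((\<lambda>t. hnorm s (c t)) ` {p..q})" by (intro compact_continuous_image hnorm_c_continuous) auto
  then have "bounded ((\<lambda>t. hnorm s (c t)) ` {p..q})" by (rule compact_imp_bounded)
  then obtain R where "\<forall>t\<in>{p..q}. norm (hnorm s (c t)) \<le> R" unfolding bounded_iff by auto
  then show ?thesis by (intro that[of "max R 1"]) (fastforce simp: hnorm_nonneg)+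
qed

lemma \<F>_continuous: "continuous_on A (\<lambda>t. \<F> t n)"
proof (intro continuous_at_imp_continuous_on ballI)
  fix r
  obtain R where R: "\<And>t. t \<in> {r - 1..r + 1} \<Longrightarrow> hnorm s (c t) \<le> R" using hnorm_c_bounded by metis
  have "((\<lambda>t. \<F> t n - \<F> r n) \<longlongrightarrow> 0) (at r)"
  proof (rule Lim_null_comparison)
    have "((\<lambda>t. B * (3 * (6 * R)\<^sup>2 * (6 * hnorm s (\<lambda>n. c t n - c r n)))) \<longlongrightarrow> B * (3 * (6 * R)\<^sup>2 * (6 * 0))) (at r)"
      by (intro tendsto_mult_left c_continuous)
    then show "((\<lambda>t. B * (3 * (6 * R)\<^sup>2 * (6 * hnorm s (\<lambda>n. c t n - c r n)))) \<longlongrightarrow> 0) (at r)" by simp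
    have "\<forall>\<^sub>F t in at r. t \<in> ball r 1" by (intro eventually_at_in_open') auto
    then show "\<forall>\<^sub>F t in at r. norm (\<F> t n - \<F> r n) \<le> B * (3 * (6 * R)\<^sup>2 * (6 * hnorm s (\<lambda>n. c t n - c r n)))"
    proof eventually_elim
      case (elim t)
      then have "t \<in> {r - 1..r + 1}" by (auto simp: dist_real_def)
      then show ?case unfolding \<F>_def by (intro fc_nonlin_ser_diff c_hs R) auto
    qed
  qed
  then show "isCont (\<lambda>t. \<F> t n) r" unfolding isCont_def by (rule LIM_zero_cancel)
qed

text \<open>Duhamel's formula holds almost everywhere in \<open>x\<close>, so Fourier coefficients
  of both sides can be compared. The free evolution is pulled out in front, which leaves the time
  \<open>t\<close> only in the prefactor and in the upper limit of the integral.\<close>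

lemma duhamel:
  "c t n = cis (- ((of_int n)\<^sup>2 * t)) * (fc \<Phi> n - \<i> * (LBINT \<tau>=0..ereal t. cis ((of_int n)\<^sup>2 * \<tau>) * \<F> \<tau> n))"
proof -
  let ?p = "min 0 t" and ?q = "max 0 t" and ?\<sigma> = "(if 0 \<le> t then 1 else - 1) :: complex"
  define a where "a n = cis (- ((of_int n)\<^sup>2 * t)) * fc \<Phi> n" for n
  define b where "b \<tau> n = cis (- ((of_int n)\<^sup>2 * (t - \<tau>))) * \<F> \<tau> n" for \<tau> n
  define J where "J n = (LINT \<tau>:{?p..?q}|lborel. b \<tau> n)" for n
  obtain R where R: "0 < R" "\<And>\<tau>. \<tau> \<in> {?p..?q} \<Longrightarrow> hnorm s (c \<tau>) \<le> R" using hnorm_c_bounded by metis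
  have Fhs: "hs s (\<F> \<tau>)" "hnorm s (\<F> \<tau>) \<le> 108 * 4 powr s * G * hnorm s (c \<tau>) ^ 3" for \<tau>
    unfolding \<F>_def by (rule nonlin_hs[OF c_hs])+
  have bl: "l1 (b \<tau>)" "infsum (\<lambda>n. cmod (b \<tau> n)) UNIV = infsum (\<lambda>n. cmod (\<F> \<tau> n)) UNIV" for \<tau>
    using hs_l1(1)[OF s_ge_1 Fhs(1), of \<tau>] by (simp_all add: b_def norm_mult)
  have C: "infsum (\<lambda>n. cmod (b \<tau> n)) UNIV \<le> 6 * (108 * 4 powr s * G * R ^ 3)" if "\<tau> \<in> {?p..?q}" for \<tau>
  proof -
    have "108 * 4 powr s * G * hnorm s (c \<tau>) ^ 3 \<le> 108 * 4 powr s * G * R ^ 3"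
      using R(2)[OF that] G_nonneg hnorm_nonneg by (intro mult_left_mono power_mono) auto
    then show ?thesis unfolding bl(2) using hs_l1(2)[OF s_ge_1 Fhs(1), of \<tau>] Fhs(2)[of \<tau>] by linarith
  qed
  have bc: "continuous_on {?p..?q} (\<lambda>\<tau>. b \<tau> n)" for n
    unfolding b_def by (intro continuous_intros \<F>_continuous)
  have J: "l1 J" "(LINT \<tau>:{?p..?q}|lborel. ser (b \<tau>) x) = ser J x" for x
    unfolding J_def[abs_def] using integral_ser[OF bc bl(1) C] by simp_all
  have al: "l1 a" unfolding a_def using hs_l1(1)[OF s_ge_1 Hs_circle_hs[OF s_nonneg data]] by (simp add: norm_mult)
  have nl: "schroedinger_propagator (t - \<tau>) (\<lambda>y. of_real (lam y * (cmod (u \<tau> y))\<^sup>2) * u \<tau> y) x = ser (b \<tau>) x" for \<tau> x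
  proof -
    have "(\<lambda>y. of_real (lam y * (cmod (u \<tau> y))\<^sup>2) * u \<tau> y) = nonlin lam (u \<tau>)" by (simp add: nonlin_def fun_eq_iff)
    moreover have "fc (nonlin lam (u \<tau>)) n = \<F> \<tau> n" for n
      unfolding \<F>_def c_def by (rule fc_nonlin_ser[OF u_integrable c_hs[unfolded c_def]])
    ultimately show ?thesis unfolding propagator_eq b_def by simp
  qed
  have "AE x in lborel. u t x = schroedinger_propagator t \<Phi> x
          - \<i> * (LBINT \<tau>=0..ereal t. schroedinger_propagator (t - \<tau>)
                (\<lambda>y. of_real (lam y * (cmod (u \<tau> y))\<^sup>2) * u \<tau> y) x)"
    using solution unfolding global_NLS_solution_def by blast
  then have "AE x in lborel. u t x = schroedinger_propagator t \<Phi> x - \<i> * (?\<sigma> * ser J x)"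
    unfolding nl interval_integral_signed J(2) .
  then have "AE x in circ. u t x = ser a x - (\<i> * ?\<sigma>) * ser J x"
    unfolding AE_circ_iff propagator_eq a_def[abs_def] by eventually_elim simp
  then have "fc (u t) n = fc (\<lambda>x. ser a x - (\<i> * ?\<sigma>) * ser J x) n"
    by (rule fc_cong_AE)
       (intro borel_measurable_integrable u_integrable Bochner_Integration.integrable_diff integrable_mult_right ser_integrable al J(1))+
  also have "\<dots> = a n - (\<i> * ?\<sigma>) * J n"
  proof -
    have "fc (\<lambda>x. k * ser J x) n = k * J n" for k
      using fc_ser[OF J(1), of n] unfolding fc_eq
      by (simp only: mult.assoc integral_mult_right_zero times_divide_eq_right[symmetric])
    then show ?thesis by (simp only: fc_diff[OF ser_integrable[OF al] integrable_mult_right[OF ser_integrable[OF J(1)]]] fc_ser[OF al])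
  qed
  also have "\<dots> = a n - \<i> * (LBINT \<tau>=0..ereal t. b \<tau> n)"
    unfolding interval_integral_signed J_def by (simp only: mult.assoc)
  also have "(LBINT \<tau>=0..ereal t. b \<tau> n) = cis (- ((of_int n)\<^sup>2 * t)) * (LBINT \<tau>=0..ereal t. cis ((of_int n)\<^sup>2 * \<tau>) * \<F> \<tau> n)"
    unfolding b_def interval_lebesgue_integral_mult_right[symmetric]
    by (simp add: right_diff_distrib cis_mult[symmetric] flip: mult.assoc)
       (simp add: diff_conv_add_uminus cis_mult[symmetric] mult_ac del: add_uminus_conv_diff)?
  finally show ?thesis unfolding c_def a_def by (simp add: algebra_simps)
qed

text \<open>In the interaction form of \<open>duhamel\<close> the integrand is continuous in time,
  so the fundamental theorem of calculus makes every single coefficient differentiable, although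
  \<open>u\<close> is only a mild solution.\<close>

theorem c_deriv:
  "((\<lambda>t. c t n) has_vector_derivative (- \<i> * (of_int n)\<^sup>2 * c t n - \<i> * \<F> t n)) (at t)"
proof -
  let ?T = "\<bar>t\<bar> + 1"
  let ?g = "\<lambda>\<tau>. cis ((of_int n)\<^sup>2 * \<tau>) * \<F> \<tau> n"
  let ?I = "\<lambda>t. LBINT \<tau>=0..ereal t. ?g \<tau>"
  have "continuous_on {- ?T..?T} ?g" by (intro continuous_intros \<F>_continuous)
  then have "((\<lambda>t. LBINT \<tau>=ereal 0..ereal t. ?g \<tau>) has_vector_derivative ?g t) (at t within {- ?T..?T})"
    by (intro interval_integral_FTC2) auto
  moreover have "at t within {- ?T..?T} = at t" by (intro at_within_interior) (simp add: interior_atLeastAtMost_real abs_if)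
  ultimately have I: "(?I has_vector_derivative ?g t) (at t)" by (simp add: zero_ereal_def)
  have e: "((\<lambda>t. cis (- ((of_int n)\<^sup>2 * t))) has_vector_derivative (- \<i> * (of_int n)\<^sup>2 * cis (- ((of_int n)\<^sup>2 * t)))) (at t)"
    using has_vector_derivative_cis_mult[of "- ((of_int n)\<^sup>2)" t] by simp
  have "((\<lambda>t. cis (- ((of_int n)\<^sup>2 * t)) * (fc \<Phi> n - \<i> * ?I t)) has_vector_derivative
    (cis (- ((of_int n)\<^sup>2 * t)) * (0 - \<i> * ?g t) +
     (- \<i> * (of_int n)\<^sup>2 * cis (- ((of_int n)\<^sup>2 * t))) * (fc \<Phi> n - \<i> * ?I t))) (at t)"
    by (intro has_vector_derivative_mult e has_vector_derivative_diff has_vector_derivative_const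
        has_vector_derivative_mult_right I)
  moreover have "cis (- ((of_int n)\<^sup>2 * t)) * ?g t = \<F> t n"
    by (simp add: mult.assoc[symmetric] cis_mult)
  moreover have "e * (0 - \<i> * g) + (- \<i> * k * e) * z = - \<i> * k * (e * z) - \<i> * (e * g)" for e g k z :: complex
    by (simp add: algebra_simps)
  ultimately show ?thesis by (simp only: duhamel[symmetric])
qed

end

section \<open>Smooth coefficients and weak derivatives\<close>

lemma integral_circ_FTC:
  fixes F f :: "real \<Rightarrow> complex"
  assumes "\<And>x. (F has_vector_derivative f x) (at x)" "continuous_on UNIV f" "F (2 * pi) = F 0"
  shows "(\<integral>x. f x \<partial>circ) = 0"
proof -
  have "(\<integral>x. indicator {0..2*pi} x *\<^sub>R f x \<partial>lborel) = F (2 * pi) - F 0"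
    using assms by (intro integral_FTC_Icc) (auto intro: has_vector_derivative_at_within continuous_on_subset)
  then show ?thesis unfolding circ_def using assms(3) by (simp add: integral_restrict_space)
qed

lemma continuous_integrable_circ:
  fixes f :: "real \<Rightarrow> complex"
  assumes "continuous_on UNIV f" shows "integrable circ f"
proof -
  have "compact (f ` {0..2*pi})" by (intro compact_continuous_image continuous_on_subset[OF assms]) auto
  then have "bounded (f ` {0..2*pi})" by (rule compact_imp_bounded)
  then obtain M where "\<forall>x\<in>{0..2*pi}. norm (f x) \<le> M" unfolding bounded_iff by auto
  then show ?thesis
    by (intro integrable_circ_bounded[where B = M] circ_measurable borel_measurable_continuous_onI assms)
       (auto intro!: AE_I2 simp: space_circ)
qed

lemma fc_derivative:
  fixes f f' :: "real \<Rightarrow> complex"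
  assumes f: "\<And>x. (f has_vector_derivative f' x) (at x)" and f': "continuous_on UNIV f'" and per: "f (2 * pi) = f 0"
  shows "fc f' n = \<i> * of_int n * fc f n"
proof -
  have fc: "continuous_on UNIV f"
    using f by (auto intro!: continuous_at_imp_continuous_on has_vector_derivative_continuous)
  let ?e = "\<lambda>x. cis (- of_int n * x)"
  have "(\<integral>x. f' x * ?e x + f x * (\<i> * of_real (- of_int n) * ?e x) \<partial>circ) = 0"
  proof (rule integral_circ_FTC)
    show "((\<lambda>x. f x * ?e x) has_vector_derivative (f' x * ?e x + f x * (\<i> * of_real (- of_int n) * ?e x))) (at x)" for x
      using has_vector_derivative_mult[OF f has_vector_derivative_cis_mult[of "- of_int n" x UNIV]] by (simp add: add.commute)
    show "continuous_on UNIV (\<lambda>x. f' x * ?e x + f x * (\<i> * of_real (- of_int n) * ?e x))"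
      by (intro continuous_intros fc f')
    show "f (2 * pi) * ?e (2 * pi) = f 0 * ?e 0"
      using per cis_multiple_2pi[of "- of_int n"] by (simp add: mult_ac)
  qed
  moreover have "(\<integral>x. f' x * ?e x + f x * (\<i> * of_real (- of_int n) * ?e x) \<partial>circ) =
     (\<integral>x. f' x * ?e x + (- \<i> * of_int n) * (f x * ?e x) \<partial>circ)"
    by (intro Bochner_Integration.integral_cong refl) simp
  moreover have "\<dots> = (\<integral>x. f' x * ?e x \<partial>circ) + (- \<i> * of_int n) * (\<integral>x. f x * ?e x \<partial>circ)"
    using integrable_mult_cis[OF continuous_integrable_circ[OF f']] integrable_mult_cis[OF continuous_integrable_circ[OF fc]]
    by (subst Bochner_Integration.integral_add) (auto simp only: integral_mult_right_zero integrable_mult_right)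
  ultimately have "(\<integral>x. f' x * ?e x \<partial>circ) = \<i> * of_int n * (\<integral>x. f x * ?e x \<partial>circ)" by (simp add: algebra_simps)
  then show ?thesis by (simp add: fc_eq)
qed

lemma fc_real_minus: "fc (\<lambda>x. complex_of_real (f x)) (- n) = cnj (fc (\<lambda>x. complex_of_real (f x)) n)"
proof -
  have "cnj (\<integral>x. complex_of_real (f x) * cis (- (of_int n * x)) \<partial>circ) =
    (\<integral>x. cnj (complex_of_real (f x) * cis (- (of_int n * x))) \<partial>circ)" by (rule Bochner_Integration.integral_cnj[symmetric])
  then show ?thesis by (simp add: fc_eq cis_cnj)
qed

context
  fixes f :: "real \<Rightarrow> real" assumes f: "smooth_circle f"
begin

private abbreviation (input) D :: "nat \<Rightarrow> real \<Rightarrow> real" where "D k \<equiv> (deriv ^^ k) f"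

lemma smooth_deriv: "(D k has_real_derivative D (Suc k) x) (at x)"
proof -
  have "D k field_differentiable (at x)" using f unfolding smooth_circle_def by blast
  then show ?thesis using DERIV_deriv_iff_field_differentiable by fastforce
qed

lemma smooth_continuous: "continuous_on UNIV (D k)"
  using smooth_deriv by (auto intro!: continuous_at_imp_continuous_on DERIV_isCont)

lemma smooth_periodic: "D k (x + 2 * pi) = D k x"
proof (induction k arbitrary: x)
  case 0
  then show ?case using f by (simp add: smooth_circle_def circle_fun_def)
next
  case (Suc k)
  have "((\<lambda>y. D k (y + 2 * pi)) has_real_derivative D (Suc k) (x + 2 * pi)) (at x)"
    using smooth_deriv[of k "x + 2 * pi"] by (simp only: DERIV_shift)
  then have "(D k has_real_derivative D (Suc k) (x + 2 * pi)) (at x)" unfolding Suc .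
  then show ?case using smooth_deriv[of k x] by (rule DERIV_unique)
qed

lemma smooth_bounded: obtains M where "0 \<le> M" "\<And>x. x \<in> {0..2*pi} \<Longrightarrow> \<bar>D k x\<bar> \<le> M"
proof -
  have "compact (D k ` {0..2*pi})" by (intro compact_continuous_image continuous_on_subset[OF smooth_continuous]) auto
  then have "bounded (D k ` {0..2*pi})" by (rule compact_imp_bounded)
  then obtain M where "\<forall>x\<in>{0..2*pi}. norm (D k x) \<le> M" unfolding bounded_iff by auto
  then show ?thesis by (intro that[of "max 0 M"]) (auto simp: max_def dest: bspec intro: order.trans)
qed

lemma smooth_bounded_UNIV: obtains M where "\<And>x. \<bar>f x\<bar> \<le> M"
proof -
  obtain M where M: "\<And>x. x \<in> {0..2*pi} \<Longrightarrow> \<bar>f x\<bar> \<le> M" using smooth_bounded[of 0] by auto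
  have per: "f (x + real n * (2 * pi)) = f x" for n :: nat and x
  proof (induction n)
    case (Suc n)
    then show ?case using smooth_periodic[of 0 "x + real n * (2 * pi)"] by (simp add: algebra_simps)
  qed simp
  have per': "f (x + of_int n * (2 * pi)) = f x" for n :: int and x
  proof (cases "0 \<le> n")
    case True
    then show ?thesis using per[of x "nat n"] by simp
  next
    case False
    then show ?thesis using per[of "x + of_int n * (2 * pi)" "nat (- n)"] by simp
  qed
  have "\<bar>f x\<bar> \<le> M" for x
  proof -
    define m where "m = \<lfloor>x / (2 * pi)\<rfloor>"
    have "of_int m \<le> x / (2 * pi)" "x / (2 * pi) < of_int m + 1" unfolding m_def by linarith+
    then have "0 \<le> x - of_int m * (2 * pi)" "x - of_int m * (2 * pi) \<le> 2 * pi"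
      by (simp_all add: field_simps)
    then have "\<bar>f (x - of_int m * (2 * pi))\<bar> \<le> M" by (intro M) auto
    then show ?thesis using per'[of "x - of_int m * (2 * pi)" m] by simp
  qed
  then show ?thesis by (rule that)
qed

lemma fc_smooth: "fc (\<lambda>x. complex_of_real (D k x)) n = (\<i> * of_int n) ^ k * fc (\<lambda>x. complex_of_real (f x)) n"
proof (induction k)
  case (Suc k)
  have "fc (\<lambda>x. complex_of_real (D (Suc k) x)) n = \<i> * of_int n * fc (\<lambda>x. complex_of_real (D k x)) n"
  proof (rule fc_derivative)
    show "((\<lambda>x. complex_of_real (D k x)) has_vector_derivative complex_of_real (D (Suc k) x)) (at x)" for x
      using has_vector_derivative_of_real[OF smooth_deriv[of k x]] .
    show "continuous_on UNIV (\<lambda>x. complex_of_real (D (Suc k) x))" by (intro continuous_on_of_real smooth_continuous)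
    show "complex_of_real (D k (2 * pi)) = complex_of_real (D k 0)" using smooth_periodic[of k 0] by simp
  qed
  then show ?case using Suc by (simp only: power_Suc mult.assoc)
qed simp

lemma fc_smooth_decay:
  obtains M where "0 \<le> M" "\<And>n. cmod (fc (\<lambda>x. complex_of_real (f x)) n) * \<bar>real_of_int n\<bar> ^ k \<le> M"
proof -
  obtain M where M: "0 \<le> M" "\<And>x. x \<in> {0..2*pi} \<Longrightarrow> \<bar>D k x\<bar> \<le> M" using smooth_bounded by metis
  have "cmod (fc (\<lambda>x. complex_of_real (f x)) n) * \<bar>real_of_int n\<bar> ^ k \<le> M" for n
  proof -
    have "norm (fc (\<lambda>x. complex_of_real (D k x)) n) \<le> M"
      using M by (intro norm_fc_le) (auto intro!: AE_I2 simp: space_circ)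
    then show ?thesis unfolding fc_smooth by (simp add: norm_mult norm_power mult.commute)
  qed
  then show ?thesis using M(1) that by blast
qed

text \<open>With \<open>k\<close> at least \<open>s + 3\<close>, the decay of order \<open>k\<close>
  covers the power \<open>s + 1\<close> and two more, which make the sum comparable to that of
  \<open>1 / (1 + n\<^sup>2)\<close>. The bound \<open>M0\<close> of order zero takes care of
  \<open>n = 0\<close>.\<close>

lemma smooth_potential: assumes "1 \<le> s" obtains G where "potential (fc (\<lambda>x. complex_of_real (f x))) s G"
proof -
  let ?L = "fc (\<lambda>x. complex_of_real (f x))"
  obtain k :: nat where k: "s + 3 \<le> k" using real_arch_simple by blast
  obtain M0 where M0: "0 \<le> M0" "\<And>n. cmod (?L n) * \<bar>real_of_int n\<bar> ^ 0 \<le> M0" using fc_smooth_decay by metis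
  obtain Mk where Mk: "0 \<le> Mk" "\<And>n. cmod (?L n) * \<bar>real_of_int n\<bar> ^ k \<le> Mk" using fc_smooth_decay by metis
  let ?C = "2 ^ k * (M0 + Mk)"
  have le: "cmod (?L n) * (1 + \<bar>real_of_int n\<bar>) powr (s + 1) \<le> ?C * (1 / (1 + (real_of_int n)\<^sup>2))" for n
  proof -
    let ?a = "\<bar>real_of_int n\<bar>"
    have p: "0 < 1 + (real_of_int n)\<^sup>2" by (simp add: add_pos_nonneg)
    have "(1 + ?a) powr (s + 1) * (1 + (real_of_int n)\<^sup>2) \<le> (1 + ?a) powr (s + 1) * (1 + ?a) powr 2"
      by (intro mult_left_mono) (auto simp: powr_numeral power2_eq_square algebra_simps)
    also have "\<dots> = (1 + ?a) powr (s + 3)" by (subst powr_add[symmetric]) (simp add: add.commute)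
    also have "\<dots> \<le> (1 + ?a) powr k" using k by (intro powr_mono) auto
    also have "\<dots> = (1 + ?a) ^ k" by (simp add: powr_realpow)
    also have "\<dots> \<le> (2 * max 1 ?a) ^ k" by (intro power_mono) auto
    also have "\<dots> \<le> 2 ^ k * (?a ^ 0 + ?a ^ k)" unfolding power_mult_distrib by (intro mult_left_mono) (auto simp: max_def)
    finally have "cmod (?L n) * ((1 + ?a) powr (s + 1) * (1 + (real_of_int n)\<^sup>2)) \<le> cmod (?L n) * (2 ^ k * (?a ^ 0 + ?a ^ k))"
      by (rule mult_left_mono) simp
    also have "\<dots> = 2 ^ k * (cmod (?L n) * ?a ^ 0 + cmod (?L n) * ?a ^ k)" by (simp add: algebra_simps)
    also have "\<dots> \<le> ?C" using M0(2)[of n] Mk(2)[of n] by (intro mult_left_mono add_mono) auto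
    finally show ?thesis using p by (simp add: field_simps)
  qed
  have "potential ?L s (?C * 5)"
  proof
    fix A :: "int set" assume A: "finite A"
    have "(\<Sum>n\<in>A. cmod (?L n) * (1 + \<bar>real_of_int n\<bar>) powr (s + 1)) \<le> (\<Sum>n\<in>A. ?C * (1 / (1 + (real_of_int n)\<^sup>2)))"
      by (intro sum_mono le)
    also have "\<dots> = ?C * (\<Sum>n\<in>A. 1 / (1 + (real_of_int n)\<^sup>2))" by (simp add: sum_distrib_left)
    also have "\<dots> \<le> ?C * 5" using M0 Mk by (intro mult_left_mono sum_inverse_square_le_5 A) auto
    finally show "(\<Sum>n\<in>A. cmod (?L n) * (1 + \<bar>real_of_int n\<bar>) powr (s + 1)) \<le> ?C * 5" .
  qed (use assms fc_real_minus in auto)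
  then show ?thesis by (rule that)
qed

end

section \<open>Weak derivatives in terms of Fourier coefficients\<close>

lemma smooth_circle_trig: "smooth_circle (\<lambda>x. a * cos (of_int n * x) + b * sin (of_int n * x))"
proof -
  have d: "((\<lambda>x. a * cos (of_int n * x) + b * sin (of_int n * x)) has_real_derivative
     (b * of_int n) * cos (of_int n * x) + (- a * of_int n) * sin (of_int n * x)) (at x)" for a b x :: real
    by (auto intro!: derivative_eq_intros)
  have "\<exists>a' b'. (deriv ^^ k) (\<lambda>x. a * cos (of_int n * x) + b * sin (of_int n * x)) = (\<lambda>x. a' * cos (of_int n * x) + b' * sin (of_int n * x))" for k
  proof (induction k)
    case (Suc k)
    then obtain a' b' where eq: "(deriv ^^ k) (\<lambda>x. a * cos (of_int n * x) + b * sin (of_int n * x)) =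
      (\<lambda>x. a' * cos (of_int n * x) + b' * sin (of_int n * x))" by blast
    have "(deriv ^^ Suc k) (\<lambda>x. a * cos (of_int n * x) + b * sin (of_int n * x)) =
      (\<lambda>x. (b' * of_int n) * cos (of_int n * x) + (- a' * of_int n) * sin (of_int n * x))"
      unfolding funpow.simps comp_apply eq by (rule ext) (rule DERIV_imp_deriv[OF d])
    then show ?case by blast
  qed auto
  then have "(deriv ^^ k) (\<lambda>x. a * cos (of_int n * x) + b * sin (of_int n * x)) field_differentiable (at x)" for k x
    using d unfolding field_differentiable_def by metis
  moreover have "cos (of_int n * (x + 2 * pi)) = cos (of_int n * x)" "sin (of_int n * (x + 2 * pi)) = sin (of_int n * x)" for x
  proof -
    have "cis (of_int n * (x + 2 * pi)) = cis (of_int n * x)"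
      using cis_multiple_2pi[of "of_int n"] by (simp add: distrib_left cis_mult[symmetric] mult_ac)
    then show "cos (of_int n * (x + 2 * pi)) = cos (of_int n * x)" "sin (of_int n * (x + 2 * pi)) = sin (of_int n * x)"
      by (auto simp: complex_eq_iff)
  qed
  ultimately show ?thesis unfolding smooth_circle_def circle_fun_def by simp
qed

lemma integrable_mult_continuous:
  fixes h :: "real \<Rightarrow> complex" and k :: "real \<Rightarrow> real"
  assumes h: "integrable circ h" and k: "continuous_on UNIV k" "\<And>x. x \<in> {0..2*pi} \<Longrightarrow> \<bar>k x\<bar> \<le> M"
  shows "integrable circ (\<lambda>x. h x * of_real (k x))"
proof (rule Bochner_Integration.integrable_bound[OF integrable_mult_left[OF h, of "of_real M"]])
  have "(\<lambda>x. complex_of_real (k x)) \<in> borel_measurable borel"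
    by (intro borel_measurable_continuous_onI continuous_on_of_real k)
  then show "(\<lambda>x. h x * of_real (k x)) \<in> borel_measurable circ"
    by (intro borel_measurable_times borel_measurable_integrable[OF h] circ_measurable)
  show "AE x in circ. norm (h x * of_real (k x)) \<le> norm (h x * of_real M)"
  proof (rule AE_I2)
    fix x assume "x \<in> space circ"
    then have "\<bar>k x\<bar> \<le> M" unfolding space_circ by (rule k(2))
    then have "\<bar>k x\<bar> \<le> \<bar>M\<bar>" by linarith
    then show "norm (h x * of_real (k x)) \<le> norm (h x * of_real M)" by (simp add: norm_mult mult_left_mono)
  qed
qed

text \<open>Test functions are real valued, so the character is tested through its cosine and sine
  parts, and the two identities are recombined.\<close>

lemma fc_weak_deriv:
  assumes f: "integrable circ f" and g: "is_weak_deriv f g"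
  shows "fc g n = \<i> * of_int n * fc f n"
proof -
  have gi: "integrable circ g" using g by (intro L2_circle_integrable) (simp add: is_weak_deriv_def)
  let ?c = "\<lambda>x. cos (of_int n * x)" and ?s = "\<lambda>x. sin (of_int n * x)"
  have test: "(\<integral>x. h x * of_real (a * ?c x + b * ?s x) \<partial>circ) = of_real a * (\<integral>x. h x * of_real (?c x) \<partial>circ) + of_real b * (\<integral>x. h x * of_real (?s x) \<partial>circ)"
    and cs: "(\<integral>x. h x * cis (- (of_int n * x)) \<partial>circ) = (\<integral>x. h x * of_real (?c x) \<partial>circ) - \<i> * (\<integral>x. h x * of_real (?s x) \<partial>circ)"
    if h: "integrable circ h" for h :: "real \<Rightarrow> complex" and a b
  proof -
    have i: "integrable circ (\<lambda>x. h x * of_real (?c x))" "integrable circ (\<lambda>x. h x * of_real (?s x))"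
      by (rule integrable_mult_continuous[OF h, of _ 1], intro continuous_intros, simp)+
    have "(\<integral>x. h x * of_real (a * ?c x + b * ?s x) \<partial>circ) = (\<integral>x. of_real a * (h x * of_real (?c x)) + of_real b * (h x * of_real (?s x)) \<partial>circ)"
      by (intro Bochner_Integration.integral_cong refl) (simp add: algebra_simps)
    then show "(\<integral>x. h x * of_real (a * ?c x + b * ?s x) \<partial>circ) = of_real a * (\<integral>x. h x * of_real (?c x) \<partial>circ) + of_real b * (\<integral>x. h x * of_real (?s x) \<partial>circ)"
      using i by simp
    have "(\<integral>x. h x * cis (- (of_int n * x)) \<partial>circ) = (\<integral>x. h x * of_real (?c x) - \<i> * (h x * of_real (?s x)) \<partial>circ)"
      by (intro Bochner_Integration.integral_cong refl) (simp add: complex_eq_iff)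
    then show "(\<integral>x. h x * cis (- (of_int n * x)) \<partial>circ) = (\<integral>x. h x * of_real (?c x) \<partial>circ) - \<i> * (\<integral>x. h x * of_real (?s x) \<partial>circ)"
      using i by simp
  qed
  have w: "(\<integral>x. f x * of_real ((b * of_int n) * ?c x + (- a * of_int n) * ?s x) \<partial>circ) = - (\<integral>x. g x * of_real (a * ?c x + b * ?s x) \<partial>circ)" for a b
  proof -
    have "deriv (\<lambda>x. a * ?c x + b * ?s x) x = (b * of_int n) * ?c x + (- a * of_int n) * ?s x" for x
      by (rule DERIV_imp_deriv) (auto intro!: derivative_eq_intros)
    note d = this
    have "circle_integral (\<lambda>x. f x * of_real (deriv (\<lambda>x. a * ?c x + b * ?s x) x)) =
        - circle_integral (\<lambda>x. g x * of_real (a * ?c x + b * ?s x))"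
      using g smooth_circle_trig[of a n b] unfolding is_weak_deriv_def by blast
    then show ?thesis unfolding circle_integral_eq d .
  qed
  have "(\<integral>x. g x * cis (- (of_int n * x)) \<partial>circ) = \<i> * of_int n * (\<integral>x. f x * cis (- (of_int n * x)) \<partial>circ)"
  proof -
    have "of_int n * Fc = - Gs" "- of_int n * Fs = - Gc \<Longrightarrow> Gc - \<i> * Gs = \<i> * of_int n * (Fc - \<i> * Fs)"
      if "of_int n * Fc = - Gs" for Fc Fs Gc Gs :: complex
      using that by (simp_all add: algebra_simps)
    moreover have "of_int n * (\<integral>x. f x * of_real (?c x) \<partial>circ) = - (\<integral>x. g x * of_real (?s x) \<partial>circ)"
      using w[of 1 0] unfolding test[OF f] test[OF gi] by simp
    moreover have "- of_int n * (\<integral>x. f x * of_real (?s x) \<partial>circ) = - (\<integral>x. g x * of_real (?c x) \<partial>circ)"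
      using w[of 0 1] unfolding test[OF f] test[OF gi] by simp
    ultimately show ?thesis unfolding cs[OF f] cs[OF gi] by blast
  qed
  then show ?thesis by (simp add: fc_eq)
qed
lemma parseval_tpoly:
  assumes "finite A"
  shows "(\<integral>x. (cmod (tpoly A a x))\<^sup>2 \<partial>circ) = 2 * pi * (\<Sum>n\<in>A. (cmod (a n))\<^sup>2)"
proof -
  have "complex_of_real (\<integral>x. (cmod (tpoly A a x))\<^sup>2 \<partial>circ) = (\<integral>x. tpoly A a x * cnj (tpoly A a x) \<partial>circ)"
    unfolding integral_complex_of_real[symmetric] complex_norm_square ..
  also have "\<dots> = 2 * pi * (\<Sum>n\<in>A. cnj (a n) * fc (tpoly A a) n)" by (rule integral_mult_tpoly[OF tpoly_integrable])
  also have "(\<Sum>n\<in>A. cnj (a n) * fc (tpoly A a) n) = (\<Sum>n\<in>A. complex_of_real ((cmod (a n))\<^sup>2))"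
    using assms by (intro sum.cong refl) (simp only: fc_tpoly complex_norm_square mult.commute)
  also have "2 * pi * \<dots> = complex_of_real (2 * pi * (\<Sum>n\<in>A. (cmod (a n))\<^sup>2))" by simp
  finally show ?thesis by (simp only: of_real_eq_iff)
qed

lemma tpoly_deriv:
  "(tpoly A a has_vector_derivative tpoly A (\<lambda>n. \<i> * of_int n * a n) x) (at x)"
proof -
  have "((\<lambda>x. \<Sum>n\<in>A. a n * cis (of_int n * x)) has_vector_derivative
    (\<Sum>n\<in>A. a n * (\<i> * of_real (of_int n) * cis (of_int n * x)))) (at x)"
    by (intro has_vector_derivative_sum has_vector_derivative_mult_right has_vector_derivative_cis_mult)
  then show ?thesis unfolding tpoly_def[abs_def] by (simp add: mult_ac)
qed

lemma tpoly_continuous: "continuous_on UNIV (tpoly A a)"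
  unfolding tpoly_def[abs_def] by (intro continuous_intros)

lemma tpoly_periodic: "tpoly A a (x + 2 * pi) = tpoly A a x"
proof -
  have "cis (of_int n * (x + 2 * pi)) = cis (of_int n * x)" for n
    using cis_multiple_2pi[of "of_int n"] by (simp add: distrib_left cis_mult[symmetric] mult_ac)
  then show ?thesis by (simp add: tpoly_def)
qed

lemma integral_tpoly_parts:
  assumes "smooth_circle \<phi>"
  shows "(\<integral>x. tpoly A a x * of_real (deriv \<phi> x) \<partial>circ) =
    - (\<integral>x. tpoly A (\<lambda>n. \<i> * of_int n * a n) x * of_real (\<phi> x) \<partial>circ)"
proof -
  let ?b = "\<lambda>n. \<i> * of_int n * a n"
  have d: "(\<phi> has_real_derivative deriv \<phi> x) (at x)" for x using smooth_deriv[OF assms, of 0 x] by simp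
  have c: "continuous_on UNIV \<phi>" "continuous_on UNIV (deriv \<phi>)"
    using smooth_continuous[OF assms, of 0] smooth_continuous[OF assms, of 1] by simp_all
  have "(\<integral>x. tpoly A a x * of_real (deriv \<phi> x) + tpoly A ?b x * of_real (\<phi> x) \<partial>circ) = 0"
  proof (rule integral_circ_FTC)
    show "((\<lambda>x. tpoly A a x * of_real (\<phi> x)) has_vector_derivative
      (tpoly A a x * of_real (deriv \<phi> x) + tpoly A ?b x * of_real (\<phi> x))) (at x)" for x
      by (rule has_vector_derivative_mult[OF tpoly_deriv has_vector_derivative_of_real[OF d]])
    show "continuous_on UNIV (\<lambda>x. tpoly A a x * of_real (deriv \<phi> x) + tpoly A ?b x * of_real (\<phi> x))"
      by (intro continuous_intros tpoly_continuous c)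
    show "tpoly A a (2 * pi) * of_real (\<phi> (2 * pi)) = tpoly A a 0 * of_real (\<phi> 0)"
      using tpoly_periodic[of A a 0] smooth_periodic[OF assms, of 0 0] by simp
  qed
  moreover have "integrable circ (\<lambda>x. tpoly A a x * of_real (deriv \<phi> x))" "integrable circ (\<lambda>x. tpoly A ?b x * of_real (\<phi> x))"
    by (rule continuous_integrable_circ, intro continuous_intros tpoly_continuous c)+
  ultimately show ?thesis by (simp add: eq_neg_iff_add_eq_0)
qed

text \<open>Existence is what gives \<open>weak_deriv\<close>, a choice, its meaning. The argument
  is that of Riesz and Fischer: the differentiated partial sums converge almost everywhere along a
  rapidly converging subsequence, with a square integrable majorant that justifies passing to the
  limit in the integration by parts.\<close>

lemma weak_deriv_exists:
  assumes f: "f \<in> L2_circle" and \<beta>: "\<And>A. finite A \<Longrightarrow> (\<Sum>n\<in>A. (1 + (real_of_int n)\<^sup>2) * (cmod (fc f n))\<^sup>2) \<le> \<beta>\<^sup>2" "0 \<le> \<beta>"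
  shows "\<exists>g. is_weak_deriv f g"
proof -
  let ?c = "fc f"
  define b where "b n = \<i> * of_int n * ?c n" for n
  define q where "q n = (cmod (b n))\<^sup>2" for n
  have l1: "l1 ?c" by (rule h1_imp_l1(1)[OF \<beta>])
  have qle: "q n \<le> (1 + (real_of_int n)\<^sup>2) * (cmod (?c n))\<^sup>2" for n
    unfolding q_def b_def by (simp add: norm_mult power_mult_distrib mult_right_mono)
  have "sum q A \<le> \<beta>\<^sup>2" if "finite A" for A
    by (rule order.trans[OF sum_mono[OF qle] \<beta>(1)[OF that]])
  then have qs: "q summable_on UNIV"
    by (intro nonneg_bdd_above_summable_on) (auto simp: q_def intro!: bdd_aboveI[where M = "\<beta>\<^sup>2"])
  have "(\<lambda>L. sum q (modes L)) \<longlonglongrightarrow> infsum q UNIV" by (rule has_sum_modes[OF has_sum_infsum[OF qs]])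
  \<comment> \<open>The rate \<open>(1 / 16) ^ k\<close> leaves \<open>(1 / 4) ^ k\<close> after the
    weight \<open>4 ^ k\<close> in \<open>sk\<close>, so the integrals of the \<open>sk\<close>
    remain summable.\<close>
  then have "\<forall>k. \<exists>M. \<forall>L\<ge>M. norm (sum q (modes L) - infsum q UNIV) < (1 / 16) ^ k"
    by (intro allI LIMSEQ_D) simp_all
  then obtain M where "\<forall>k. \<forall>L\<ge>M k. norm (sum q (modes L) - infsum q UNIV) < (1 / 16) ^ k"
    unfolding choice_iff ..
  then have M: "norm (sum q (modes L) - infsum q UNIV) < (1 / 16) ^ k" if "M k \<le> L" for k L
    using that by blast
  \<comment> \<open>The sum makes \<open>L\<close> monotone and at least \<open>M k\<close>; the
    summand \<open>k\<close> makes it unbounded.\<close>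
  define L where "L k = k + (\<Sum>j\<le>k. M j)" for k
  have L: "k \<le> L k" "M k \<le> L k" "L k \<le> L (Suc k)" for k
    unfolding L_def using member_le_sum[of k "{..k}" M] by auto
  define gk where "gk k = psum b (L k)" for k
  define d where "d k x = gk (Suc k) x - gk k x" for k x
  have deq: "d k = tpoly (modes (L (Suc k)) - modes (L k)) b" for k
  proof
    fix x
    have "modes (L k) \<subseteq> modes (L (Suc k))" using L(3)[of k] by auto
    then show "d k x = tpoly (modes (L (Suc k)) - modes (L k)) b x"
      unfolding d_def gk_def tpoly_def by (subst sum_diff) auto
  qed
  \<comment> \<open>With this weight, finiteness of the sum over \<open>k\<close> at a point forces
    the increments \<open>d k x\<close> to decay there like \<open>(1 / 2) ^ k\<close>.\<close>
  define sk where "sk k x = 4 ^ k * (cmod (d k x))\<^sup>2" for k x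
  have dm: "d k \<in> borel_measurable circ" for k unfolding deq by (intro circ_measurable tpoly_measurable)
  have d2: "integrable circ (\<lambda>x. (cmod (d k x))\<^sup>2)" for k
  proof (rule integrable_circ_bounded)
    let ?A = "modes (L (Suc k)) - modes (L k)"
    show "(\<lambda>x. (cmod (d k x))\<^sup>2) \<in> borel_measurable circ"
      by (rule borel_measurable_power[OF measurable_compose[OF dm borel_measurable_norm]])
    show "AE x in circ. norm ((cmod (d k x))\<^sup>2) \<le> (\<Sum>n\<in>?A. cmod (b n))\<^sup>2"
      unfolding deq by (intro AE_I2) (simp add: norm_tpoly_le power_mono)
  qed
  have ski: "integrable circ (sk k)" for k unfolding sk_def[abs_def] by (intro integrable_mult_right d2)
  have skn: "0 \<le> sk k x" for k x by (simp add: sk_def)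
  have int_sk: "(\<integral>x. sk k x \<partial>circ) \<le> 2 * pi * (1 / 4) ^ k" for k
  proof -
    have sub: "modes (L k) \<subseteq> modes (L (Suc k))" using L(3)[of k] by auto
    have "(\<Sum>n\<in>modes (L (Suc k)) - modes (L k). q n) = sum q (modes (L (Suc k))) - sum q (modes (L k))"
      using sub by (intro sum_diff) auto
    also have "\<dots> \<le> infsum q UNIV - sum q (modes (L k))"
      using sum_le_infsum[OF qs, of "modes (L (Suc k))"] by (simp add: q_def)
    also have "\<dots> \<le> (1 / 16) ^ k" using M[OF L(2)[of k]] by (simp add: abs_if split: if_splits)
    finally have "(\<Sum>n\<in>modes (L (Suc k)) - modes (L k). q n) \<le> (1 / 16) ^ k" .
    then have "4 ^ k * (2 * pi * (\<Sum>n\<in>modes (L (Suc k)) - modes (L k). q n)) \<le> 4 ^ k * (2 * pi * (1 / 16) ^ k)"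
      by (intro mult_left_mono) auto
    also have "\<dots> = 2 * pi * (1 / 4) ^ k" by (simp add: power_mult_distrib[symmetric])
    finally show ?thesis unfolding sk_def deq q_def by (simp add: parseval_tpoly)
  qed
  have "AE x in circ. (\<Sum>k. ennreal (sk k x)) \<noteq> \<infinity>"
  proof (rule nn_integral_PInf_AE)
    have m: "(\<lambda>x. ennreal (sk k x)) \<in> borel_measurable circ" for k
      by (rule measurable_compose[OF borel_measurable_integrable[OF ski] measurable_ennreal])
    show "(\<lambda>x. \<Sum>k. ennreal (sk k x)) \<in> borel_measurable circ" by (rule borel_measurable_suminf_order[OF m])
    have "(\<integral>\<^sup>+x. (\<Sum>k. ennreal (sk k x)) \<partial>circ) = (\<Sum>k. \<integral>\<^sup>+x. ennreal (sk k x) \<partial>circ)"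
      by (rule nn_integral_suminf[OF m])
    also have "\<dots> = (\<Sum>k. ennreal (\<integral>x. sk k x \<partial>circ))"
      by (intro suminf_cong nn_integral_eq_integral ski AE_I2 skn)
    also have "\<dots> \<le> (\<Sum>k. ennreal (2 * pi * (1 / 4) ^ k))" by (intro suminf_le ennreal_leI int_sk) auto
    finally have le: "(\<integral>\<^sup>+x. (\<Sum>k. ennreal (sk k x)) \<partial>circ) \<le> (\<Sum>k. ennreal (2 * pi * (1 / 4) ^ k))" .
    have "summable (\<lambda>k. 2 * pi * (1 / 4 :: real) ^ k)" by (intro summable_mult summable_geometric) simp
    then have "(\<Sum>k. ennreal (2 * pi * (1 / 4) ^ k)) \<noteq> top" by (rule ennreal_suminf_neq_top) simp
    then show "(\<integral>\<^sup>+x. (\<Sum>k. ennreal (sk k x)) \<partial>circ) \<noteq> \<infinity>"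
      using le unfolding infinity_ennreal_def by (rule neq_top_trans)
  qed
  then have AEs: "AE x in circ. summable (\<lambda>k. sk k x)"
    by eventually_elim (intro summable_suminf_not_top skn, simp)
  define Sx where "Sx x = (\<Sum>k. sk k x)" for x
  have Si: "integrable circ Sx" unfolding Sx_def[abs_def]
  proof (rule integrable_suminf[OF ski])
    show "AE x in circ. summable (\<lambda>k. norm (sk k x))" using AEs by eventually_elim (simp add: skn)
    show "summable (\<lambda>k. \<integral>x. norm (sk k x) \<partial>circ)"
    proof (rule summable_comparison_test')
      show "summable (\<lambda>k. 2 * pi * (1 / 4 :: real) ^ k)" by (intro summable_mult summable_geometric) simp
      show "norm (\<integral>x. norm (sk k x) \<partial>circ) \<le> 2 * pi * (1 / 4) ^ k" if "0 \<le> k" for k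
        using int_sk[of k] Bochner_Integration.integral_nonneg[of circ "sk k"] by (simp add: skn)
    qed
  qed
  \<comment> \<open>The increments sum to at most \<open>2 * sqrt (Sx x)\<close> by the geometric
    series, so \<open>W\<close> dominates all \<open>gk k\<close> at once.\<close>
  define W where "W x = cmod (gk 0 x) + 2 * sqrt (Sx x)" for x
  have good: "AE x in circ. (\<forall>k. cmod (gk k x) \<le> W x) \<and> convergent (\<lambda>k. gk k x)"
    using AEs
  proof eventually_elim
    case (elim x)
    have dle: "cmod (d k x) \<le> sqrt (Sx x) * (1 / 2) ^ k" for k
    proof -
      have "sk k x \<le> Sx x" unfolding Sx_def using sum_le_suminf[OF elim, of "{k}"] by (simp add: skn)
      then have "(2 ^ k * cmod (d k x))\<^sup>2 \<le> Sx x"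
        unfolding sk_def by (simp add: power_mult_distrib power_mult[symmetric] mult.commute[of k 2] power_mult)
      then have "2 ^ k * cmod (d k x) \<le> sqrt (Sx x)" by (rule real_le_rsqrt)
      then show ?thesis by (simp add: power_one_over field_simps)
    qed
    have geo: "(\<lambda>k. (1 / 2 :: real) ^ k) sums 2" using geometric_sums[of "1 / 2 :: real"] by simp
    have sg: "summable (\<lambda>k. sqrt (Sx x) * (1 / 2) ^ k)" using geo by (intro summable_mult) (simp add: sums_iff)
    have tel: "gk k x = gk 0 x + (\<Sum>j<k. d j x)" for k by (induction k) (simp_all add: d_def)
    have sd: "summable (\<lambda>k. d k x)" by (rule summable_comparison_test'[OF sg]) (use dle in auto)
    have "convergent (\<lambda>k. gk 0 x + (\<Sum>j<k. d j x))"
      by (rule convergentI[OF tendsto_add[OF tendsto_const summable_LIMSEQ[OF sd]]])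
    moreover have "cmod (gk k x) \<le> W x" for k
    proof -
      have "cmod (\<Sum>j<k. d j x) \<le> (\<Sum>j<k. sqrt (Sx x) * (1 / 2) ^ j)" by (rule order.trans[OF norm_sum sum_mono[OF dle]])
      also have "\<dots> \<le> (\<Sum>j. sqrt (Sx x) * (1 / 2) ^ j)"
        using skn by (intro sum_le_suminf sg) (auto simp: Sx_def intro!: mult_nonneg_nonneg suminf_nonneg elim)
      also have "\<dots> = 2 * sqrt (Sx x)" using sums_mult[OF geo, of "sqrt (Sx x)"] by (simp add: sums_iff)
      finally show ?thesis unfolding tel[of k] W_def by (intro norm_triangle_le) auto
    qed
    ultimately show ?case unfolding tel[symmetric] by blast
  qed
  \<comment> \<open>Off the null set \<open>lim\<close> is the true limit. Measurability and
    periodicity of \<open>g\<close> hold everywhere, being inherited from the sequence.\<close>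
  define g where "g x = lim (\<lambda>k. gk k x)" for x
  have lim: "AE x in circ. (\<lambda>k. gk k x) \<longlonglongrightarrow> g x" using good by eventually_elim (simp add: g_def convergent_LIMSEQ_iff)
  have gm: "g \<in> borel_measurable borel"
    unfolding g_def[abs_def] gk_def by (intro borel_measurable_lim_metric tpoly_measurable)
  have g0i: "integrable circ (\<lambda>x. (cmod (gk 0 x))\<^sup>2)"
  proof (rule integrable_circ_bounded)
    show "(\<lambda>x. (cmod (gk 0 x))\<^sup>2) \<in> borel_measurable circ"
      unfolding gk_def by (rule borel_measurable_power[OF measurable_compose[OF circ_measurable[OF tpoly_measurable] borel_measurable_norm]])
    show "AE x in circ. norm ((cmod (gk 0 x))\<^sup>2) \<le> (\<Sum>n\<in>modes (L 0). cmod (b n))\<^sup>2"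
      unfolding gk_def by (intro AE_I2) (simp add: norm_tpoly_le power_mono)
  qed
  have gW: "AE x in circ. cmod (g x) \<le> W x"
    using good lim
  proof eventually_elim
    case (elim x)
    show ?case by (rule tendsto_upperbound[OF tendsto_norm[OF elim(2)]]) (use elim(1) in auto)
  qed
  have gL2: "g \<in> L2_circle"
  proof -
    have "integrable circ (\<lambda>x. (cmod (g x))\<^sup>2)"
    proof (rule Bochner_Integration.integrable_bound)
      show "integrable circ (\<lambda>x. 2 * (cmod (gk 0 x))\<^sup>2 + 8 * Sx x)"
        by (intro Bochner_Integration.integrable_add integrable_mult_right g0i Si)
      show "(\<lambda>x. (cmod (g x))\<^sup>2) \<in> borel_measurable circ"
        by (rule borel_measurable_power[OF measurable_compose[OF circ_measurable[OF gm] borel_measurable_norm]])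
      show "AE x in circ. norm ((cmod (g x))\<^sup>2) \<le> norm (2 * (cmod (gk 0 x))\<^sup>2 + 8 * Sx x)"
        using gW AEs
      proof eventually_elim
        case (elim x)
        have S0: "0 \<le> Sx x" unfolding Sx_def using elim(2) skn by (intro suminf_nonneg)
        have "(cmod (g x))\<^sup>2 \<le> (W x)\<^sup>2" using elim(1) by (intro power_mono) auto
        also have "\<dots> \<le> 2 * (cmod (gk 0 x))\<^sup>2 + 2 * (2 * sqrt (Sx x))\<^sup>2"
          unfolding W_def using zero_le_power2[of "cmod (gk 0 x) - 2 * sqrt (Sx x)"] by (simp add: power2_sum power2_diff)
        also have "\<dots> = 2 * (cmod (gk 0 x))\<^sup>2 + 8 * Sx x" using S0 by (simp add: power_mult_distrib)
        finally show ?case using S0 by simp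
      qed
    qed
    moreover have "circle_fun g" unfolding circle_fun_def g_def gk_def by (simp add: tpoly_periodic)
    ultimately show ?thesis using gm unfolding L2_circle_def by (simp add: circle_integrable_eq)
  qed
  have "is_weak_deriv f g" unfolding is_weak_deriv_def circle_integral_eq
  proof (intro conjI allI impI gL2)
    fix \<phi> assume \<phi>: "smooth_circle \<phi>"
    have c: "continuous_on UNIV \<phi>" "continuous_on UNIV (deriv \<phi>)"
      using smooth_continuous[OF \<phi>, of 0] smooth_continuous[OF \<phi>, of 1] by simp_all
    obtain M0 where M0: "0 \<le> M0" "\<And>x. x \<in> {0..2*pi} \<Longrightarrow> \<bar>\<phi> x\<bar> \<le> M0" using smooth_bounded[OF \<phi>, of 0] by auto
    obtain M1 where M1: "0 \<le> M1" "\<And>x. x \<in> {0..2*pi} \<Longrightarrow> \<bar>deriv \<phi> x\<bar> \<le> M1" using smooth_bounded[OF \<phi>, of 1] by auto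
    have cm: "(\<lambda>x. complex_of_real (\<phi> x)) \<in> borel_measurable circ" "(\<lambda>x. complex_of_real (deriv \<phi> x)) \<in> borel_measurable circ"
      by (intro circ_measurable borel_measurable_continuous_onI continuous_on_of_real c)+
    have 1: "(\<lambda>k. \<integral>x. psum ?c (L k) x * of_real (deriv \<phi> x) \<partial>circ) \<longlonglongrightarrow> (\<integral>x. ser ?c x * of_real (deriv \<phi> x) \<partial>circ)"
    proof (rule integral_dominated_convergence[where w = "\<lambda>x. infsum (\<lambda>n. cmod (?c n)) UNIV * M1"])
      show "(\<lambda>x. ser ?c x * of_real (deriv \<phi> x)) \<in> borel_measurable circ"
        by (rule borel_measurable_times[OF circ_measurable[OF ser_measurable[OF l1]] cm(2)])
      show "(\<lambda>x. psum ?c (L k) x * of_real (deriv \<phi> x)) \<in> borel_measurable circ" for k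
        by (rule borel_measurable_times[OF circ_measurable[OF tpoly_measurable] cm(2)])
      show "AE x in circ. (\<lambda>k. psum ?c (L k) x * of_real (deriv \<phi> x)) \<longlonglongrightarrow> ser ?c x * of_real (deriv \<phi> x)"
      proof (intro AE_I2 tendsto_mult_right)
        fix x
        have "filterlim L at_top sequentially"
          by (rule filterlim_at_top_mono[OF filterlim_ident]) (simp add: L)
        then show "(\<lambda>k. psum ?c (L k) x) \<longlonglongrightarrow> ser ?c x" by (rule filterlim_compose[OF psum_tendsto[OF l1]])
      qed
      show "AE x in circ. norm (psum ?c (L k) x * of_real (deriv \<phi> x)) \<le> infsum (\<lambda>n. cmod (?c n)) UNIV * M1" for k
      proof (rule AE_I2)
        fix x assume "x \<in> space circ"
        then show "norm (psum ?c (L k) x * of_real (deriv \<phi> x)) \<le> infsum (\<lambda>n. cmod (?c n)) UNIV * M1"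
          unfolding norm_mult norm_of_real space_circ
          by (intro mult_mono M1 order.trans[OF norm_tpoly_le sum_le_infsum[OF l1]] infsum_nonneg) auto
      qed
      show "integrable circ (\<lambda>x. infsum (\<lambda>n. cmod (?c n)) UNIV * M1)"
        by (rule finite_measure.integrable_const[OF finite_measure_circ])
    qed
    have 2: "(\<lambda>k. \<integral>x. gk k x * of_real (\<phi> x) \<partial>circ) \<longlonglongrightarrow> (\<integral>x. g x * of_real (\<phi> x) \<partial>circ)"
    proof (rule integral_dominated_convergence[where w = "\<lambda>x. (cmod (gk 0 x) + (2 + 2 * Sx x)) * M0"])
      show "(\<lambda>x. g x * of_real (\<phi> x)) \<in> borel_measurable circ" by (rule borel_measurable_times[OF circ_measurable[OF gm] cm(1)])
      show "(\<lambda>x. gk k x * of_real (\<phi> x)) \<in> borel_measurable circ" for k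
        unfolding gk_def by (rule borel_measurable_times[OF circ_measurable[OF tpoly_measurable] cm(1)])
      show "AE x in circ. (\<lambda>k. gk k x * of_real (\<phi> x)) \<longlonglongrightarrow> g x * of_real (\<phi> x)"
        using lim by eventually_elim (rule tendsto_mult_right)
      have "integrable circ (\<lambda>x. cmod (gk 0 x))" unfolding gk_def by (rule integrable_norm[OF tpoly_integrable])
      then show "integrable circ (\<lambda>x. (cmod (gk 0 x) + (2 + 2 * Sx x)) * M0)"
        using finite_measure.integrable_const[OF finite_measure_circ]
        by (intro integrable_mult_left Bochner_Integration.integrable_add integrable_mult_right Si)
      show "AE x in circ. norm (gk k x * of_real (\<phi> x)) \<le> (cmod (gk 0 x) + (2 + 2 * Sx x)) * M0" for k
        using good AEs AE_space[of circ]
      proof eventually_elim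
        case (elim x)
        have S0: "0 \<le> Sx x" unfolding Sx_def using elim(2) skn by (intro suminf_nonneg)
        have "sqrt (Sx x) \<le> 1 + Sx x" using S0 by (intro real_le_lsqrt) (auto simp: power2_eq_square algebra_simps)
        then have "W x \<le> cmod (gk 0 x) + (2 + 2 * Sx x)" by (simp add: W_def)
        then have "cmod (gk k x) \<le> cmod (gk 0 x) + (2 + 2 * Sx x)" using elim(1) by (meson order_trans)
        then show ?case using elim(3) S0 unfolding norm_mult norm_of_real space_circ by (intro mult_mono M0) auto
      qed
    qed
    have eq: "(\<integral>x. psum ?c (L k) x * of_real (deriv \<phi> x) \<partial>circ) = - (\<integral>x. gk k x * of_real (\<phi> x) \<partial>circ)" for k
      unfolding gk_def b_def[abs_def] by (rule integral_tpoly_parts[OF \<phi>])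
    have "(\<integral>x. ser ?c x * of_real (deriv \<phi> x) \<partial>circ) = - (\<integral>x. g x * of_real (\<phi> x) \<partial>circ)"
      using 1 tendsto_minus[OF 2] unfolding eq by (rule LIMSEQ_unique)
    moreover have "(\<integral>x. f x * of_real (deriv \<phi> x) \<partial>circ) = (\<integral>x. ser ?c x * of_real (deriv \<phi> x) \<partial>circ)"
    proof (rule integral_cong_AE)
      show "(\<lambda>x. f x * of_real (deriv \<phi> x)) \<in> borel_measurable circ"
        by (rule borel_measurable_times[OF L2_circle_measurable[OF f] cm(2)])
      show "(\<lambda>x. ser ?c x * of_real (deriv \<phi> x)) \<in> borel_measurable circ"
        by (rule borel_measurable_times[OF circ_measurable[OF ser_measurable[OF l1]] cm(2)])
      show "AE x in circ. f x * of_real (deriv \<phi> x) = ser ?c x * of_real (deriv \<phi> x)"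
        using fourier_inversion[OF L2_circle_integrable[OF f] l1] by eventually_elim simp
    qed
    ultimately show "(\<integral>x. f x * of_real (deriv \<phi> x) \<partial>circ) = - (\<integral>x. g x * of_real (\<phi> x) \<partial>circ)" by simp
  qed
  then show ?thesis by blast
qed
section \<open>Conservation of mass and energy\<close>

lemma h1_le_hnorm:
  assumes "1 \<le> s" "hs s a" "finite A"
  shows "(\<Sum>n\<in>A. (1 + (real_of_int n)\<^sup>2) * (cmod (a n))\<^sup>2) \<le> (2 * hnorm s a)\<^sup>2"
proof -
  have "(\<Sum>n\<in>A. (1 + (real_of_int n)\<^sup>2) * (cmod (a n))\<^sup>2) \<le> (\<Sum>n\<in>A. 2 * (weight 1 s n)\<^sup>2 * (cmod (a n))\<^sup>2)"
    by (intro sum_mono mult_right_mono bracket_le_weight_1 assms) auto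
  also have "\<dots> = 2 * (\<Sum>n\<in>A. (weight 1 s n * cmod (a n))\<^sup>2)"
    by (simp add: power_mult_distrib sum_distrib_left mult_ac)
  also have "\<dots> \<le> 2 * (hnorm s a)\<^sup>2" by (intro mult_left_mono sum_le_hnorm assms) auto
  also have "\<dots> \<le> (2 * hnorm s a)\<^sup>2" by (simp add: power_mult_distrib)
  finally show ?thesis .
qed

text \<open>By \<open>weak_deriv_exists\<close> the chosen \<open>weak_deriv f\<close> is a weak
  derivative, so its coefficients are \<open>\<i> * n\<close> times those of \<open>f\<close>, and
  Bessel's inequality applies to it.\<close>

lemma kinetic_ge:
  assumes "1 \<le> s" "f \<in> Hs_circle s" "finite A"
  shows "2 * pi * (\<Sum>n\<in>A. (real_of_int n)\<^sup>2 * (cmod (fc f n))\<^sup>2) \<le> (\<integral>x. (cmod (weak_deriv f x))\<^sup>2 \<partial>circ)"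
proof -
  have f: "f \<in> L2_circle" using assms(2) by (simp add: Hs_circle_def)
  have hs: "hs s (fc f)" using assms by (intro Hs_circle_hs) auto
  have w: "is_weak_deriv f (weak_deriv f)"
    unfolding weak_deriv_def using weak_deriv_exists[OF f h1_le_hnorm[OF assms(1) hs]] hnorm_nonneg[of s "fc f"]
    by (intro someI_ex[of "is_weak_deriv f"]) simp
  have "(\<Sum>n\<in>A. (real_of_int n)\<^sup>2 * (cmod (fc f n))\<^sup>2) = (\<Sum>n\<in>A. (cmod (fc (weak_deriv f) n))\<^sup>2)"
    unfolding fc_weak_deriv[OF L2_circle_integrable[OF f] w] by (simp add: norm_mult power_mult_distrib)
  then show ?thesis using bessel[of "weak_deriv f" A] w assms(3) by (simp add: is_weak_deriv_def)
qed

lemma mass_ge: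
  assumes "f \<in> L2_circle" "finite A" shows "2 * pi * (\<Sum>n\<in>A. (cmod (fc f n))\<^sup>2) \<le> mass f"
  unfolding mass_def circle_integral_eq by (rule bessel[OF assms])

context potential
begin

text \<open>On \<open>modes L\<close>, up to the factor \<open>2 * pi\<close>, the integral of
  \<open>lam * \<bar>p\<bar> ^ 4\<close> over the circle, where \<open>p\<close> is the
  trigonometric polynomial with coefficients \<open>a\<close>; see
  \<open>potential_energy_eq\<close>.\<close>

definition potential_energy :: "int set \<Rightarrow> (int \<Rightarrow> complex) \<Rightarrow> real" where
  "potential_energy S a = Re (\<Sum>n\<in>S. cnj (a n) * cubic \<Lambda> S a n)"

lemma potential_energy_quads: "(\<Sum>n\<in>S. cnj (a n) * cubic \<Lambda> S a n) = (\<Sum>(i,j,m,n)\<in>quads S. quartic \<Lambda> i j m n a)"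
  unfolding cubic_def quartic_def sum_distrib_left sum.cartesian_product
  by (rule sum.reindex_bij_witness[of _ "\<lambda>(a,b,m,n). (n,a,b,m)" "\<lambda>(n,a,b,m). (a,b,m,n)"])
     (auto simp: mult_ac)

text \<open>The product rule gives four sums. They agree in pairs by the exchange symmetries, and
  the two pairs are conjugate to each other by reversal and reality of the potential; the real part
  therefore collects a factor 4.\<close>

lemma potential_energy_deriv:
  fixes c :: "real \<Rightarrow> int \<Rightarrow> complex"
  assumes d: "\<And>n. n \<in> S \<Longrightarrow> ((\<lambda>t. c t n) has_vector_derivative \<delta> n) (at t)"
  shows "((\<lambda>t. potential_energy S (c t)) has_vector_derivative 4 * Re (\<Sum>n\<in>S. cnj (\<delta> n) * cubic \<Lambda> S (c t) n)) (at t)"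
proof -
  let ?c = "c t"
  let ?T = "\<lambda>f g h k. (\<Sum>(a,b,m,n)\<in>quads S. \<Lambda> (n + m - a - b) * (f a * g b * cnj (h m) * cnj (k n)))"
  have "((\<lambda>t. \<Sum>(i,j,m,n)\<in>quads S. quartic \<Lambda> i j m n (c t)) has_vector_derivative
    (\<Sum>(a,b,m,n)\<in>quads S. \<Lambda> (n + m - a - b) * (?c a * ?c b * cnj (?c m) * cnj (\<delta> n) + (?c a * ?c b * cnj (\<delta> m) + (?c a * \<delta> b + \<delta> a * ?c b) * cnj (?c m)) * cnj (?c n)))) (at t)"
    unfolding split_beta quartic_def
    by (intro has_vector_derivative_sum has_vector_derivative_mult_right has_vector_derivative_mult has_vector_derivative_cnj d) auto
  also have "(\<Sum>(a,b,m,n)\<in>quads S. \<Lambda> (n + m - a - b) * (?c a * ?c b * cnj (?c m) * cnj (\<delta> n) + (?c a * ?c b * cnj (\<delta> m) + (?c a * \<delta> b + \<delta> a * ?c b) * cnj (?c m)) * cnj (?c n))) =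
     ?T ?c ?c ?c \<delta> + ?T ?c ?c \<delta> ?c + ?T ?c \<delta> ?c ?c + ?T \<delta> ?c ?c ?c"
    unfolding sum.distrib[symmetric] by (intro sum.cong refl) (auto simp: algebra_simps)
  also have "?T ?c ?c \<delta> ?c = ?T ?c ?c ?c \<delta>"
    by (subst sum_quads_perm(2), intro sum.cong refl) (auto simp: algebra_simps)
  also have "?T ?c \<delta> ?c ?c = ?T \<delta> ?c ?c ?c"
    by (subst sum_quads_perm(1), intro sum.cong refl) (auto simp: algebra_simps)
  also have "?T \<delta> ?c ?c ?c = cnj (?T ?c ?c ?c \<delta>)"
  proof -
    have r: "\<Lambda> (a + b - n - m) = cnj (\<Lambda> (n + m - a - b))" for a b m n
      using reality[of "n + m - a - b"] by (simp add: algebra_simps)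
    have "?T \<delta> ?c ?c ?c = (\<Sum>(a,b,m,n)\<in>quads S. \<Lambda> (a + b - n - m) * (\<delta> n * ?c m * cnj (?c b) * cnj (?c a)))"
      by (rule sum_quads_perm(3))
    also have "\<dots> = cnj (?T ?c ?c ?c \<delta>)" unfolding cnj_sum
    proof (intro sum.cong refl, clarify)
      fix a b m n
      show "\<Lambda> (a + b - n - m) * (\<delta> n * ?c m * cnj (?c b) * cnj (?c a)) =
        cnj (\<Lambda> (n + m - a - b) * (?c a * ?c b * cnj (?c m) * cnj (\<delta> n)))"
        unfolding complex_cnj_mult complex_cnj_cnj r[of a b n m, symmetric] by (simp only: mult_ac)
    qed
    finally show ?thesis .
  qed
  also have "?T ?c ?c ?c \<delta> = (\<Sum>n\<in>S. cnj (\<delta> n) * cubic \<Lambda> S ?c n)"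
    unfolding cubic_def sum_distrib_left sum.cartesian_product
    by (rule sum.reindex_bij_witness[of _ "\<lambda>(n,a,b,m). (a,b,m,n)" "\<lambda>(a,b,m,n). (n,a,b,m)"])
       (auto simp: mult_ac)
  finally have "((\<lambda>t. \<Sum>(i,j,m,n)\<in>quads S. quartic \<Lambda> i j m n (c t)) has_vector_derivative
    ((\<Sum>n\<in>S. cnj (\<delta> n) * cubic \<Lambda> S ?c n) + (\<Sum>n\<in>S. cnj (\<delta> n) * cubic \<Lambda> S ?c n) +
    cnj (\<Sum>n\<in>S. cnj (\<delta> n) * cubic \<Lambda> S ?c n) + cnj (\<Sum>n\<in>S. cnj (\<delta> n) * cubic \<Lambda> S ?c n))) (at t)" .
  from bounded_linear.has_vector_derivative[OF bounded_linear_Re this]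
  show ?thesis unfolding potential_energy_def potential_energy_quads by (simp del: Re_sum cnj_sum)
qed

text \<open>Hamiltonian structure: \<open>n\<^sup>2 * c + cubic\<close> is both the gradient of the
  truncated energy and, up to the factor \<open>- \<i>\<close>, the velocity without error. These
  parts are orthogonal, so only the pairing of the gradient with \<open>e\<close> remains.\<close>

lemma energy_deriv:
  fixes c :: "real \<Rightarrow> int \<Rightarrow> complex"
  assumes d: "\<And>n. n \<in> S \<Longrightarrow> ((\<lambda>t. c t n) has_vector_derivative
      (- \<i> * (of_int n)\<^sup>2 * c t n - \<i> * (cubic \<Lambda> S (c t) n + e n))) (at t)"
  shows "((\<lambda>t. 1 / 2 * (\<Sum>n\<in>S. (real_of_int n)\<^sup>2 * (cmod (c t n))\<^sup>2) + 1 / 4 * potential_energy S (c t)) has_vector_derivative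
    Im (\<Sum>n\<in>S. ((of_int n)\<^sup>2 * cnj (c t n) + cnj (cubic \<Lambda> S (c t) n)) * e n)) (at t)"
proof -
  let ?F = "cubic \<Lambda> S (c t)"
  let ?\<delta> = "\<lambda>n. - \<i> * (of_int n)\<^sup>2 * c t n - \<i> * (?F n + e n)"
  have "((\<lambda>t. 1 / 2 * (\<Sum>n\<in>S. (real_of_int n)\<^sup>2 * (cmod (c t n))\<^sup>2) + 1 / 4 * potential_energy S (c t)) has_vector_derivative
    (1 / 2 * (2 * Im (\<Sum>n\<in>S. of_real ((real_of_int n)\<^sup>2) * (cnj (c t n) * (?F n + e n)))) +
     1 / 4 * (4 * Re (\<Sum>n\<in>S. cnj (?\<delta> n) * ?F n)))) (at t)"
    by (intro has_vector_derivative_add has_vector_derivative_mult_right square_sum_deriv potential_energy_deriv d)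
  also have "1 / 2 * (2 * Im (\<Sum>n\<in>S. of_real ((real_of_int n)\<^sup>2) * (cnj (c t n) * (?F n + e n)))) +
     1 / 4 * (4 * Re (\<Sum>n\<in>S. cnj (?\<delta> n) * ?F n)) =
     (\<Sum>n\<in>S. Im (of_real ((real_of_int n)\<^sup>2) * (cnj (c t n) * (?F n + e n))) + Re (cnj (?\<delta> n) * ?F n))"
  proof -
    have half: "1 / 2 * (2 * x) + 1 / 4 * (4 * y) = x + y" for x y :: real by simp
    show ?thesis unfolding half Im_sum Re_sum sum.distrib ..
  qed
  also have "\<dots> = (\<Sum>n\<in>S. Im (((of_int n)\<^sup>2 * cnj (c t n) + cnj (?F n)) * e n))"
  proof (rule sum.cong[OF refl])
    fix n
    have "Im (of_real k * (cnj z * (F + h))) + Re (cnj (- \<i> * of_real k * z - \<i> * (F + h)) * F) = Im ((of_real k * cnj z + cnj F) * h)"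
      for k z F h
      by (simp add: algebra_simps)
    from this[of "(real_of_int n)\<^sup>2" "c t n" "?F n" "e n"]
    show "Im (of_real ((real_of_int n)\<^sup>2) * (cnj (c t n) * (?F n + e n))) + Re (cnj (?\<delta> n) * ?F n) =
      Im (((of_int n)\<^sup>2 * cnj (c t n) + cnj (?F n)) * e n)" by simp
  qed
  finally show ?thesis by (simp only: Im_sum)
qed

end

context nls
begin

lemma potential_energy_eq: "2 * pi * potential_energy (modes L) a = (\<integral>x. lam x * (cmod (psum a L x)) ^ 4 \<partial>circ)"
  unfolding potential_energy_def by (rule integral_quartic[OF lam_integrable, symmetric])

text \<open>This is the defocusing sign: it lets the energy bound the kinetic part, already at the
  level of the truncation.\<close>

lemma potential_energy_nonneg: "0 \<le> potential_energy (modes L) a"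
proof -
  have "0 \<le> 2 * pi * potential_energy (modes L) a"
    unfolding potential_energy_eq
    by (rule Bochner_Integration.integral_nonneg) (rule mult_nonneg_nonneg[OF lam_nonneg zero_le_power[OF norm_ge_zero]])
  then have "0 \<le> (2 * pi * potential_energy (modes L) a) / (2 * pi)" by (rule divide_nonneg_pos) simp
  then show ?thesis by simp
qed

lemma potential_energy_tendsto:
  assumes f: "integrable circ f" "l1 (fc f)"
  shows "(\<lambda>L. 2 * pi * potential_energy (modes L) (fc f)) \<longlonglongrightarrow> (\<integral>x. lam x * (cmod (f x)) ^ 4 \<partial>circ)"
proof -
  let ?X = "infsum (\<lambda>n. cmod (fc f n)) UNIV"
  have m: "(\<lambda>x. lam x * (cmod (h x)) ^ 4) \<in> borel_measurable circ" if "h \<in> borel_measurable circ" for h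
    by (intro borel_measurable_times circ_measurable[OF lam_measurable] borel_measurable_power
        measurable_compose[OF that borel_measurable_norm])
  have "(\<lambda>L. \<integral>x. lam x * (cmod (psum (fc f) L x)) ^ 4 \<partial>circ) \<longlonglongrightarrow> (\<integral>x. lam x * (cmod (ser (fc f) x)) ^ 4 \<partial>circ)"
  proof (rule integral_dominated_convergence[where w = "\<lambda>_. B * ?X ^ 4"])
    show "(\<lambda>x. lam x * (cmod (ser (fc f) x)) ^ 4) \<in> borel_measurable circ"
      by (rule m[OF circ_measurable[OF ser_measurable[OF f(2)]]])
    show "(\<lambda>x. lam x * (cmod (psum (fc f) L x)) ^ 4) \<in> borel_measurable circ" for L
      by (rule m[OF circ_measurable[OF tpoly_measurable]])
    show "integrable circ (\<lambda>_. B * ?X ^ 4)" by (rule finite_measure.integrable_const[OF finite_measure_circ])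
    show "AE x in circ. (\<lambda>L. lam x * (cmod (psum (fc f) L x)) ^ 4) \<longlonglongrightarrow> lam x * (cmod (ser (fc f) x)) ^ 4"
      by (intro AE_I2 tendsto_mult_left tendsto_power tendsto_norm psum_tendsto f)
    show "AE x in circ. norm (lam x * (cmod (psum (fc f) L x)) ^ 4) \<le> B * ?X ^ 4" for L
    proof (rule AE_I2)
      fix x
      have "cmod (psum (fc f) L x) \<le> ?X" by (rule order.trans[OF norm_tpoly_le sum_le_infsum[OF f(2)]]) auto
      then have "lam x * (cmod (psum (fc f) L x)) ^ 4 \<le> B * ?X ^ 4"
        using B_nonneg lam_le by (intro mult_mono power_mono) auto
      then show "norm (lam x * (cmod (psum (fc f) L x)) ^ 4) \<le> B * ?X ^ 4" using lam_nonneg[of x] by simp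
    qed
  qed
  also have "(\<integral>x. lam x * (cmod (ser (fc f) x)) ^ 4 \<partial>circ) = (\<integral>x. lam x * (cmod (f x)) ^ 4 \<partial>circ)"
  proof (rule integral_cong_AE)
    show "(\<lambda>x. lam x * (cmod (ser (fc f) x)) ^ 4) \<in> borel_measurable circ"
      by (rule m[OF circ_measurable[OF ser_measurable[OF f(2)]]])
    show "(\<lambda>x. lam x * (cmod (f x)) ^ 4) \<in> borel_measurable circ" by (rule m[OF borel_measurable_integrable[OF f(1)]])
    show "AE x in circ. lam x * (cmod (ser (fc f) x)) ^ 4 = lam x * (cmod (f x)) ^ 4"
      using fourier_inversion[OF f] by eventually_elim simp
  qed
  finally show ?thesis unfolding potential_energy_eq .
qed

end

section \<open>Mass and energy bounds in the limit of the truncation\<close>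

context nls_flow
begin

definition err :: "nat \<Rightarrow> real \<Rightarrow> int \<Rightarrow> complex" where "err L t n = \<F> t n - F (c t) L n"

lemma c_deriv_truncated:
  "((\<lambda>t. c t n) has_vector_derivative (- \<i> * (of_int n)\<^sup>2 * c t n - \<i> * (F (c t) L n + err L t n))) (at t)"
  using c_deriv[of n t] by (simp add: err_def)

lemma err_le:
  "L2_set (\<lambda>n. weight 1 s n * cmod (err L t n)) (modes L) \<le> 324 * 4 powr s * G * (hnorm s (c t))\<^sup>2 * htail s (c t) L"
  unfolding err_def \<F>_def by (rule truncation_error[OF c_hs])

lemma c_0: "c 0 n = fc \<Phi> n"
  using duhamel[of 0 n]
  by (simp add: zero_ereal_def interval_lebesgue_integral_def einterval_same set_lebesgue_integral_def)

lemma htail_antimono: assumes "hs s a" "L \<le> M" shows "htail s a M \<le> htail s a L"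
  unfolding htail_def using assms(2) by (intro real_sqrt_le_mono diff_left_mono sum_mono2) auto

text \<open>A compactness argument of Dini type: the tail at \<open>r\<close> is small for one
  \<open>L\<close>, continuity in \<open>H\<^sup>s\<close> carries this to a neighbourhood of
  \<open>r\<close>, finitely many neighbourhoods cover the interval, and tails decrease in
  \<open>L\<close>.\<close>

lemma htail_uniform:
  assumes "0 < \<epsilon>" obtains L0 where "\<And>L t. L0 \<le> L \<Longrightarrow> t \<in> {p..q} \<Longrightarrow> htail s (c t) L \<le> \<epsilon>"
proof -
  have "\<exists>U L. open U \<and> r \<in> U \<and> (\<forall>t\<in>U. htail s (c t) L \<le> \<epsilon>)" for r
  proof -
    have "\<forall>\<^sub>F t in at r. hnorm s (\<lambda>n. c t n - c r n) < \<epsilon> / 2"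
      by (rule order_tendstoD(2)[OF c_continuous]) (use assms in simp)
    then obtain U where U: "open U" "r \<in> U" "\<And>t. t \<in> U \<Longrightarrow> t \<noteq> r \<Longrightarrow> hnorm s (\<lambda>n. c t n - c r n) < \<epsilon> / 2"
      unfolding eventually_at_topological by blast
    have "\<forall>\<^sub>F L in sequentially. htail s (c r) L < \<epsilon> / 2"
      by (rule order_tendstoD(2)[OF htail_tendsto[OF c_hs]]) (use assms in simp)
    then obtain L where L: "htail s (c r) L < \<epsilon> / 2" unfolding eventually_sequentially by blast
    have "htail s (c t) L \<le> \<epsilon>" if "t \<in> U" for t
    proof (cases "t = r")
      case True then show ?thesis using L assms by simp
    next
      case False
      then show ?thesis using U(3)[OF that] hnorm_diff(3)[OF c_hs[of t] c_hs[of r], of L] L by simp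
    qed
    then show ?thesis using U by blast
  qed
  then obtain U L where UL: "\<And>r. open (U r)" "\<And>r. r \<in> U r" "\<And>r t. t \<in> U r \<Longrightarrow> htail s (c t) (L r) \<le> \<epsilon>"
    by metis
  obtain R where R: "R \<subseteq> {p..q}" "finite R" "{p..q} \<subseteq> (\<Union>r\<in>R. U r)"
    using compactE_image[of "{p..q}" "{p..q}" U] UL by (metis UN_I compact_Icc subsetI)
  show ?thesis
  proof (rule that[of "Max (insert 0 (L ` R))"])
    fix M t assume M: "Max (insert 0 (L ` R)) \<le> M" "t \<in> {p..q}"
    then obtain r where r: "r \<in> R" "t \<in> U r" using R by blast
    have "L r \<le> Max (insert 0 (L ` R))" using r R by (intro Max_ge) auto
    then have "htail s (c t) M \<le> htail s (c t) (L r)" using M by (intro htail_antimono c_hs) simp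
    then show "htail s (c t) M \<le> \<epsilon>" using UL(3)[OF r(2)] by simp
  qed
qed

lemma drift_le:
  assumes d: "\<And>t. t \<in> {- T..T} \<Longrightarrow> (f has_vector_derivative f' t) (at t)"
    and b: "\<And>t. t \<in> {- T..T} \<Longrightarrow> \<bar>f' t\<bar> \<le> b" and t: "t \<in> {- T..T}"
  shows "\<bar>f t - f 0\<bar> \<le> b * (T :: real)"
proof -
  have "norm (f t - f 0) \<le> b * norm (t - 0)"
  proof (rule field_differentiable_bound[of "{- T..T}" f f'])
    show "(f has_field_derivative f' x) (at x within {- T..T})" if "x \<in> {- T..T}" for x
      using d[OF that] by (simp add: has_real_derivative_iff_has_vector_derivative has_vector_derivative_at_within)
  qed (use t b in auto)
  also have "\<dots> \<le> b * T" using t b[OF t] by (intro mult_left_mono) auto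
  finally show ?thesis by simp
qed

lemma err_uniform:
  assumes "0 < \<epsilon>"
  obtains L0 where "\<And>L t. L0 \<le> L \<Longrightarrow> t \<in> {- T..T} \<Longrightarrow> L2_set (\<lambda>n. weight 1 s n * cmod (err L t n)) (modes L) \<le> \<epsilon>"
proof -
  obtain R where R: "0 < R" "\<And>t. t \<in> {- T..T} \<Longrightarrow> hnorm s (c t) \<le> R" using hnorm_c_bounded by blast
  let ?C = "324 * 4 powr s * G * R\<^sup>2"
  have C: "0 \<le> ?C" using G_nonneg by simp
  obtain L0 where L0: "\<And>L t. L0 \<le> L \<Longrightarrow> t \<in> {- T..T} \<Longrightarrow> htail s (c t) L \<le> \<epsilon> / (?C + 1)"
    using htail_uniform[of "\<epsilon> / (?C + 1)"] assms C by (metis add_nonneg_pos divide_pos_pos zero_less_one)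
  show ?thesis
  proof (rule that[of L0])
    fix L t assume L: "L0 \<le> L" "t \<in> {- T..T}"
    have "L2_set (\<lambda>n. weight 1 s n * cmod (err L t n)) (modes L) \<le> 324 * 4 powr s * G * (hnorm s (c t))\<^sup>2 * htail s (c t) L"
      by (rule err_le)
    also have "\<dots> \<le> ?C * (\<epsilon> / (?C + 1))"
      using R(2)[OF L(2)] L0[OF L] hnorm_nonneg[of s "c t"] htail_nonneg[OF c_hs, of t L] G_nonneg
      by (intro mult_mono mult_left_mono power_mono) auto
    also have "\<dots> \<le> \<epsilon>" using C assms by (simp add: divide_le_eq field_simps)
    finally show "L2_set (\<lambda>n. weight 1 s n * cmod (err L t n)) (modes L) \<le> \<epsilon>" .
  qed
qed

lemma L2_set_pairing_le:
  "\<bar>Im (\<Sum>n\<in>A. g n * e n)\<bar> \<le> L2_set (\<lambda>n. cmod (g n)) A * L2_set (\<lambda>n. cmod (e n)) A"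
proof -
  have "\<bar>Im (\<Sum>n\<in>A. g n * e n)\<bar> \<le> (\<Sum>n\<in>A. \<bar>cmod (g n)\<bar> * \<bar>cmod (e n)\<bar>)"
    by (rule order.trans[OF abs_Im_le_cmod], rule order.trans[OF norm_sum]) (simp add: norm_mult)
  also have "\<dots> \<le> L2_set (\<lambda>n. cmod (g n)) A * L2_set (\<lambda>n. cmod (e n)) A" by (rule L2_set_mult_ineq)
  finally show ?thesis .
qed

lemma weight_1_ge: "1 \<le> weight 1 s n" "\<bar>real_of_int n\<bar> \<le> weight 1 s n"
proof -
  show "1 \<le> weight 1 s n" by (rule weight_ge_1[OF s_nonneg])
  have g: "1 \<le> grow 1 n" "\<bar>real_of_int n\<bar> \<le> grow 1 n" by (simp_all add: grow_def)
  have "grow 1 n powr 1 \<le> grow 1 n powr s" using g s_ge_1 by (intro powr_mono) auto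
  then show "\<bar>real_of_int n\<bar> \<le> weight 1 s n" using g by (simp add: weight_def)
qed

text \<open>The truncated mass changes only through the pairing of \<open>c\<close> with the error.
  On \<open>[- T, T]\<close> this drift is made arbitrarily small by a large \<open>L\<close>, and
  at time 0 Bessel's inequality bounds it by the mass of the data.\<close>

lemma mass_bound:
  assumes "finite A" shows "2 * pi * (\<Sum>n\<in>A. (cmod (c t n))\<^sup>2) \<le> mass \<Phi>"
proof (rule field_le_epsilon)
  fix \<epsilon> :: real assume \<epsilon>: "0 < \<epsilon>"
  define T where "T = \<bar>t\<bar> + 1"
  have t: "t \<in> {- T..T}" "0 < T" unfolding T_def by auto
  obtain R where R: "0 < R" "\<And>t. t \<in> {- T..T} \<Longrightarrow> hnorm s (c t) \<le> R" using hnorm_c_bounded by blast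
  \<comment> \<open>Makes the total drift \<open>2 * (R * \<eta>) * T\<close> equal to
    \<open>\<epsilon> / (2 * pi)\<close>.\<close>
  define \<eta> where "\<eta> = \<epsilon> / (4 * pi * R * T)"
  have \<eta>: "0 < \<eta>" unfolding \<eta>_def using \<epsilon> R t by simp
  obtain L0 where L0: "\<And>L t. L0 \<le> L \<Longrightarrow> t \<in> {- T..T} \<Longrightarrow> L2_set (\<lambda>n. weight 1 s n * cmod (err L t n)) (modes L) \<le> \<eta>"
    using err_uniform[OF \<eta>] by blast
  have "\<forall>\<^sub>F L in sequentially. finite (modes L) \<and> A \<subseteq> modes L \<and> modes L \<subseteq> UNIV"
    using filterlim_modes assms unfolding filterlim_finite_subsets_at_top by blast
  then have "\<forall>\<^sub>F L in sequentially. A \<subseteq> modes L \<and> L0 \<le> L"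
    using eventually_ge_at_top[of L0] by eventually_elim simp
  then obtain L where L: "A \<subseteq> modes L" "L0 \<le> L" unfolding eventually_sequentially by blast
  let ?f = "\<lambda>t. \<Sum>n\<in>modes L. 1 * (cmod (c t n))\<^sup>2"
  have "\<bar>?f t - ?f 0\<bar> \<le> 2 * (R * \<eta>) * T"
  proof (rule drift_le[OF square_sum_deriv[OF c_deriv_truncated] _ t(1)])
    fix r assume r: "r \<in> {- T..T}"
    have "Im (\<Sum>n\<in>modes L. of_real 1 * (cnj (c r n) * (F (c r) L n + err L r n))) = Im (\<Sum>n\<in>modes L. cnj (c r n) * err L r n)"
      using cubic_pairing_real[of "c r" "modes L"] by (simp add: distrib_left sum.distrib del: Im_sum)
    also have "\<bar>\<dots>\<bar> \<le> L2_set (\<lambda>n. cmod (cnj (c r n))) (modes L) * L2_set (\<lambda>n. cmod (err L r n)) (modes L)"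
      by (rule L2_set_pairing_le)
    also have "\<dots> \<le> R * \<eta>"
    proof (intro mult_mono)
      have "L2_set (\<lambda>n. cmod (cnj (c r n))) (modes L) \<le> L2_set (\<lambda>n. weight 1 s n * cmod (c r n)) (modes L)"
        using weight_1_ge(1) by (intro L2_set_mono) (simp_all add: mult_le_cancel_right1)
      then show "L2_set (\<lambda>n. cmod (cnj (c r n))) (modes L) \<le> R"
        using L2_set_le_hnorm[OF c_hs[of r], of "modes L"] R(2)[OF r] by simp
      have "L2_set (\<lambda>n. cmod (err L r n)) (modes L) \<le> L2_set (\<lambda>n. weight 1 s n * cmod (err L r n)) (modes L)"
        using weight_1_ge(1) by (intro L2_set_mono) (simp_all add: mult_le_cancel_right1)
      then show "L2_set (\<lambda>n. cmod (err L r n)) (modes L) \<le> \<eta>" using L0[OF L(2) r] by simp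
    qed (use R in auto)
    finally show "\<bar>2 * Im (\<Sum>n\<in>modes L. of_real 1 * (cnj (c r n) * (F (c r) L n + err L r n)))\<bar> \<le> 2 * (R * \<eta>)" by simp
  qed
  moreover have "2 * (R * \<eta>) * T = \<epsilon> / (2 * pi)" unfolding \<eta>_def using R(1) t(2) by (simp add: field_simps)
  ultimately have "?f t \<le> ?f 0 + \<epsilon> / (2 * pi)" by linarith
  moreover have "(\<Sum>n\<in>A. (cmod (c t n))\<^sup>2) \<le> ?f t" using L(1) by (simp add: sum_mono2)
  ultimately have "2 * pi * (\<Sum>n\<in>A. (cmod (c t n))\<^sup>2) \<le> 2 * pi * (?f 0 + \<epsilon> / (2 * pi))"
    by (intro mult_left_mono) auto
  also have "\<dots> = 2 * pi * (\<Sum>n\<in>modes L. (cmod (fc \<Phi> n))\<^sup>2) + \<epsilon>" by (simp add: c_0 distrib_left)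
  also have "\<dots> \<le> mass \<Phi> + \<epsilon>" using mass_ge[of \<Phi> "modes L"] data by (simp add: Hs_circle_def)
  finally show "2 * pi * (\<Sum>n\<in>A. (cmod (c t n))\<^sup>2) \<le> mass \<Phi> + \<epsilon>" .
qed

text \<open>Same scheme as for the mass. At time \<open>t\<close> the potential energy is dropped by
  its sign; at time 0 the truncated potential energy is within \<open>\<epsilon>\<close> of the true
  one for large \<open>L\<close>.\<close>

lemma energy_bound:
  assumes "finite A" shows "pi * (\<Sum>n\<in>A. (real_of_int n)\<^sup>2 * (cmod (c t n))\<^sup>2) \<le> energy lam \<Phi>"
proof (rule field_le_epsilon)
  fix \<epsilon> :: real assume \<epsilon>: "0 < \<epsilon>"
  define T where "T = \<bar>t\<bar> + 1"
  have t: "t \<in> {- T..T}" "0 < T" unfolding T_def by auto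
  obtain R where R: "0 < R" "\<And>t. t \<in> {- T..T} \<Longrightarrow> hnorm s (c t) \<le> R" using hnorm_c_bounded by blast
  define R' where "R' = R + 108 * 4 powr s * G * R ^ 3"
  have R': "0 < R'" unfolding R'_def using R G_nonneg by (intro add_pos_nonneg) auto
  define \<eta> where "\<eta> = \<epsilon> / (4 * pi * R' * T)"
  have \<eta>: "0 < \<eta>" unfolding \<eta>_def using \<epsilon> R' t by simp
  have \<Phi>i: "integrable circ \<Phi>" by (rule \<Phi>_integrable)
  have l1: "l1 (fc \<Phi>)" by (rule hs_l1(1)[OF s_ge_1 Hs_circle_hs[OF s_nonneg data]])
  let ?P = "\<integral>x. lam x * (cmod (\<Phi> x)) ^ 4 \<partial>circ"
  obtain L0 where L0: "\<And>L t. L0 \<le> L \<Longrightarrow> t \<in> {- T..T} \<Longrightarrow> L2_set (\<lambda>n. weight 1 s n * cmod (err L t n)) (modes L) \<le> \<eta>"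
    using err_uniform[OF \<eta>] by blast
  have "\<forall>\<^sub>F L in sequentially. finite (modes L) \<and> A \<subseteq> modes L \<and> modes L \<subseteq> UNIV"
    using filterlim_modes assms unfolding filterlim_finite_subsets_at_top by blast
  moreover have "\<forall>\<^sub>F L in sequentially. 2 * pi * potential_energy (modes L) (fc \<Phi>) < ?P + \<epsilon>"
    by (rule order_tendstoD(2)[OF potential_energy_tendsto[OF \<Phi>i l1]]) (use \<epsilon> in simp)
  ultimately have "\<forall>\<^sub>F L in sequentially. A \<subseteq> modes L \<and> L0 \<le> L \<and> 2 * pi * potential_energy (modes L) (fc \<Phi>) < ?P + \<epsilon>"
    using eventually_ge_at_top[of L0] by eventually_elim simp
  then obtain L where L: "A \<subseteq> modes L" "L0 \<le> L" "2 * pi * potential_energy (modes L) (fc \<Phi>) < ?P + \<epsilon>"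
    unfolding eventually_sequentially by blast
  let ?f = "\<lambda>t. 1 / 2 * (\<Sum>n\<in>modes L. (real_of_int n)\<^sup>2 * (cmod (c t n))\<^sup>2) + 1 / 4 * potential_energy (modes L) (c t)"
  have "\<bar>?f t - ?f 0\<bar> \<le> (R' * \<eta>) * T"
  proof (rule drift_le[OF energy_deriv[OF c_deriv_truncated] _ t(1)])
    fix r assume r: "r \<in> {- T..T}"
    have w0: "0 \<le> weight 1 s n" for n by (rule weight_nonneg)
    \<comment> \<open>For \<open>s < 2\<close> the sequence \<open>n\<^sup>2 * c n\<close> need not
      be square summable. One weight is therefore moved from the gradient to the error, which is
      small in the weighted norm; \<open>n\<^sup>2\<close> divided by the weight is at most the
      weight, since \<open>s\<close> is at least 1.\<close>
    have "(\<Sum>n\<in>modes L. ((of_int n)\<^sup>2 * cnj (c r n) + cnj (F (c r) L n)) * err L r n) =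
      (\<Sum>n\<in>modes L. ((of_int n)\<^sup>2 * cnj (c r n) + cnj (F (c r) L n)) / of_real (weight 1 s n) * (of_real (weight 1 s n) * err L r n))"
    proof (rule sum.cong[OF refl])
      fix n
      have "weight 1 s n \<noteq> 0" using weight_1_ge(1)[of n] by linarith
      then show "((of_int n)\<^sup>2 * cnj (c r n) + cnj (F (c r) L n)) * err L r n =
        ((of_int n)\<^sup>2 * cnj (c r n) + cnj (F (c r) L n)) / of_real (weight 1 s n) * (of_real (weight 1 s n) * err L r n)" by simp
    qed
    then have "\<bar>Im (\<Sum>n\<in>modes L. ((of_int n)\<^sup>2 * cnj (c r n) + cnj (F (c r) L n)) * err L r n)\<bar> \<le>
      L2_set (\<lambda>n. cmod (((of_int n)\<^sup>2 * cnj (c r n) + cnj (F (c r) L n)) / of_real (weight 1 s n))) (modes L) *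
      L2_set (\<lambda>n. cmod (of_real (weight 1 s n) * err L r n)) (modes L)"
      using L2_set_pairing_le by (simp only:)
    also have "\<dots> \<le> R' * \<eta>"
    proof (intro mult_mono)
      have "cmod (((of_int n)\<^sup>2 * cnj (c r n) + cnj (F (c r) L n)) / of_real (weight 1 s n)) \<le>
        weight 1 s n * cmod (c r n) + weight 1 s n * cmod (F (c r) L n)" for n
      proof -
        let ?w = "weight 1 s n"
        have w: "1 \<le> ?w" by (rule weight_1_ge)
        have w2: "1 \<le> ?w * ?w" using mult_mono[OF w w] w by simp
        have "(real_of_int n)\<^sup>2 \<le> ?w * ?w"
          using mult_mono[OF weight_1_ge(2) weight_1_ge(2), of n n] w by (simp add: power2_eq_square)
        then have "cmod ((of_int n)\<^sup>2 * cnj (c r n) + cnj (F (c r) L n)) \<le> ?w * ?w * cmod (c r n) + ?w * ?w * cmod (F (c r) L n)"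
          using w2 by (intro norm_triangle_le add_mono)
            (auto simp: norm_mult norm_power mult_right_mono mult_le_cancel_right1)
        also have "\<dots> = (?w * cmod (c r n) + ?w * cmod (F (c r) L n)) * ?w" by (simp add: algebra_simps)
        finally show ?thesis using w by (simp add: norm_divide divide_le_eq)
      qed
      then have "L2_set (\<lambda>n. cmod (((of_int n)\<^sup>2 * cnj (c r n) + cnj (F (c r) L n)) / of_real (weight 1 s n))) (modes L) \<le>
        L2_set (\<lambda>n. weight 1 s n * cmod (c r n) + weight 1 s n * cmod (F (c r) L n)) (modes L)"
        by (intro L2_set_mono) auto
      also have "\<dots> \<le> L2_set (\<lambda>n. weight 1 s n * cmod (c r n)) (modes L) + L2_set (\<lambda>n. weight 1 s n * cmod (F (c r) L n)) (modes L)"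
        by (rule L2_set_triangle_ineq)
      also have "\<dots> \<le> hnorm s (c r) + 108 * 4 powr s * G * hnorm s (c r) ^ 3"
        by (intro add_mono L2_set_le_hnorm F_le c_hs) auto
      also have "\<dots> \<le> R'" unfolding R'_def
        using R(2)[OF r] G_nonneg hnorm_nonneg by (intro add_mono mult_left_mono power_mono) auto
      finally show "L2_set (\<lambda>n. cmod (((of_int n)\<^sup>2 * cnj (c r n) + cnj (F (c r) L n)) / of_real (weight 1 s n))) (modes L) \<le> R'" .
      show "L2_set (\<lambda>n. cmod (of_real (weight 1 s n) * err L r n)) (modes L) \<le> \<eta>"
        using L0[OF L(2) r] by (simp add: norm_mult w0)
    qed (use R' in auto)
    finally show "\<bar>Im (\<Sum>n\<in>modes L. ((of_int n)\<^sup>2 * cnj (c r n) + cnj (F (c r) L n)) * err L r n)\<bar> \<le> R' * \<eta>" .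
  qed
  moreover have "R' * \<eta> * T = \<epsilon> / (4 * pi)" unfolding \<eta>_def using R' t(2) by (simp add: field_simps)
  ultimately have "?f t \<le> ?f 0 + \<epsilon> / (4 * pi)" by linarith
  moreover have "1 / 2 * (\<Sum>n\<in>A. (real_of_int n)\<^sup>2 * (cmod (c t n))\<^sup>2) \<le> ?f t"
    using potential_energy_nonneg[of L "c t"] sum_mono2[of "modes L" A "\<lambda>n. (real_of_int n)\<^sup>2 * (cmod (c t n))\<^sup>2"] L(1) by simp
  ultimately have "2 * pi * (1 / 2 * (\<Sum>n\<in>A. (real_of_int n)\<^sup>2 * (cmod (c t n))\<^sup>2)) \<le> 2 * pi * (?f 0 + \<epsilon> / (4 * pi))"
    by (intro mult_left_mono) auto
  also have "\<dots> = 1 / 2 * (2 * pi * (\<Sum>n\<in>modes L. (real_of_int n)\<^sup>2 * (cmod (fc \<Phi> n))\<^sup>2)) +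
      1 / 4 * (2 * pi * potential_energy (modes L) (fc \<Phi>)) + \<epsilon> / 2"
    by (simp add: c_0[abs_def] distrib_left)
  also have "\<dots> \<le> 1 / 2 * (\<integral>x. (cmod (weak_deriv \<Phi> x))\<^sup>2 \<partial>circ) + 1 / 4 * (?P + \<epsilon>) + \<epsilon> / 2"
    using L(3) by (intro add_mono mult_left_mono kinetic_ge[OF s_ge_1 data]) auto
  also have "\<dots> \<le> energy lam \<Phi> + \<epsilon>" unfolding energy_def circle_integral_eq using \<epsilon> by (simp add: field_simps)
  finally show "pi * (\<Sum>n\<in>A. (real_of_int n)\<^sup>2 * (cmod (c t n))\<^sup>2) \<le> energy lam \<Phi> + \<epsilon>" by simp
qed

lemma h1_bound:
  assumes "finite A"
  shows "(\<Sum>n\<in>A. (1 + (real_of_int n)\<^sup>2) * (cmod (c t n))\<^sup>2) \<le> (1 + \<bar>energy lam \<Phi>\<bar> + \<bar>mass \<Phi>\<bar>)\<^sup>2"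
proof -
  let ?m = "\<Sum>n\<in>A. (cmod (c t n))\<^sup>2" and ?k = "\<Sum>n\<in>A. (real_of_int n)\<^sup>2 * (cmod (c t n))\<^sup>2"
  have nn: "0 \<le> ?m" "0 \<le> ?k" by (auto intro: sum_nonneg)
  have "?m \<le> 2 * pi * ?m" "?k \<le> pi * ?k"
    using nn pi_gt3 by (auto simp: mult_le_cancel_right1)
  then have "?m + ?k \<le> \<bar>energy lam \<Phi>\<bar> + \<bar>mass \<Phi>\<bar>" using mass_bound[OF assms, of t] energy_bound[OF assms, of t] by linarith
  also have "\<dots> \<le> 1 + \<bar>energy lam \<Phi>\<bar> + \<bar>mass \<Phi>\<bar>" by simp
  also have "\<dots> \<le> (1 + \<bar>energy lam \<Phi>\<bar> + \<bar>mass \<Phi>\<bar>)\<^sup>2" by (rule self_le_power) auto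
  finally show ?thesis by (simp add: distrib_right sum.distrib)
qed

end

section \<open>Polynomial growth\<close>

lemma gronwall_forward:
  fixes Z :: "real \<Rightarrow> real"
  assumes d: "\<And>r. 0 \<le> r \<Longrightarrow> r \<le> t \<Longrightarrow> \<exists>D. (Z has_real_derivative D) (at r) \<and> D \<le> a * Z r + b"
    and "0 \<le> t" "0 \<le> a" "0 \<le> b"
  shows "Z t \<le> exp (a * t) * (Z 0 + b * t)"
proof -
  let ?W = "\<lambda>r. Z r * exp (- a * r) - b * r"
  have "?W t \<le> ?W 0"
  proof (rule DERIV_nonpos_imp_nonincreasing[OF assms(2)])
    fix r assume r: "0 \<le> r" "r \<le> t"
    then obtain D where D: "(Z has_real_derivative D) (at r)" "D \<le> a * Z r + b" using d by blast
    have "(?W has_real_derivative (D * exp (- a * r) + Z r * (- a * exp (- a * r)) - b)) (at r)"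
      by (auto intro!: derivative_eq_intros D(1))
    moreover have "D * exp (- a * r) + Z r * (- a * exp (- a * r)) - b \<le> 0"
    proof -
      have "exp (- a * r) \<le> 1" using r assms(3) by simp
      then have "b * exp (- a * r) \<le> b" using assms(4) by (simp add: mult_left_le)
      moreover have "(D - a * Z r) * exp (- a * r) \<le> b * exp (- a * r)" using D(2) by (intro mult_right_mono) auto
      ultimately show ?thesis by (simp add: algebra_simps)
    qed
    ultimately show "\<exists>y. (?W has_real_derivative y) (at r) \<and> y \<le> 0" by blast
  qed
  then have "exp (a * t) * (Z t * exp (- a * t)) \<le> exp (a * t) * (Z 0 + b * t)" by (intro mult_left_mono) auto
  moreover have "exp (a * t) * (Z t * exp (- a * t)) = Z t" by (simp add: exp_minus field_simps)
  ultimately show ?thesis by argo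
qed

text \<open>The bound on the absolute value of the derivative is invariant under time reversal,
  which reduces negative times to \<open>gronwall_forward\<close>.\<close>

lemma gronwall:
  fixes Z :: "real \<Rightarrow> real"
  assumes d: "\<And>r. \<exists>D. (Z has_real_derivative D) (at r) \<and> (r \<in> {- \<bar>t\<bar>..\<bar>t\<bar>} \<longrightarrow> \<bar>D\<bar> \<le> a * Z r + b)"
    and "0 \<le> a" "0 \<le> b"
  shows "Z t \<le> exp (a * \<bar>t\<bar>) * (Z 0 + b * \<bar>t\<bar>)"
proof (cases "0 \<le> t")
  case True
  have "\<exists>D. (Z has_real_derivative D) (at r) \<and> D \<le> a * Z r + b" if "0 \<le> r" "r \<le> t" for r
    using d[of r] that by fastforce
  then have "Z t \<le> exp (a * t) * (Z 0 + b * t)" by (intro gronwall_forward True assms)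
  then show ?thesis using True by simp
next
  case False
  have "\<exists>D. ((\<lambda>r. Z (- r)) has_real_derivative D) (at r) \<and> D \<le> a * Z (- r) + b" if "0 \<le> r" "r \<le> - t" for r
  proof -
    have "- r \<in> {- \<bar>t\<bar>..\<bar>t\<bar>}" using that False by auto
    then obtain D where D: "(Z has_real_derivative D) (at (- r))" "\<bar>D\<bar> \<le> a * Z (- r) + b"
      using d[of "- r"] by blast
    have "((\<lambda>r. Z (- r)) has_real_derivative (D * (- 1))) (at r)"
      by (rule DERIV_chain2[where f = Z and g = uminus, OF D(1)]) (auto intro!: derivative_eq_intros)
    then show ?thesis using D(2) by (intro exI[of _ "D * (- 1)"]) auto
  qed
  from gronwall_forward[of "- t" "\<lambda>r. Z (- r)", OF this] show ?thesis using False assms by simp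
qed

context nls_flow
begin

text \<open>The condition on \<open>K\<close> says \<open>\<delta> * (1 + T) \<le> 1 / 2\<close>.
  Its first half, \<open>\<delta> \<le> 1 / 2\<close>, makes the modified square \<open>Z\<close>
  equivalent to \<open>Q\<close>, with \<open>Q \<le> 2 * Z\<close> and
  \<open>Z \<le> 3 / 2 * Q\<close>; its second half keeps the Gronwall exponent
  \<open>2 * \<delta> * T\<close> below 1. Hence the square grows by at most
  \<open>2 * (3 / 2) * exp 1 \<le> 9\<close>.\<close>

theorem weighted_growth:
  fixes K :: nat
  defines "\<beta> \<equiv> 1 + \<bar>energy lam \<Phi>\<bar> + \<bar>mass \<Phi>\<bar>"
  assumes K: "1 \<le> K" "2 * growth_const * \<beta> ^ 4 * (1 + \<bar>t\<bar>) \<le> sqrt K" and A: "finite A"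
  shows "L2_set (\<lambda>n. weight (10 * real K) s n * cmod (c t n)) A \<le> 3 * (Hs_norm s \<Phi> / (2 * pi))"
proof -
  let ?g = growth_const and ?w = "weight (10 * real K) s"
  let ?Q = "\<lambda>L r. \<Sum>n\<in>modes L. (?w n)\<^sup>2 * (cmod (c r n))\<^sup>2"
  let ?H = "(Hs_norm s \<Phi> / (2 * pi))\<^sup>2"
  define \<delta> where "\<delta> = ?g * \<beta> ^ 4 / sqrt K"
  define T where "T = \<bar>t\<bar>"
  have T: "0 \<le> T" "t \<in> {- T..T}" unfolding T_def by auto
  have \<beta>: "1 \<le> \<beta>" unfolding \<beta>_def by simp
  have g: "3 \<le> ?g" by (rule growth_const_ge)
  have sK: "0 < sqrt K" using K(1) by simp
  have \<delta>0: "0 \<le> \<delta>" unfolding \<delta>_def using g \<beta> by simp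
  have "\<delta> * (1 + T) \<le> 1 / 2" using K(2) sK unfolding \<delta>_def T_def by (simp add: field_simps)
  then have "\<delta> + \<delta> * T \<le> 1 / 2" by (simp add: distrib_left)
  then have \<delta>: "\<delta> \<le> 1 / 2" "\<delta> * T \<le> 1 / 2" using \<delta>0 mult_nonneg_nonneg[OF \<delta>0 T(1)] by linarith+
  have N: "1 \<le> 10 * real K" using K(1) by simp
  have Q0: "?Q L 0 \<le> ?H" for L
  proof -
    have "2 * pi * L2_set (\<lambda>n. ?w n * cmod (fc \<Phi> n)) (modes L) \<le> Hs_norm s \<Phi>"
      using data by (intro weight_sum_le_Hs_norm[OF N s_nonneg]) (auto simp: Hs_circle_def)
    then have "L2_set (\<lambda>n. ?w n * cmod (fc \<Phi> n)) (modes L) \<le> Hs_norm s \<Phi> / (2 * pi)" by (simp add: field_simps)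
    then have "(L2_set (\<lambda>n. ?w n * cmod (c 0 n)) (modes L))\<^sup>2 \<le> ?H" unfolding c_0 by (intro power_mono) auto
    then show ?thesis unfolding weighted_square_eq .
  qed
  have Qn: "0 \<le> ?Q L r" for L r by (intro sum_nonneg) simp
  \<comment> \<open>The truncation \<open>L\<close> depends on \<open>\<epsilon>\<close> but does
    not occur in this estimate, so \<open>\<epsilon>\<close> can be sent to 0 afterwards.\<close>
  have main: "(L2_set (\<lambda>n. ?w n * cmod (c t n)) A)\<^sup>2 \<le> 2 * (exp (2 * \<delta> * T + 2 * \<epsilon> * T) * (3 / 2 * ?H + \<epsilon> * T))" if \<epsilon>: "0 < \<epsilon>" for \<epsilon>
  proof -
    \<comment> \<open>The 6 is the price in \<open>weighted_l1_le\<close> for bounding the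
      \<open>\<ell>\<^sup>1\<close> norm of the error by its weighted norm; the error term in the
      rate then has coefficient at most \<open>\<epsilon>\<close>.\<close>
    define \<eta> where "\<eta> = \<epsilon> / (6 * (?g * \<beta>\<^sup>2))"
    have \<eta>: "0 < \<eta>" unfolding \<eta>_def using \<epsilon> g \<beta> by simp
    obtain L0 where L0: "\<And>L r. L0 \<le> L \<Longrightarrow> r \<in> {- T..T} \<Longrightarrow> L2_set (\<lambda>n. weight 1 s n * cmod (err L r n)) (modes L) \<le> \<eta>"
      using err_uniform[OF \<eta>] by blast
    have "\<forall>\<^sub>F L in sequentially. finite (modes L) \<and> A \<subseteq> modes L \<and> modes L \<subseteq> UNIV"
      using filterlim_modes A unfolding filterlim_finite_subsets_at_top by blast
    then have "\<forall>\<^sub>F L in sequentially. A \<subseteq> modes L \<and> L0 \<le> L"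
      using eventually_ge_at_top[of L0] by eventually_elim simp
    then obtain L where L: "A \<subseteq> modes L" "L0 \<le> L" unfolding eventually_sequentially by blast
    let ?Z = "\<lambda>r. modified_square K (modes L) (c r)"
    have close: "\<bar>?Z r - ?Q L r\<bar> \<le> \<delta> * ?Q L r" for r
      unfolding \<delta>_def by (rule modified_square_close[OF K(1) _ \<beta> h1_bound[folded \<beta>_def]]) auto
    have half: "\<delta> * ?Q L r \<le> 1 / 2 * ?Q L r" for r by (rule mult_right_mono[OF \<delta>(1) Qn])
    have QZ: "?Q L r \<le> 2 * ?Z r" "?Z r \<le> 3 / 2 * ?Q L r" for r using close[of r] half[of r] by linarith+
    have der: "\<exists>D. (?Z has_real_derivative D) (at r) \<and> (r \<in> {- \<bar>t\<bar>..\<bar>t\<bar>} \<longrightarrow> \<bar>D\<bar> \<le> (2 * \<delta> + 2 * \<epsilon>) * ?Z r + \<epsilon>)" for r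
    proof -
      define \<eta>' where "\<eta>' = 6 * L2_set (\<lambda>n. weight 1 s n * cmod (err L r n)) (modes L)"
      have e1: "(\<Sum>n\<in>modes L. cmod (err L r n)) \<le> \<eta>'" unfolding \<eta>'_def by (rule weighted_l1_le[OF s_ge_1]) simp
      have w: "?w n \<le> weight 1 s n" for n
      proof -
        have "grow (10 * real K) n \<le> grow 1 n"
          unfolding grow_def using N divide_left_mono[of 1 "10 * real K" "\<bar>real_of_int n\<bar>"] by auto
        then show ?thesis unfolding weight_def using grow_ge_1[of "10 * real K" n] s_nonneg by (intro powr_mono2) auto
      qed
      have "L2_set (\<lambda>n. ?w n * cmod (err L r n)) (modes L) \<le> L2_set (\<lambda>n. weight 1 s n * cmod (err L r n)) (modes L)"
        by (intro L2_set_mono mult_right_mono w mult_nonneg_nonneg weight_nonneg) auto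
      then have e2: "L2_set (\<lambda>n. ?w n * cmod (err L r n)) (modes L) \<le> \<eta>'"
        unfolding \<eta>'_def using L2_set_nonneg[of "\<lambda>n. weight 1 s n * cmod (err L r n)" "modes L"] by linarith
      obtain D where D: "(?Z has_real_derivative D) (at r)"
        "\<bar>D\<bar> \<le> ?g * \<beta> ^ 4 / sqrt K * ?Q L r + ?g * \<beta>\<^sup>2 * \<eta>' * (1 + ?Q L r)"
        using growth_rate[OF c_deriv_truncated K(1) _ \<beta> h1_bound[folded \<beta>_def] e1 e2] by auto
      have "\<bar>D\<bar> \<le> (2 * \<delta> + 2 * \<epsilon>) * ?Z r + \<epsilon>" if "r \<in> {- \<bar>t\<bar>..\<bar>t\<bar>}"
      proof -
        have "\<eta>' \<le> 6 * \<eta>" unfolding \<eta>'_def using L0[OF L(2), of r] that by (simp add: T_def)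
        then have "?g * \<beta>\<^sup>2 * \<eta>' \<le> ?g * \<beta>\<^sup>2 * (6 * \<eta>)" using g by (intro mult_left_mono) auto
        also have "\<dots> = \<epsilon>" unfolding \<eta>_def using g \<beta> by simp
        finally have "?g * \<beta>\<^sup>2 * \<eta>' * (1 + ?Q L r) \<le> \<epsilon> * (1 + ?Q L r)" using Qn[of r L] by (intro mult_right_mono) auto
        moreover have "?g * \<beta> ^ 4 / sqrt K * ?Q L r = \<delta> * ?Q L r" by (simp add: \<delta>_def)
        ultimately have "\<bar>D\<bar> \<le> \<delta> * ?Q L r + \<epsilon> * (1 + ?Q L r)" using D(2) by linarith
        also have "\<dots> \<le> \<delta> * (2 * ?Z r) + \<epsilon> * (1 + 2 * ?Z r)"
          using QZ(1)[of r] \<delta>0 \<epsilon> by (intro add_mono mult_left_mono) auto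
        finally show ?thesis by (simp add: algebra_simps)
      qed
      then show ?thesis using D(1) by blast
    qed
    have "(L2_set (\<lambda>n. ?w n * cmod (c t n)) A)\<^sup>2 = (\<Sum>n\<in>A. (?w n)\<^sup>2 * (cmod (c t n))\<^sup>2)" by (rule weighted_square_eq[symmetric])
    also have "\<dots> \<le> ?Q L t" using L(1) by (intro sum_mono2) auto
    also have "\<dots> \<le> 2 * ?Z t" by (rule QZ)
    also have "?Z t \<le> exp ((2 * \<delta> + 2 * \<epsilon>) * \<bar>t\<bar>) * (?Z 0 + \<epsilon> * \<bar>t\<bar>)"
      using gronwall[OF der] \<delta>0 \<epsilon> by simp
    also have "\<dots> \<le> exp ((2 * \<delta> + 2 * \<epsilon>) * \<bar>t\<bar>) * (3 / 2 * ?H + \<epsilon> * \<bar>t\<bar>)"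
      using QZ(2)[of 0] Q0[of L] by (intro mult_left_mono add_right_mono) auto
    finally show ?thesis by (simp add: T_def distrib_right)
  qed
  have "(L2_set (\<lambda>n. ?w n * cmod (c t n)) A)\<^sup>2 \<le> 2 * (exp (2 * \<delta> * T + 2 * 0 * T) * (3 / 2 * ?H + 0 * T))"
  proof (rule tendsto_lowerbound)
    show "((\<lambda>\<epsilon>. 2 * (exp (2 * \<delta> * T + 2 * \<epsilon> * T) * (3 / 2 * ?H + \<epsilon> * T))) \<longlongrightarrow> 2 * (exp (2 * \<delta> * T + 2 * 0 * T) * (3 / 2 * ?H + 0 * T))) (at_right 0)"
      by (intro tendsto_intros)
    show "\<forall>\<^sub>F \<epsilon> in at_right 0. (L2_set (\<lambda>n. ?w n * cmod (c t n)) A)\<^sup>2 \<le> 2 * (exp (2 * \<delta> * T + 2 * \<epsilon> * T) * (3 / 2 * ?H + \<epsilon> * T))"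
      unfolding eventually_at_right_field using main by (intro exI[of _ 1]) auto
  qed simp
  also have "\<dots> = exp (2 * \<delta> * T) * (3 * ?H)" by simp
  also have "\<dots> \<le> 3 * (3 * ?H)"
  proof (intro mult_right_mono)
    have "exp (2 * \<delta> * T) \<le> exp 1" using \<delta>(2) by simp
    then show "exp (2 * \<delta> * T) \<le> 3" using exp_le by linarith
  qed simp
  also have "\<dots> = (3 * (Hs_norm s \<Phi> / (2 * pi)))\<^sup>2" by (simp add: power2_eq_square)
  finally show ?thesis
  proof (rule power2_le_imp_le)
    have "0 \<le> Hs_norm s \<Phi>" unfolding Hs_norm_def by (intro real_sqrt_ge_zero infsum_nonneg) simp
    then show "0 \<le> 3 * (Hs_norm s \<Phi> / (2 * pi))" by simp
  qed
qed

text \<open>The constant is \<open>160 = 20 * 2 * 4\<close>: 20 from \<open>2 * N\<close> with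
  \<open>N = 10 * K\<close>, 2 from rounding \<open>y\<^sup>2\<close> up to the integer
  \<open>K\<close>, and 4 from the square of the 2 in \<open>y\<close>. Squaring
  \<open>\<beta> ^ 4\<close> gives the eighth power.\<close>

theorem Hs_growth:
  "Hs_norm s (u t) \<le> 3 * (160 * growth_const\<^sup>2 * (1 + \<bar>energy lam \<Phi>\<bar> + \<bar>mass \<Phi>\<bar>) ^ 8) powr s *
     (1 + \<bar>t\<bar>) powr (2 * s) * Hs_norm s \<Phi>"
proof -
  define \<beta> where "\<beta> = 1 + \<bar>energy lam \<Phi>\<bar> + \<bar>mass \<Phi>\<bar>"
  let ?g = growth_const
  define y where "y = 2 * ?g * \<beta> ^ 4 * (1 + \<bar>t\<bar>)"
  define K where "K = nat \<lceil>y\<^sup>2\<rceil>"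
  have \<beta>: "1 \<le> \<beta>" unfolding \<beta>_def by simp
  have g: "3 \<le> ?g" by (rule growth_const_ge)
  have "1 * 1 \<le> (2 * ?g * \<beta> ^ 4) * (1 + \<bar>t\<bar>)"
    using g one_le_power[OF \<beta>, of 4] mult_mono[of 1 "2 * ?g" 1 "\<beta> ^ 4"] by (intro mult_mono) auto
  then have y: "1 \<le> y" unfolding y_def by simp
  then have y2: "1 \<le> y\<^sup>2" by (rule one_le_power)
  have K: "y\<^sup>2 \<le> K" "K \<le> y\<^sup>2 + 1" unfolding K_def using y2 by linarith+
  have K1: "1 \<le> K" using K(1) y2 by (metis of_nat_1 of_nat_le_iff order_trans)
  have "sqrt (y\<^sup>2) \<le> sqrt K" using K(1) by (rule real_sqrt_le_mono)
  then have yK: "y \<le> sqrt K" using y by simp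
  have "Hs_norm s (u t) \<le> 2 * pi * (2 * (10 * real K)) powr s * (3 * (Hs_norm s \<Phi> / (2 * pi)))"
  proof (rule Hs_norm_le)
    show "1 \<le> 10 * real K" using K1 by simp
    show "0 \<le> s" by (rule s_nonneg)
    show "L2_set (\<lambda>n. weight (10 * real K) s n * cmod (fc (u t) n)) A \<le> 3 * (Hs_norm s \<Phi> / (2 * pi))" if "finite A" for A
      using weighted_growth[OF K1 _ that, of t] yK unfolding y_def \<beta>_def c_def by simp
    show "(\<lambda>n. (cmod (fourier_coeff (u t) n))\<^sup>2 * japanese_bracket n powr (2 * s)) summable_on UNIV"
      using u_Hs[of t] by (simp add: Hs_circle_def)
  qed
  also have "\<dots> = 3 * (20 * real K) powr s * Hs_norm s \<Phi>" by (simp add: field_simps)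
  also have "\<dots> \<le> 3 * (160 * ?g\<^sup>2 * \<beta> ^ 8 * (1 + \<bar>t\<bar>)\<^sup>2) powr s * Hs_norm s \<Phi>"
  proof (intro mult_right_mono mult_left_mono powr_mono2 s_nonneg)
    have "20 * real K \<le> 20 * (2 * y\<^sup>2)" using K(2) y2 by simp
    also have "\<dots> = 160 * ?g\<^sup>2 * \<beta> ^ 8 * (1 + \<bar>t\<bar>)\<^sup>2"
      unfolding y_def by (simp add: power_mult_distrib power_mult[symmetric])
    finally show "20 * real K \<le> 160 * ?g\<^sup>2 * \<beta> ^ 8 * (1 + \<bar>t\<bar>)\<^sup>2" .
    show "0 \<le> Hs_norm s \<Phi>" unfolding Hs_norm_def by (intro real_sqrt_ge_zero infsum_nonneg) simp
  qed auto
  also have "(160 * ?g\<^sup>2 * \<beta> ^ 8 * (1 + \<bar>t\<bar>)\<^sup>2) powr s = (160 * ?g\<^sup>2 * \<beta> ^ 8) powr s * (1 + \<bar>t\<bar>) powr (2 * s)"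
  proof -
    have "((1 + \<bar>t\<bar>)\<^sup>2) powr s = (1 + \<bar>t\<bar>) powr (2 * s)"
      using powr_powr[of "1 + \<bar>t\<bar>" 2 s] by (simp add: powr_numeral)
    then show ?thesis using \<beta> by (subst powr_mult) auto
  qed
  finally show ?thesis unfolding \<beta>_def by (simp only: mult.assoc)
qed

end

theorem theorem1p4:
  fixes lam :: "real \<Rightarrow> real" and s :: real
  assumes "smooth_circle lam" and "\<forall>x. 0 \<le> lam x" and "1 \<le> s"
  shows "\<exists>\<epsilon>\<^sub>0>0. \<forall>\<epsilon>. 0 < \<epsilon> \<and> \<epsilon> < \<epsilon>\<^sub>0 \<longrightarrow>
    (\<exists>C :: real \<Rightarrow> real \<Rightarrow> real.
       continuous_on UNIV (\<lambda>(E, M). C E M) \<and> (\<forall>E M. 0 < C E M) \<and>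
       (\<forall>\<Phi> \<in> Hs_circle s. \<forall>u. global_NLS_solution lam s \<Phi> u \<longrightarrow>
          (\<forall>t. Hs_norm s (u t) \<le>
             C (energy lam \<Phi>) (mass \<Phi>) * (1 + \<bar>t\<bar>) powr (2 * s + \<epsilon>) * Hs_norm s \<Phi>)))"
\<comment> \<open>The threshold 1 is an arbitrary choice: as \<open>1 + \<bar>t\<bar>\<close> is at
  least 1, raising the exponent from \<open>2 * s\<close> only weakens the bound.\<close>
proof (intro exI[of _ "1 :: real"] conjI allI impI)
  fix \<epsilon> :: real assume \<epsilon>: "0 < \<epsilon> \<and> \<epsilon> < 1"
  obtain G where G: "potential (fc (\<lambda>x. complex_of_real (lam x))) s G" using smooth_potential[OF assms(1,3)] .
  obtain B where B: "\<And>x. \<bar>lam x\<bar> \<le> B" using smooth_bounded_UNIV[OF assms(1)] by blast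
  interpret nls lam s G B
  proof (rule nls.intro)
    show "lam \<in> borel_measurable borel"
      using smooth_continuous[OF assms(1), of 0] by (intro borel_measurable_continuous_onI) simp
    show "0 \<le> lam x" for x using assms(2) by blast
    show "lam x \<le> B" for x using B[of x] by linarith
    show "potential (fc (\<lambda>x. complex_of_real (lam x))) s G" by (rule G)
  qed
  \<comment> \<open>The absolute values and the summand 1 keep the base of the power positive for
    all real arguments, so the function is continuous and positive on the whole plane.\<close>
  let ?C = "\<lambda>E M. 3 * (160 * growth_const\<^sup>2 * (1 + \<bar>E\<bar> + \<bar>M\<bar>) ^ 8) powr s"
  have pos: "0 < 160 * growth_const\<^sup>2 * (1 + \<bar>E\<bar> + \<bar>M\<bar>) ^ 8" for E M :: real
  proof -
    have "0 < 1 + \<bar>E\<bar> + \<bar>M\<bar>" by linarith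
    moreover have "0 < growth_const" using growth_const_ge by linarith
    ultimately show ?thesis by simp
  qed
  show "\<exists>C :: real \<Rightarrow> real \<Rightarrow> real. continuous_on UNIV (\<lambda>(E, M). C E M) \<and> (\<forall>E M. 0 < C E M) \<and>
       (\<forall>\<Phi> \<in> Hs_circle s. \<forall>u. global_NLS_solution lam s \<Phi> u \<longrightarrow>
          (\<forall>t. Hs_norm s (u t) \<le>
             C (energy lam \<Phi>) (mass \<Phi>) * (1 + \<bar>t\<bar>) powr (2 * s + \<epsilon>) * Hs_norm s \<Phi>))"
  proof (intro exI[of _ ?C] conjI allI ballI impI)
    have "160 * growth_const\<^sup>2 * (1 + \<bar>fst p\<bar> + \<bar>snd p\<bar>) ^ 8 \<noteq> 0" for p :: "real \<times> real"
      using pos[of "fst p" "snd p"] by linarith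
    then show "continuous_on UNIV (\<lambda>(E, M). ?C E M)"
      unfolding split_beta by (intro continuous_intros) auto
    show "0 < ?C E M" for E M
      unfolding zero_less_mult_iff[of 3] powr_gt_zero using less_imp_neq[OF pos[of E M]] by argo
    fix \<Phi> u t assume \<Phi>: "\<Phi> \<in> Hs_circle s" and u: "global_NLS_solution lam s \<Phi> u"
    interpret nls_flow lam s G B \<Phi> u by unfold_locales (rule \<Phi>, rule u)
    have "0 \<le> Hs_norm s \<Phi>" unfolding Hs_norm_def by (intro real_sqrt_ge_zero infsum_nonneg) simp
    moreover have "(1 + \<bar>t\<bar>) powr (2 * s) \<le> (1 + \<bar>t\<bar>) powr (2 * s + \<epsilon>)" using \<epsilon> by (intro powr_mono) auto
    ultimately have "?C (energy lam \<Phi>) (mass \<Phi>) * (1 + \<bar>t\<bar>) powr (2 * s) * Hs_norm s \<Phi> \<le>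
      ?C (energy lam \<Phi>) (mass \<Phi>) * (1 + \<bar>t\<bar>) powr (2 * s + \<epsilon>) * Hs_norm s \<Phi>"
      by (intro mult_right_mono mult_left_mono) auto
    then show "Hs_norm s (u t) \<le> ?C (energy lam \<Phi>) (mass \<Phi>) * (1 + \<bar>t\<bar>) powr (2 * s + \<epsilon>) * Hs_norm s \<Phi>"
      using Hs_growth[of t] by linarith
  qed
qed simp

end
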